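(* Assume $v_\circ<v_\bullet$. Then for every $v_\star\in[v_\circ,v_\bullet)$ there exist $\rho_\star=\rho_\star(v_\circ,v_\bullet,v_\star)\in(0,\infty)$ and $c=c(v_\circ,v_\bullet,v_\star)\in(0,\infty)$ such that for all $\rho\ge\rho_\star$, $\mathbb P^\rho(\exists\, n\in\mathbb N: X_n<nv_\star-L)\le c^{-1}e^{-c\log^{3/2}L}$ for all $L\in\mathbb N$.
   Context: Fix $q\in(0,1)$ and $p_\circ,p_\bullet\in[0,1]$; put $v_\circ=2p_\circ-1$, $v_\bullet=2p_\bullet-1$. A lazy simple random walk on $\mathbb Z$ has i.i.d. steps equal to $-1,0,1$ with probabilities $\frac{1-q}{2},q,\frac{1-q}{2}$. Let $W$ be the set of two-sided paths $w=(w(n))_{n\in\mathbb Z}$ in $\mathbb Z$ with $|w(n+1)-w(n)|\le 1$; let $P_x$ be the law on $W$ of a two-sided lazy simple random walk with $w(0)=x$, and $\mu=\sum_{x\in\mathbb Z}P_x$. For $\rho\in(0,\infty)$, under $\mathbb P^\rho$ one has a Poisson point process $\omega=\sum_j\delta_{w_j}$ on $W$ with intensity $\rho\mu$ and, independently, i.i.d. uniform $[0,1]$ variables $U=(U_y)_{y\in\mathbb Z^2}$. Space-time points are $y=(x,n)\in\mathbb Z^2$. Let $\mathcal T=\{(w_j(n),n): j,\ n\in\mathbb Z\}$. For $y\in\mathbb Z^2$ define $Y^y_0=y$, $Y^y_{i+1}=Y^y_i+(1,1)$ if ($Y^y_i\in\mathcal T$ and $U_{Y^y_i}\le p_\bullet$)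 or ($Y^y_i\notin\mathcal T$ and $U_{Y^y_i}\le p_\circ$), and $Y^y_{i+1}=Y^y_i+(-1,1)$ otherwise; $X^y$ is the spatial coordinate of $Y^y$, $X=X^{(0,0)}$. *)

theory Defs
  imports "HOL-Probability.Probability"
begin

definition lazy_step_pmf :: "real \<Rightarrow> int pmf" where
  "lazy_step_pmf q =
     bind_pmf (bernoulli_pmf q) (\<lambda>b. if b then return_pmf 0
        else map_pmf (\<lambda>s. if s then 1 else -1) (bernoulli_pmf (1/2)))"

text \<open>Sample point: (N, xi, U) where
  N x = number of PPP walks with w(0) = x (i.i.d. Poisson(rho)),
  xi (x,k,n) = step w(n+1) - w(n) of the k-th walk started at x (i.i.d. lazy steps),
  U y = uniform [0,1] variable at space-time point y.\<close>
type_synonym sample = "((int \<Rightarrow> nat) \<times> (int \<times> nat \<times> int \<Rightarrow> int)) \<times> (int \<times> int \<Rightarrow> real)"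

definition env_measure :: "real \<Rightarrow> real \<Rightarrow> sample measure" where
  "env_measure q \<rho> =
     (PiM UNIV (\<lambda>x::int. measure_pmf (poisson_pmf \<rho>))
        \<Otimes>\<^sub>M PiM UNIV (\<lambda>_::int \<times> nat \<times> int. measure_pmf (lazy_step_pmf q)))
     \<Otimes>\<^sub>M PiM UNIV (\<lambda>_::int \<times> int. uniform_measure lborel {0..1::real})"

definition walk_path :: "(int \<times> nat \<times> int \<Rightarrow> int) \<Rightarrow> int \<Rightarrow> nat \<Rightarrow> int \<Rightarrow> int" where
  "walk_path xi x k n =
     (if 0 \<le> n then x + (\<Sum>i\<in>{0..<n}. xi (x, k, i))
      else x - (\<Sum>i\<in>{n..<0}. xi (x, k, i)))"

definition trace :: "sample \<Rightarrow> (int \<times> int) set" where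
  "trace \<omega> = {(walk_path (snd (fst \<omega>)) x k n, n) | x k n. k < fst (fst \<omega>) x}"

primrec Ywalk :: "real \<Rightarrow> real \<Rightarrow> sample \<Rightarrow> int \<times> int \<Rightarrow> nat \<Rightarrow> int \<times> int" where
  "Ywalk p_o p_b \<omega> y 0 = y"
| "Ywalk p_o p_b \<omega> y (Suc i) =
     (let z = Ywalk p_o p_b \<omega> y i; U = snd \<omega> in
      if (z \<in> trace \<omega> \<and> U z \<le> p_b) \<or> (z \<notin> trace \<omega> \<and> U z \<le> p_o)
      then (fst z + 1, snd z + 1) else (fst z - 1, snd z + 1))"

definition Xwalk :: "real \<Rightarrow> real \<Rightarrow> sample \<Rightarrow> nat \<Rightarrow> int" where
  "Xwalk p_o p_b \<omega> n = fst (Ywalk p_o p_b \<omega> (0, 0) n)"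

end

theory Submission
  imports Defs
begin

text \<open>If the walker visits at most \<open>2 \<delta> n\<close> vacant sites before time \<open>n\<close>, then \<open>X\<^sub>n\<close> is at least a sum of
  \<open>n\<close> independent steps of mean \<open>v\<^sub>\<bullet>\<close> minus \<open>4 \<delta> n\<close>, and Hoeffding's lemma controls that sum. So it
  suffices that, when \<open>\<rho>\<close> is large, no nearest-neighbour path of length \<open>n\<close> meets more than a small
  fraction of vacant sites. This is shown along the scales \<open>L\<^sub>k\<^sub>+\<^sub>1 = L\<^sub>k\<^sup>4\<close>: a bad path at scale \<open>k + 1\<close>
  contains 16 bad paths at scale \<open>k\<close> separated by time gaps of order \<open>L\<^sub>k\<^sup>3\<close>.
  Events separated in time decouple exactly, at the price of lowering the density: the walks missing
  the earlier region are independent of those hitting it, and by the Markov property and the local limit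
  bound they still form an environment of density at least \<open>\<rho> (1 - \<epsilon>)\<close> in the later region, with
  \<open>\<epsilon>\<close> of order \<open>L\<^sub>k\<^sup>-\<^sup>1\<^sup>/\<^sup>2\<close>. Hence the bad probabilities satisfy
  \<open>p\<^sub>k\<^sub>+\<^sub>1 \<le> (6 L\<^sub>k\<^sub>+\<^sub>1\<^sup>2 p\<^sub>k)\<^sup>1\<^sup>6\<close>, which yields decay like \<open>exp (- c 8\<^sup>k)\<close>, that is,
  \<open>exp (- c log\<^sup>3\<^sup>/\<^sup>2 L)\<close> at \<open>L = L\<^sub>k\<close>.\<close>

section \<open>Independence of disjoint coordinates in product measures\<close>

text \<open>The obstacle is that the cloud forgets slowly: one walk links distant times, and
  correlations decay only like a power of the gap. Vacancy, however, is a decreasing event, so in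
  the later region the walks that also hit the earlier one can simply be discarded; this makes the
  comparison of densities one-sided. The losses of density are summable over the scales, and so is
  the fraction of order \<open>L^2 / L^3\<close> of slots given up for spacing, hence both stay
  within a factor 2 in total. The quantifier over paths is part of the bad event, so the union bound
  runs only over the 16 starting points of the bad pieces. In exponents of the base scale B this
  entropy is of order \<open>4^k\<close> per piece, and the target decay
  \<open>8^k = (4^k)^(3/2)\<close> dictates the rate; 16 pieces reproduce it with a surplus after
  the entropy is paid. Since badness speaks of all paths at once, the environment can be fixed
  before the coins U are examined.\<close>

lemma nn_integral_PiM_prod_disjoint:
  fixes f :: "'j \<Rightarrow> ('i \<Rightarrow> 'a) \<Rightarrow> ennreal"
  assumes N: "\<And>i. prob_space (N i)" "\<And>i. space (N i) = UNIV"
    and J: "finite J" "disjoint_family_on K J"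
    and f: "\<And>j. j \<in> J \<Longrightarrow> f j \<in> borel_measurable (PiM UNIV N)"
    and dep: "\<And>j \<omega> \<omega>'. j \<in> J \<Longrightarrow> (\<And>i. i \<in> K j \<Longrightarrow> \<omega> i = \<omega>' i) \<Longrightarrow> f j \<omega> = f j \<omega>'"
  shows "(\<integral>\<^sup>+\<omega>. (\<Prod>j\<in>J. f j \<omega>) \<partial>PiM UNIV N) = (\<Prod>j\<in>J. \<integral>\<^sup>+\<omega>. f j \<omega> \<partial>PiM UNIV N)"
proof -
  let ?M = "PiM UNIV N"
  interpret prob_space ?M by (rule prob_space_PiM) (rule N)
  have "distr ?M (\<Pi>\<^sub>M i\<in>UNIV. N i) (\<lambda>x. \<lambda>i\<in>UNIV. x i) = distr ?M ?M (\<lambda>x. x)"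
    by (intro distr_cong) (auto simp: restrict_UNIV)
  also have "\<dots> = (\<Pi>\<^sub>M i\<in>UNIV. distr ?M (N i) (\<lambda>x. x i))"
    using distr_PiM_component[of UNIV N] N(1) by simp
  finally have "indep_vars N (\<lambda>i \<omega>. \<omega> i) UNIV"
    by (subst indep_vars_iff_distr_eq_PiM') auto
  from indep_vars_restrict[OF this _ J(2)]
  have R: "indep_vars (\<lambda>j. PiM (K j) N) (\<lambda>j \<omega>. restrict (\<lambda>i. \<omega> i) (K j)) J" by simp
  \<comment> \<open>Independence is known for the restrictions to \<open>K j\<close>, whereas
    \<open>f j\<close> lives on the whole product. Padding with \<open>undefined\<close> brings a
    restriction back into its domain, and by \<open>dep\<close> this does not change the
    value.\<close>
  have m: "(\<lambda>\<omega> i. if i \<in> K j then \<omega> i else undefined) \<in> measurable (PiM (K j) N) ?M" for j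
  proof (rule measurable_PiM_single')
    fix i show "(\<lambda>\<omega>. if i \<in> K j then \<omega> i else undefined) \<in> PiM (K j) N \<rightarrow>\<^sub>M N i"
      by (cases "i \<in> K j") (use N in auto)
  qed (use N in auto)
  have "indep_vars (\<lambda>_. borel) (\<lambda>j \<omega>. (\<lambda>\<omega>. f j (\<lambda>i. if i \<in> K j then \<omega> i else undefined)) (restrict (\<lambda>i. \<omega> i) (K j))) J"
    by (rule indep_vars_compose2[OF R]) (rule measurable_compose[OF m f])
  then have "(\<integral>\<^sup>+\<omega>. (\<Prod>j\<in>J. f j (\<lambda>i. if i \<in> K j then restrict \<omega> (K j) i else undefined)) \<partial>?M)
    = (\<Prod>j\<in>J. \<integral>\<^sup>+\<omega>. f j (\<lambda>i. if i \<in> K j then restrict \<omega> (K j) i else undefined) \<partial>?M)"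
    by (rule indep_vars_nn_integral[OF J(1)]) auto
  moreover have "f j (\<lambda>i. if i \<in> K j then restrict \<omega> (K j) i else undefined) = f j \<omega>" if "j \<in> J" for j \<omega>
    by (rule dep[OF that]) auto
  ultimately show ?thesis by simp
qed

lemma emeasure_PiM_Int_disjoint:
  fixes P Q :: "('i \<Rightarrow> 'a) \<Rightarrow> bool"
  assumes N: "\<And>i. prob_space (N i)" "\<And>i. space (N i) = UNIV"
    and AB: "A \<inter> B = {}"
    and [measurable]: "Measurable.pred (PiM UNIV N) P" "Measurable.pred (PiM UNIV N) Q"
    and dP: "\<And>\<omega> \<omega>'. (\<And>i. i \<in> A \<Longrightarrow> \<omega> i = \<omega>' i) \<Longrightarrow> P \<omega> = P \<omega>'"
    and dQ: "\<And>\<omega> \<omega>'. (\<And>i. i \<in> B \<Longrightarrow> \<omega> i = \<omega>' i) \<Longrightarrow> Q \<omega> = Q \<omega>'"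
  shows "emeasure (PiM UNIV N) {\<omega>. P \<omega> \<and> Q \<omega>} = emeasure (PiM UNIV N) {\<omega>. P \<omega>} * emeasure (PiM UNIV N) {\<omega>. Q \<omega>}"
proof -
  let ?M = "PiM UNIV N"
  have sp: "space ?M = UNIV" using N(2) by (auto simp: space_PiM)
  have m1: "{\<omega>. P \<omega>} \<in> sets ?M" using measurable_sets[OF assms(4), of "{True}"] sp by (auto simp: vimage_def)
  have m2: "{\<omega>. Q \<omega>} \<in> sets ?M" using measurable_sets[OF assms(5), of "{True}"] sp by (auto simp: vimage_def)
  have m3: "{\<omega>. P \<omega> \<and> Q \<omega>} \<in> sets ?M" using sets.Int[OF m1 m2] by (simp add: Collect_conj_eq)
  define F :: "bool \<Rightarrow> ('i \<Rightarrow> 'a) \<Rightarrow> ennreal"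
    where "F j \<omega> = (if j then indicator {\<omega>. P \<omega>} \<omega> else indicator {\<omega>. Q \<omega>} \<omega>)" for j \<omega>
  have "(\<integral>\<^sup>+\<omega>. (\<Prod>j\<in>(UNIV::bool set). F j \<omega>) \<partial>?M) = (\<Prod>j\<in>(UNIV::bool set). \<integral>\<^sup>+\<omega>. F j \<omega> \<partial>?M)"
  proof (rule nn_integral_PiM_prod_disjoint[where K="\<lambda>j. if j then A else B"])
    show "disjoint_family_on (\<lambda>j. if j then A else B) UNIV" using AB by (auto simp: disjoint_family_on_def)
    fix j :: bool and \<omega> \<omega>' :: "'i \<Rightarrow> 'a" assume *: "\<And>i. i \<in> (if j then A else B) \<Longrightarrow> \<omega> i = \<omega>' i"
    show "F j \<omega> = F j \<omega>'"
      using dP[of \<omega> \<omega>'] dQ[of \<omega> \<omega>'] * by (auto simp: F_def indicator_def split: if_splits)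
  next
    fix j show "F j \<in> borel_measurable ?M"
      unfolding F_def using m1 m2 by (cases j) (simp_all add: sp)
  qed (use N in auto)
  then have "(\<integral>\<^sup>+\<omega>. indicator {\<omega>. P \<omega>} \<omega> * indicator {\<omega>. Q \<omega>} \<omega> \<partial>?M) = (\<integral>\<^sup>+\<omega>. indicator {\<omega>. P \<omega>} \<omega> \<partial>?M) * (\<integral>\<^sup>+\<omega>. indicator {\<omega>. Q \<omega>} \<omega> \<partial>?M)"
    by (simp add: UNIV_bool F_def mult.commute)
  also have "(\<lambda>\<omega>. indicator {\<omega>. P \<omega>} \<omega> * indicator {\<omega>. Q \<omega>} \<omega> :: ennreal) = indicator {\<omega>. P \<omega> \<and> Q \<omega>}"
    by (auto simp: indicator_def)
  finally show ?thesis using m1 m2 m3 by simp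
qed

section \<open>Local bounds for the lazy walk\<close>

primrec srw :: "nat \<Rightarrow> int \<Rightarrow> real" where
  "srw 0 u = of_bool (u = 0)"
| "srw (Suc j) u = (srw j (u - 1) + srw j (u + 1)) / 2"

text \<open>To end at u after j steps, (u + j) / 2 of them must go up, and the recursion becomes
  Pascal's rule. For u > j the binomial coefficient is 0, so no upper guard appears.\<close>

lemma srw_eq_binomial:
  "srw j u = (if even (u + int j) \<and> 0 \<le> u + int j then real (j choose nat ((u + int j) div 2)) / 2 ^ j else 0)"
proof (induction j arbitrary: u)
  case 0
  show ?case by (cases "u = 0") (auto elim!: evenE)
next
  case (Suc j)
  show ?case
  proof (cases "even (u + int (Suc j)) \<and> 0 \<le> u + int (Suc j)")
    case True
    then obtain i where i: "u + int (Suc j) = 2 * i" by blast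
    with True have "i \<ge> 0" by simp
    then obtain n where n: "i = int n" using nonneg_int_cases by blast
    have e: "u - 1 + int j = 2 * (int n - 1)" "u + 1 + int j = 2 * int n" using i n by simp_all
    show ?thesis
    proof (cases n)
      case 0
      then have "u = - 1 - int j" using i n by simp
      then show ?thesis by (simp add: Suc.IH)
    next
      case (Suc m)
      have "srw (Suc j) u = (real (j choose m) / 2 ^ j + real (j choose n) / 2 ^ j) / 2"
        unfolding srw.simps Suc.IH e by (simp add: Suc nat_add_distrib)
      also have "\<dots> = real (Suc j choose n) / 2 ^ Suc j" by (simp add: Suc add_divide_distrib)
      finally show ?thesis using i n by simp
    qed
  next
    case False
    have "srw j (u - 1) = 0" "srw j (u + 1) = 0" using False by (auto simp: Suc.IH)
    then show ?thesis using False by auto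
  qed
qed

lemma central_binomial_step:
  "Suc n * ((2 * Suc n) choose Suc n) = 2 * (2 * n + 1) * ((2 * n) choose n)"
proof -
  have "Suc (2 * n) * ((2 * n) choose n) = (Suc (2 * n) choose Suc n) * Suc n"
    by (rule Suc_times_binomial_eq)
  moreover have "(2 * Suc n) choose Suc n = 2 * (Suc (2 * n) choose Suc n)"
    using binomial_symmetric[of n "Suc (2 * n)"] by simp
  ultimately show ?thesis by (simp add: algebra_simps del: binomial_Suc_Suc)
qed

text \<open>The left side starts at 1 and decreases in n: consecutive values have ratio (2n + 1)(2n
  + 3) / (2n + 2)^2 < 1. This replaces Stirling's formula.\<close>

lemma central_binomial_le:
  "(real ((2 * n) choose n) / 4 ^ n)\<^sup>2 * (2 * real n + 1) \<le> 1"
proof (induction n)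
  case (Suc n)
  define c where "c = real ((2 * n) choose n) / 4 ^ n"
  have "real (Suc n) * real ((2 * Suc n) choose Suc n) = 2 * (2 * real n + 1) * real ((2 * n) choose n)"
    using arg_cong[OF central_binomial_step[of n], of real] by (simp add: algebra_simps)
  then have "real ((2 * Suc n) choose Suc n) = 2 * (2 * real n + 1) * real ((2 * n) choose n) / real (Suc n)"
    by (metis nonzero_mult_div_cancel_left of_nat_0 of_nat_eq_iff nat.distinct(1))
  then have "real ((2 * Suc n) choose Suc n) / 4 ^ Suc n = c * ((2 * real n + 1) / (2 * real n + 2))"
    unfolding c_def by (simp add: divide_simps del: binomial_Suc_Suc) (simp add: algebra_simps del: binomial_Suc_Suc)
  then have "(real ((2 * Suc n) choose Suc n) / 4 ^ Suc n)\<^sup>2 * (2 * real (Suc n) + 1)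
     = (c\<^sup>2 * (2 * real n + 1)) * ((2 * real n + 1) * (2 * real n + 3) / (2 * real n + 2)\<^sup>2)"
    by (simp add: power_mult_distrib power_divide power2_eq_square del: binomial_Suc_Suc)
  also have "\<dots> \<le> 1 * 1"
  proof (rule mult_mono)
    show "c\<^sup>2 * (2 * real n + 1) \<le> 1" using Suc.IH by (simp add: c_def)
    show "(2 * real n + 1) * (2 * real n + 3) / (2 * real n + 2)\<^sup>2 \<le> 1"
      by (subst divide_le_eq_1_pos, intro zero_less_power) (auto simp: power2_eq_square algebra_simps)
  qed auto
  finally show ?case by simp
qed simp

text \<open>The middle coefficient dominates its row. For odd j = 2n + 1 it is half of the central
  coefficient of row 2n + 2, so the even bound serves both parities.\<close>

lemma srw_le: "srw j u \<le> 1 / sqrt (real j + 1)"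
proof -
  have "srw j u \<le> real (j choose (j div 2)) / 2 ^ j"
    unfolding srw_eq_binomial by (auto intro!: divide_right_mono binomial_maximum)
  also have "\<dots> \<le> 1 / sqrt (real j + 1)"
  proof (rule power2_le_imp_le)
    have "(real (j choose (j div 2)) / 2 ^ j)\<^sup>2 * (real j + 1) \<le> 1"
    proof (cases "even j")
      case True
      then obtain n where "j = 2 * n" by blast
      then show ?thesis using central_binomial_le[of n] by (simp add: power_mult)
    next
      case False
      then obtain n where j: "j = 2 * n + 1" using oddE by blast
      have "(2 * Suc n) choose Suc n = 2 * (Suc (2 * n) choose n)"
        using binomial_symmetric[of n "Suc (2 * n)"] by simp
      then have "real (j choose (j div 2)) / 2 ^ j = real ((2 * Suc n) choose Suc n) / 4 ^ Suc n"
        by (simp add: j power_mult del: binomial_Suc_Suc)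
      then show ?thesis using central_binomial_le[of "Suc n"]
        by (simp add: j mult.commute algebra_simps del: binomial_Suc_Suc)
          (smt (verit) mult_left_mono zero_le_power2)
    qed
    then show "(real (j choose (j div 2)) / 2 ^ j)\<^sup>2 \<le> (1 / sqrt (real j + 1))\<^sup>2"
      by (simp add: power_divide pos_le_divide_eq)
  qed simp
  finally show ?thesis .
qed

section \<open>Lazy walk: averaging over the number of moving steps\<close>

primrec lazy_prob :: "real \<Rightarrow> nat \<Rightarrow> int \<Rightarrow> real" where
  "lazy_prob q 0 u = of_bool (u = 0)"
| "lazy_prob q (Suc n) u = q * lazy_prob q n u + (1 - q) / 2 * (lazy_prob q n (u - 1) + lazy_prob q n (u + 1))"

text \<open>\<open>n\<close> lazy steps followed by \<open>j\<close> simple ones: this exhibits the lazy walk as a simple walk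
  observed at a binomial time.\<close>

primrec mixed_prob :: "real \<Rightarrow> nat \<Rightarrow> nat \<Rightarrow> int \<Rightarrow> real" where
  "mixed_prob q 0 j u = srw j u"
| "mixed_prob q (Suc n) j u = q * mixed_prob q n j u + (1 - q) * mixed_prob q n (Suc j) u"

text \<open>Lazy and simple steps commute as convolutions, so one simple step can be peeled off on
  the outside. This matches the recursion of \<open>lazy_prob\<close> with that of
  \<open>mixed_prob\<close>.\<close>

lemma mixed_prob_Suc: "mixed_prob q n (Suc j) u = (mixed_prob q n j (u - 1) + mixed_prob q n j (u + 1)) / 2"
  by (induction n arbitrary: j u) (auto simp: field_simps)

lemma lazy_prob_eq_mixed: "lazy_prob q n u = mixed_prob q n 0 u"
  by (induction n arbitrary: u) (auto simp: mixed_prob_Suc)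

text \<open>Conditioning a binomial average on one trial. It has the shape of the recursion of
  \<open>mixed_prob\<close>, so that \<open>mixed_prob_le\<close> goes through by induction.\<close>

lemma binomial_average_Suc:
  fixes p q :: real and d :: "nat \<Rightarrow> real"
  shows "(\<Sum>M\<le>Suc n. real (Suc n choose M) * p ^ M * q ^ (Suc n - M) * d M) =
    q * (\<Sum>M\<le>n. real (n choose M) * p ^ M * q ^ (n - M) * d M) +
    p * (\<Sum>M\<le>n. real (n choose M) * p ^ M * q ^ (n - M) * d (Suc M))"
proof -
  have "(\<Sum>M\<le>Suc n. real (Suc n choose M) * p ^ M * q ^ (Suc n - M) * d M) =
     q ^ Suc n * d 0 + (\<Sum>M\<le>n. real (Suc n choose Suc M) * p ^ Suc M * q ^ (n - M) * d (Suc M))"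
    by (subst sum.atMost_Suc_shift) simp
  also have "(\<Sum>M\<le>n. real (Suc n choose Suc M) * p ^ Suc M * q ^ (n - M) * d (Suc M)) =
    (\<Sum>M\<le>n. real (n choose Suc M) * p ^ Suc M * q ^ (n - M) * d (Suc M)) +
    p * (\<Sum>M\<le>n. real (n choose M) * p ^ M * q ^ (n - M) * d (Suc M))"
    by (simp add: sum.distrib[symmetric] sum_distrib_left algebra_simps)
  also have "q ^ Suc n * d 0 + ((\<Sum>M\<le>n. real (n choose Suc M) * p ^ Suc M * q ^ (n - M) * d (Suc M)) + X)
    = (\<Sum>M\<le>Suc n. real (n choose M) * p ^ M * q ^ (Suc n - M) * d M) + X" for X
    by (subst sum.atMost_Suc_shift) simp
  also have "(\<Sum>M\<le>Suc n. real (n choose M) * p ^ M * q ^ (Suc n - M) * d M) =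
     q * (\<Sum>M\<le>n. real (n choose M) * p ^ M * q ^ (n - M) * d M)"
    by (simp add: sum_distrib_left Suc_diff_le algebra_simps)
  finally show ?thesis .
qed

lemma mixed_prob_le:
  assumes "0 \<le> q" "q \<le> 1"
  shows "mixed_prob q n j u \<le> (\<Sum>M\<le>n. real (n choose M) * (1 - q) ^ M * q ^ (n - M) * (1 / sqrt (real (j + M) + 1)))"
proof (induction n arbitrary: j u)
  case 0
  show ?case using srw_le[of j u] by simp
next
  case (Suc n)
  show ?case
    unfolding mixed_prob.simps binomial_average_Suc
    using Suc.IH[of j u] Suc.IH[of "Suc j" u] assms
    by (intro add_mono mult_left_mono) auto
qed

text \<open>The absorption identity turns the weight of M for n trials, divided by M + 1, into a
  multiple of the weight of M + 1 for n + 1 trials, and these weights sum to at most 1.\<close>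

lemma binomial_average_inverse_le:
  fixes q :: real
  assumes "0 < q" "q < 1"
  shows "(\<Sum>M\<le>n. real (n choose M) * (1 - q) ^ M * q ^ (n - M) / (real M + 1)) \<le> 1 / ((1 - q) * (real n + 1))"
proof -
  define p where "p = 1 - q"
  have p: "0 < p" "p + q = 1" using assms by (auto simp: p_def)
  have *: "real (n choose M) / (real M + 1) = real (Suc n choose Suc M) / (real n + 1)" for M
  proof -
    have "real (Suc n) * real (n choose M) = real (Suc n choose Suc M) * real (Suc M)"
      using arg_cong[OF Suc_times_binomial_eq[of n M], of real] by (simp only: of_nat_mult)
    then show ?thesis by (simp add: field_simps del: binomial_Suc_Suc)
  qed
  have "(\<Sum>M\<le>n. real (n choose M) * p ^ M * q ^ (n - M) / (real M + 1)) * (p * (real n + 1)) =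
     (\<Sum>M\<le>n. real (Suc n choose Suc M) * p ^ Suc M * q ^ (n - M))"
    unfolding sum_distrib_right
  proof (rule sum.cong)
    fix M
    have "real (n choose M) * p ^ M * q ^ (n - M) / (real M + 1) * (p * (real n + 1))
      = (real (n choose M) / (real M + 1)) * (real n + 1) * p ^ Suc M * q ^ (n - M)" by simp
    also have "\<dots> = real (Suc n choose Suc M) * p ^ Suc M * q ^ (n - M)"
      unfolding * by (simp del: binomial_Suc_Suc)
    finally show "real (n choose M) * p ^ M * q ^ (n - M) / (real M + 1) * (p * (real n + 1)) =
       real (Suc n choose Suc M) * p ^ Suc M * q ^ (n - M)" .
  qed simp
  also have "\<dots> \<le> (\<Sum>M\<le>Suc n. real (Suc n choose M) * p ^ M * q ^ (Suc n - M))"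
    by (subst sum.atMost_Suc_shift) (use assms p in simp)
  also have "\<dots> = (p + q) ^ Suc n" by (rule binomial_ring[symmetric])
  finally show ?thesis using p by (simp add: pos_le_divide_eq p_def)
qed

text \<open>In place of Jensen's inequality: 2 / sqrt (M + 1) \<le> s / (M + 1) + 1 / s for every s
  > 0, by expanding a square. With s^2 = (1 - q)(n + 1) the averages of the two terms are at most 1
  / s each.\<close>

lemma lazy_prob_le:
  assumes "0 < q" "q < 1"
  shows "lazy_prob q n u \<le> 1 / sqrt ((1 - q) * (real n + 1))"
proof -
  define s where "s = sqrt ((1 - q) * (real n + 1))"
  have s: "s > 0" "s\<^sup>2 = (1 - q) * (real n + 1)" using assms by (auto simp: s_def)
  let ?w = "\<lambda>M. real (n choose M) * (1 - q) ^ M * q ^ (n - M)"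
  have "lazy_prob q n u \<le> (\<Sum>M\<le>n. ?w M * (1 / sqrt (real M + 1)))"
    using mixed_prob_le[of q n 0 u] assms by (simp add: lazy_prob_eq_mixed)
  also have "\<dots> \<le> (\<Sum>M\<le>n. ?w M * ((s / (real M + 1) + 1 / s) / 2))"
  proof (intro sum_mono mult_left_mono)
    fix M
    define d where "d = 1 / sqrt (real M + 1)"
    have d: "1 / (real M + 1) = d\<^sup>2" by (simp add: d_def power_divide)
    have "s * (s * d\<^sup>2 + 1 / s - 2 * d) = (s * d - 1)\<^sup>2" using s by (simp add: power2_eq_square field_simps)
    then have "0 \<le> s * (s * d\<^sup>2 + 1 / s - 2 * d)" by simp
    then have "0 \<le> s * d\<^sup>2 + 1 / s - 2 * d" using s by (simp add: zero_le_mult_iff)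
    moreover have "s / (real M + 1) = s * d\<^sup>2" using d by (simp add: field_simps)
    ultimately show "1 / sqrt (real M + 1) \<le> (s / (real M + 1) + 1 / s) / 2"
      unfolding d_def[symmetric] by simp
  qed (use assms in auto)
  also have "\<dots> = s / 2 * (\<Sum>M\<le>n. ?w M / (real M + 1)) + 1 / (2 * s) * (\<Sum>M\<le>n. ?w M)"
    unfolding sum_distrib_left sum.distrib[symmetric]
    by (rule sum.cong) (simp_all add: add_divide_distrib distrib_left mult_ac)
  also have "(\<Sum>M\<le>n. ?w M) = 1"
    using binomial_ring[of "1 - q" q n] by simp
  also have "s / 2 * (\<Sum>M\<le>n. ?w M / (real M + 1)) \<le> s / 2 * (1 / s\<^sup>2)"
    using binomial_average_inverse_le[OF assms, of n] s by (intro mult_left_mono) auto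
  also have "s / 2 * (1 / s\<^sup>2) + 1 / (2 * s) * 1 = 1 / s" using s by (simp add: field_simps power2_eq_square)
  finally show ?thesis unfolding s_def by simp
qed

section \<open>Two-sided walks and their intensity measure\<close>

lemma sets_Collect_UNIV: "space M = UNIV \<Longrightarrow> Measurable.pred M P \<Longrightarrow> {x. P x} \<in> sets M"
  by (simp add: pred_def)

definition steps :: "real \<Rightarrow> (int \<Rightarrow> int) measure" where
  "steps q = PiM UNIV (\<lambda>_. measure_pmf (lazy_step_pmf q))"

text \<open>For every n at least one of the two intervals is empty, so one formula covers both
  directions of time.\<close>

definition traj :: "(int \<Rightarrow> int) \<Rightarrow> int \<Rightarrow> int \<Rightarrow> int" where
  "traj \<xi> x n = x + sum \<xi> {0..<n} - sum \<xi> {n..<0}"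

definition traj_graph :: "(int \<Rightarrow> int) \<Rightarrow> int \<Rightarrow> (int \<times> int) set" where
  "traj_graph \<xi> x = {z. traj \<xi> x (snd z) = fst z}"

text \<open>The infinite intensity measure \<mu>: a path is coded by its position at time 0 and its
  two-sided sequence of steps.\<close>

definition walks :: "real \<Rightarrow> (int \<times> (int \<Rightarrow> int)) measure" where
  "walks q = count_space UNIV \<Otimes>\<^sub>M steps q"

lemma walk_path_eq_traj: "walk_path xi x k n = traj (\<lambda>i. xi (x, k, i)) x n"
  by (auto simp: walk_path_def traj_def)

lemma traj_diff:
  assumes "m \<le> n"
  shows "traj \<xi> x n - traj \<xi> x m = sum \<xi> {m..<n}"
proof -
  consider "n \<le> 0" | "m \<le> 0" "0 \<le> n" | "0 \<le> m" using assms by linarith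
  then show ?thesis
  proof cases
    case 1
    then have "{m..<0} = {m..<n} \<union> {n..<0}" using assms by auto
    then have "sum \<xi> {m..<0} = sum \<xi> {m..<n} + sum \<xi> {n..<0}" by (simp add: sum.union_disjoint)
    then show ?thesis using 1 assms by (simp add: traj_def)
  next
    case 2
    then have "{m..<n} = {m..<0} \<union> {0..<n}" by auto
    then have "sum \<xi> {m..<n} = sum \<xi> {m..<0} + sum \<xi> {0..<n}" by (simp add: sum.union_disjoint)
    then show ?thesis using 2 by (simp add: traj_def)
  next
    case 3
    then have "{0..<n} = {0..<m} \<union> {m..<n}" using assms by auto
    then have "sum \<xi> {0..<n} = sum \<xi> {0..<m} + sum \<xi> {m..<n}" by (simp add: sum.union_disjoint)
    then show ?thesis using 3 assms by (simp add: traj_def)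
  qed
qed

lemma traj_shift: "traj \<xi> x n = x + traj \<xi> 0 n"
  by (simp add: traj_def)

lemma prob_space_steps: "prob_space (steps q)"
  unfolding steps_def by (intro prob_space_PiM measure_pmf.prob_space_axioms)

lemma space_steps[simp]: "space (steps q) = UNIV"
  by (simp add: steps_def space_PiM)

lemma space_walks[simp]: "space (walks q) = UNIV"
  by (simp add: walks_def space_pair_measure)

lemma measurable_count_space_combine:
  fixes f :: "'a \<Rightarrow> 'b::countable" and g :: "'a \<Rightarrow> 'c::countable"
  assumes [measurable]: "f \<in> M \<rightarrow>\<^sub>M count_space UNIV" "g \<in> M \<rightarrow>\<^sub>M count_space UNIV"
  shows "(\<lambda>x. h (f x) (g x)) \<in> M \<rightarrow>\<^sub>M count_space UNIV"
proof -
  have "(\<lambda>x. (f x, g x)) \<in> M \<rightarrow>\<^sub>M count_space UNIV \<Otimes>\<^sub>M count_space UNIV" by measurable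
  then have "(\<lambda>x. (f x, g x)) \<in> M \<rightarrow>\<^sub>M count_space UNIV" by (simp add: pair_measure_countable)
  from measurable_compose[OF this, of "\<lambda>(a, b). h a b" "count_space UNIV"] show ?thesis by simp
qed

lemma measurable_sum_count_space:
  fixes f :: "'i \<Rightarrow> 'a \<Rightarrow> int"
  assumes "\<And>i. i \<in> I \<Longrightarrow> f i \<in> M \<rightarrow>\<^sub>M count_space UNIV"
  shows "(\<lambda>x. \<Sum>i\<in>I. f i x) \<in> M \<rightarrow>\<^sub>M count_space UNIV"
  using assms
proof (induction I rule: infinite_finite_induct)
  case (insert i I)
  then show ?case by (simp add: measurable_count_space_combine[where h="(+)"])
qed simp_all

lemma measurable_step[measurable]: "(\<lambda>\<xi>. \<xi> i) \<in> steps q \<rightarrow>\<^sub>M count_space UNIV"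
  unfolding steps_def using measurable_component_singleton[of i UNIV "\<lambda>_. measure_pmf (lazy_step_pmf q)"] by simp

lemma measurable_traj[measurable]:
  assumes [measurable]: "f \<in> M \<rightarrow>\<^sub>M steps q" "g \<in> M \<rightarrow>\<^sub>M count_space UNIV"
  shows "(\<lambda>\<omega>. traj (f \<omega>) (g \<omega>) n) \<in> M \<rightarrow>\<^sub>M count_space UNIV"
proof -
  have "(\<lambda>\<omega>. sum (f \<omega>) I) \<in> M \<rightarrow>\<^sub>M count_space UNIV" for I :: "int set"
    by (rule measurable_sum_count_space) measurable
  then show ?thesis unfolding traj_def
    by (intro measurable_count_space_combine[where h="(-)"] measurable_count_space_combine[where h="(+)"]) auto
qed

text \<open>On a finite S the graph has finitely many possible patterns, so F may be an arbitrary
  predicate.\<close>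

lemma pred_traj_graph_on_finite:
  assumes S: "finite S"
    and [measurable]: "f \<in> M \<rightarrow>\<^sub>M steps q" "g \<in> M \<rightarrow>\<^sub>M count_space UNIV"
  shows "Measurable.pred M (\<lambda>\<omega>. F (traj_graph (f \<omega>) (g \<omega>) \<inter> S))"
proof -
  have "(\<lambda>\<omega>. F (traj_graph (f \<omega>) (g \<omega>) \<inter> S)) = (\<lambda>\<omega>. \<exists>C\<in>{C. C \<subseteq> S \<and> F C}. \<forall>z\<in>S. (traj (f \<omega>) (g \<omega>) (snd z) = fst z) = (z \<in> C))"
  proof
    fix \<omega>
    have "F (traj_graph (f \<omega>) (g \<omega>) \<inter> S) = (\<exists>C\<in>{C. C \<subseteq> S \<and> F C}. traj_graph (f \<omega>) (g \<omega>) \<inter> S = C)" by auto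
    also have "\<dots> = (\<exists>C\<in>{C. C \<subseteq> S \<and> F C}. \<forall>z\<in>S. (traj (f \<omega>) (g \<omega>) (snd z) = fst z) = (z \<in> C))"
      by (rule bex_cong) (auto simp: traj_graph_def)
    finally show "F (traj_graph (f \<omega>) (g \<omega>) \<inter> S) = (\<exists>C\<in>{C. C \<subseteq> S \<and> F C}. \<forall>z\<in>S. (traj (f \<omega>) (g \<omega>) (snd z) = fst z) = (z \<in> C))" .
  qed
  also have "Measurable.pred M \<dots>"
    using S by (intro pred_intros_finite) (auto intro: finite_subset[of _ "Pow S"])
  finally show ?thesis .
qed

lemma pmf_lazy_step:
  assumes "0 \<le> q" "q \<le> 1"
  shows "pmf (lazy_step_pmf q) 0 = q" "pmf (lazy_step_pmf q) 1 = (1 - q) / 2" "pmf (lazy_step_pmf q) (-1) = (1 - q) / 2"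
    "set_pmf (lazy_step_pmf q) \<subseteq> {-1, 0, 1}"
  using assms by (auto simp: lazy_step_pmf_def pmf_bind map_pmf_def split: if_splits)

lemma AE_step: "0 \<le> q \<Longrightarrow> q \<le> 1 \<Longrightarrow> AE \<xi> in steps q. \<forall>i. \<xi> i \<in> {-1, 0, 1}"
  unfolding steps_def using pmf_lazy_step(4)[of q]
  by (subst AE_all_countable, intro allI AE_PiM_component measure_pmf.prob_space_axioms)
     (auto simp: AE_measure_pmf_iff)

lemma emeasure_step_eq: "emeasure (steps q) {\<xi>. \<xi> i = v} = ennreal (pmf (lazy_step_pmf q) v)"
proof -
  have "measure_pmf (lazy_step_pmf q) = distr (steps q) (measure_pmf (lazy_step_pmf q)) (\<lambda>\<xi>. \<xi> i)"
    unfolding steps_def by (subst distr_PiM_component) (auto intro: measure_pmf.prob_space_axioms)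
  then have "emeasure (measure_pmf (lazy_step_pmf q)) {v} = emeasure (distr (steps q) (measure_pmf (lazy_step_pmf q)) (\<lambda>\<xi>. \<xi> i)) {v}"
    by simp
  also have "\<dots> = emeasure (steps q) ((\<lambda>\<xi>. \<xi> i) -` {v} \<inter> space (steps q))"
    by (rule emeasure_distr) auto
  finally show ?thesis by (simp add: emeasure_pmf_single vimage_def)
qed

lemma measure_sum_steps:
  assumes q: "0 \<le> q" "q \<le> 1" and "finite I"
  shows "measure (steps q) {\<xi>. sum \<xi> I = u} = lazy_prob q (card I) u"
  using assms(3)
proof (induction I arbitrary: u)
  case empty
  interpret prob_space "steps q" by (rule prob_space_steps)
  show ?case using prob_space by auto
next
  case (insert j I)
  interpret prob_space "steps q" by (rule prob_space_steps)
  have pr[measurable]: "Measurable.pred (steps q) (\<lambda>\<xi>. sum \<xi> J = w)" for J w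
    using measurable_sum_count_space[of J "\<lambda>i \<xi>. \<xi> i" "steps q"] by simp
  define E where "E v = {\<xi>. \<xi> j = v \<and> sum \<xi> I = u - v}" for v
  have E[measurable]: "E v \<in> sets (steps q)" for v
    unfolding E_def by (intro sets_Collect_UNIV space_steps) measurable
  have "measure (steps q) (E v) = pmf (lazy_step_pmf q) v * lazy_prob q (card I) (u - v)" for v
  proof -
    have "emeasure (steps q) (E v) = emeasure (steps q) {\<xi>. \<xi> j = v} * emeasure (steps q) {\<xi>. sum \<xi> I = u - v}"
      unfolding E_def steps_def
    proof (rule emeasure_PiM_Int_disjoint[where A="{j}" and B=I])
      show "Measurable.pred (Pi\<^sub>M UNIV (\<lambda>_. measure_pmf (lazy_step_pmf q))) (\<lambda>\<xi>. \<xi> j = v)"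
        using measurable_step[of j q] unfolding steps_def by simp
      show "Measurable.pred (Pi\<^sub>M UNIV (\<lambda>_. measure_pmf (lazy_step_pmf q))) (\<lambda>\<xi>. sum \<xi> I = u - v)"
        using pr[of I "u - v"] unfolding steps_def by simp
    qed (use insert in \<open>auto intro: measure_pmf.prob_space_axioms sum.cong\<close>)
    also have "\<dots> = ennreal (pmf (lazy_step_pmf q) v * lazy_prob q (card I) (u - v))"
      unfolding insert.IH[of "u - v", symmetric] emeasure_eq_measure emeasure_step_eq[unfolded emeasure_eq_measure]
      by (simp add: ennreal_mult'')
    finally show ?thesis unfolding insert.IH[of "u - v", symmetric] by (simp add: emeasure_eq_measure)
  qed
  moreover have "measure (steps q) {\<xi>. sum \<xi> (insert j I) = u} = measure (steps q) (\<Union>v\<in>{-1,0,1}. E v)"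
  proof (rule finite_measure_eq_AE)
    show "AE \<xi> in steps q. (\<xi> \<in> {\<xi>. sum \<xi> (insert j I) = u}) = (\<xi> \<in> (\<Union>v\<in>{-1, 0, 1}. E v))"
      using AE_step[OF q]
    proof eventually_elim
      case (elim \<xi>)
      then have "\<xi> j \<in> {-1, 0, 1}" by blast
      then show ?case using insert.hyps by (auto simp: E_def)
    qed
    show "{\<xi>. sum \<xi> (insert j I) = u} \<in> sets (steps q)" by (intro sets_Collect_UNIV space_steps pr)
  qed auto
  moreover have "measure (steps q) (\<Union>v\<in>{-1,0,1}. E v) = (\<Sum>v\<in>{-1,0,1}. measure (steps q) (E v))"
  proof (rule finite_measure_finite_Union)
    show "E ` {-1, 0, 1} \<subseteq> events" using E by blast
    show "disjoint_family_on E {-1, 0, 1}" by (auto simp: disjoint_family_on_def E_def)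
  qed simp
  ultimately show ?case using insert.hyps pmf_lazy_step[OF q] by (simp add: algebra_simps)
qed

lemma emeasure_walks_eq:
  assumes "Measurable.pred (walks q) (\<lambda>(x, \<xi>). Q x \<xi>)"
  shows "emeasure (walks q) {(x, \<xi>). Q x \<xi>} = (\<integral>\<^sup>+x. emeasure (steps q) {\<xi>. Q x \<xi>} \<partial>count_space UNIV)"
proof -
  interpret prob_space "steps q" by (rule prob_space_steps)
  have "{(x, \<xi>). Q x \<xi>} \<in> sets (walks q)"
    using sets_Collect_UNIV[OF space_walks assms] by (simp add: case_prod_unfold)
  then show ?thesis
    unfolding walks_def by (subst emeasure_pair_measure_alt) (auto simp: vimage_def)
qed

text \<open>For fixed \<xi> the map x \<mapsto> x + g \<xi> is a bijection of the integers and
  preserves counting measure; Fubini does the rest. With g the displacement up to time s, this is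
  the stationarity of \<mu>: walks may be rooted at any time s instead of 0.\<close>

lemma emeasure_walks_translate:
  assumes Q: "Measurable.pred (walks q) (\<lambda>(x, \<xi>). Q x \<xi>)"
    and g[measurable]: "g \<in> steps q \<rightarrow>\<^sub>M count_space UNIV"
  shows "emeasure (walks q) {(x, \<xi>). Q (x + g \<xi>) \<xi>} = emeasure (walks q) {(x, \<xi>). Q x \<xi>}"
proof -
  interpret S: prob_space "steps q" by (rule prob_space_steps)
  interpret C: sigma_finite_measure "count_space (UNIV :: int set)"
    by (rule sigma_finite_measure_count_space)
  interpret P: pair_sigma_finite "count_space (UNIV :: int set)" "steps q" ..
  have m: "(\<lambda>(x, \<xi>). (x + g \<xi>, \<xi>)) \<in> walks q \<rightarrow>\<^sub>M walks q"
    unfolding walks_def case_prod_unfold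
    by (intro measurable_Pair measurable_count_space_combine[where h="(+)"]) measurable
  have s1: "{(x, \<xi>). Q x \<xi>} \<in> sets (walks q)"
    using sets_Collect_UNIV[OF space_walks Q] by (simp add: case_prod_unfold)
  have s2: "{(x, \<xi>). Q (x + g \<xi>) \<xi>} \<in> sets (walks q)"
    using measurable_sets[OF m s1] by (simp add: vimage_def case_prod_unfold)
  have "emeasure (count_space UNIV) {x. Q (x + g \<xi>) \<xi>} = emeasure (count_space UNIV) {x. Q x \<xi>}" for \<xi>
  proof -
    have "bij_betw (\<lambda>x. x + g \<xi>) UNIV UNIV" by (rule bij_betwI[where g="\<lambda>x. x - g \<xi>"]) auto
    then have "emeasure (count_space UNIV) {x. Q x \<xi>} = emeasure (distr (count_space UNIV) (count_space UNIV) (\<lambda>x. x + g \<xi>)) {x. Q x \<xi>}"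
      by (simp add: distr_bij_count_space)
    then show ?thesis by (simp add: emeasure_distr vimage_def)
  qed
  then show ?thesis
    using s1 s2 unfolding walks_def by (simp add: P.emeasure_pair_measure_alt2 vimage_def)
qed

text \<open>Starting from x - \<open>traj \<xi> 0 s\<close> puts the walk at x at time s. Its past
  then uses only steps below s and its future only steps from s on, which is the Markov property in
  coordinates.\<close>

lemma traj_recentred:
  "n \<le> s \<Longrightarrow> traj \<xi> (x - traj \<xi> 0 s) n = x - sum \<xi> {n..<s}"
  "s \<le> n \<Longrightarrow> traj \<xi> (x - traj \<xi> 0 s) n = x + sum \<xi> {s..<n}"
  using traj_diff[of n s \<xi> 0] traj_diff[of s n \<xi> 0] traj_shift[of \<xi> "x - traj \<xi> 0 s" n] by auto

text \<open>The rate in the vacancy probability of A, see \<open>prob_avoid\<close>. For finite A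
  the mass is finite by \<open>emeasure_walks_hit_finite\<close>, so \<open>measure\<close> returns
  its true value.\<close>

definition capacity :: "real \<Rightarrow> (int \<times> int) set \<Rightarrow> real" where
  "capacity q A = measure (walks q) {(x, \<xi>). traj_graph \<xi> x \<inter> A \<noteq> {}}"

text \<open>The empty pattern has infinite mass, so \<open>pattern_mass q S {} = 0\<close> is a junk value.\<close>

definition pattern_mass :: "real \<Rightarrow> (int \<times> int) set \<Rightarrow> (int \<times> int) set \<Rightarrow> real" where
  "pattern_mass q S \<tau> = measure (walks q) {(x, \<xi>). traj_graph \<xi> x \<inter> S = \<tau>}"

lemma pred_walks_graph:
  assumes "finite S"
  shows "Measurable.pred (walks q) (\<lambda>(x, \<xi>). F (traj_graph \<xi> x \<inter> S))"
  unfolding case_prod_unfold walks_def by (rule pred_traj_graph_on_finite[OF assms]) measurable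

lemma sets_walks_graph:
  assumes "finite S"
  shows "{(x, \<xi>). F (traj_graph \<xi> x \<inter> S)} \<in> sets (walks q)"
  using sets_Collect_UNIV[OF space_walks pred_walks_graph[OF assms]] by (simp add: case_prod_unfold)

lemma measurable_recentre: "(\<lambda>\<xi>. x - traj \<xi> 0 s) \<in> steps q \<rightarrow>\<^sub>M count_space UNIV"
  by (rule measurable_count_space_combine[where h="(-)"]) (auto intro: measurable_traj)

lemma emeasure_walks_recentre:
  assumes "finite S"
  shows "emeasure (walks q) {(x, \<xi>). F (traj_graph \<xi> (x - traj \<xi> 0 s) \<inter> S)} = emeasure (walks q) {(x, \<xi>). F (traj_graph \<xi> x \<inter> S)}"
  using emeasure_walks_translate[OF pred_walks_graph[OF assms, of F q], of "\<lambda>\<xi>. - traj \<xi> 0 s"]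
    measurable_recentre[of 0 s q]
  by simp

text \<open>Rooted at the time of z, a walk passes through z exactly when its root is the spatial
  coordinate of z.\<close>

lemma emeasure_walks_hit_point: "emeasure (walks q) {(x, \<xi>). traj_graph \<xi> x \<inter> {z} \<noteq> {}} = 1"
proof -
  interpret prob_space "steps q" by (rule prob_space_steps)
  have "emeasure (walks q) {(x, \<xi>). traj_graph \<xi> x \<inter> {z} \<noteq> {}} =
     emeasure (walks q) {(x, \<xi>). traj_graph \<xi> (x - traj \<xi> 0 (snd z)) \<inter> {z} \<noteq> {}}"
    by (rule emeasure_walks_recentre[symmetric]) simp
  also have "{(x, \<xi>). traj_graph \<xi> (x - traj \<xi> 0 (snd z)) \<inter> {z} \<noteq> {}} = {(x, \<xi>). x = fst z}"
    by (auto simp: traj_graph_def traj_recentred(1))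
  also have "emeasure (walks q) \<dots> = (\<integral>\<^sup>+x. emeasure (steps q) {\<xi>. x = fst z} \<partial>count_space UNIV)"
    unfolding walks_def by (rule emeasure_walks_eq[unfolded walks_def]) simp
  also have "\<dots> = (\<integral>\<^sup>+x. indicator {fst z} x \<partial>count_space UNIV)"
    using emeasure_space_1 by (intro nn_integral_cong) (auto simp: indicator_def)
  finally show ?thesis by simp
qed

lemma emeasure_walks_hit_finite:
  assumes "finite A"
  shows "emeasure (walks q) {(x, \<xi>). traj_graph \<xi> x \<inter> A \<noteq> {}} < \<infinity>"
proof -
  have "emeasure (walks q) {(x, \<xi>). traj_graph \<xi> x \<inter> A \<noteq> {}} \<le> emeasure (walks q) (\<Union>z\<in>A. {(x, \<xi>). traj_graph \<xi> x \<inter> {z} \<noteq> {}})"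
    using assms by (intro emeasure_mono sets.finite_UN sets_walks_graph) auto
  also have "\<dots> \<le> (\<Sum>z\<in>A. emeasure (walks q) {(x, \<xi>). traj_graph \<xi> x \<inter> {z} \<noteq> {}})"
    using assms sets_walks_graph[of "{_}" "\<lambda>C. C \<noteq> {}" q] by (intro emeasure_subadditive_finite) blast+
  also have "\<dots> < \<infinity>" by (simp add: emeasure_walks_hit_point[simplified] of_nat_less_top)
  finally show ?thesis .
qed

lemma capacity_point: "capacity q {z} = 1"
  unfolding capacity_def measure_def emeasure_walks_hit_point by simp

lemma capacity_eq_sum_pattern_mass:
  assumes S: "finite S" "A \<subseteq> S"
  shows "capacity q A = (\<Sum>\<tau>\<in>{\<tau>\<in>Pow S. \<tau> \<inter> A \<noteq> {}}. pattern_mass q S \<tau>)"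
proof -
  have "{(x, \<xi>). traj_graph \<xi> x \<inter> A \<noteq> {}} = (\<Union>\<tau>\<in>{\<tau>\<in>Pow S. \<tau> \<inter> A \<noteq> {}}. {(x, \<xi>). traj_graph \<xi> x \<inter> S = \<tau>})"
    using S by auto blast
  moreover have "measure (walks q) (\<Union>\<tau>\<in>{\<tau>\<in>Pow S. \<tau> \<inter> A \<noteq> {}}. {(x, \<xi>). traj_graph \<xi> x \<inter> S = \<tau>})
     = (\<Sum>\<tau>\<in>{\<tau>\<in>Pow S. \<tau> \<inter> A \<noteq> {}}. measure (walks q) {(x, \<xi>). traj_graph \<xi> x \<inter> S = \<tau>})"
  proof (rule measure_finite_Union)
    fix \<tau> assume \<tau>: "\<tau> \<in> {\<tau> \<in> Pow S. \<tau> \<inter> A \<noteq> {}}"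
    have "emeasure (walks q) {(x, \<xi>). traj_graph \<xi> x \<inter> S = \<tau>} \<le> emeasure (walks q) {(x, \<xi>). traj_graph \<xi> x \<inter> S \<noteq> {}}"
      using \<tau> S sets_walks_graph[of S "\<lambda>C. C \<noteq> {}" q] by (intro emeasure_mono) auto
    also have "\<dots> < \<infinity>" by (rule emeasure_walks_hit_finite[OF S(1)])
    finally show "emeasure (walks q) {(x, \<xi>). traj_graph \<xi> x \<inter> S = \<tau>} \<noteq> \<infinity>" by simp
  qed (use S sets_walks_graph[of S] in \<open>auto simp: disjoint_family_on_def\<close>)
  ultimately show ?thesis by (simp add: capacity_def pattern_mass_def)
qed

text \<open>A pattern \<tau> inside S2 arises when the walk misses S1 and traces \<tau> on S2. For
  walks rooted at time s these two conditions use disjoint sets of steps, and the first has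
  probability at least 1 - \<epsilon> whatever the root.\<close>

lemma pattern_mass_late_ge:
  assumes S: "finite S1" "finite S2" "S1 \<inter> S2 = {}"
    and t: "\<And>z. z \<in> S1 \<Longrightarrow> snd z \<le> s" "\<And>z. z \<in> S2 \<Longrightarrow> s \<le> snd z"
    and \<epsilon>: "\<And>x. measure (steps q) {\<xi>. traj_graph \<xi> (x - traj \<xi> 0 s) \<inter> S1 \<noteq> {}} \<le> \<epsilon>"
    and \<tau>: "\<tau> \<subseteq> S2" "\<tau> \<noteq> {}"
  shows "(1 - \<epsilon>) * pattern_mass q S2 \<tau> \<le> pattern_mass q (S1 \<union> S2) \<tau>"
proof -
  interpret prob_space "steps q" by (rule prob_space_steps)
  let ?g = "\<lambda>x \<xi>. traj_graph \<xi> (x - traj \<xi> 0 s)"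
  have gm: "Measurable.pred (steps q) (\<lambda>\<xi>. F (?g x \<xi> \<inter> S))" if "finite S" for F S x
    by (rule pred_traj_graph_on_finite[OF that _ measurable_recentre, where f="\<lambda>\<xi>. \<xi>" and q=q]) simp
  have eq: "((C \<union> D) = \<tau>) = (C = {} \<and> D = \<tau>)" if "C \<subseteq> S1" "D \<subseteq> S2" for C D
    using that S(3) \<tau> by blast
  have e: "emeasure (steps q) {\<xi>. ?g x \<xi> \<inter> (S1 \<union> S2) = \<tau>} =
      emeasure (steps q) {\<xi>. ?g x \<xi> \<inter> S1 = {}} * emeasure (steps q) {\<xi>. ?g x \<xi> \<inter> S2 = \<tau>}" for x
  proof -
    have "{\<xi>. ?g x \<xi> \<inter> (S1 \<union> S2) = \<tau>} = {\<xi>. ?g x \<xi> \<inter> S1 = {} \<and> ?g x \<xi> \<inter> S2 = \<tau>}"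
      by (simp add: Int_Un_distrib eq)
    moreover have "emeasure (steps q) {\<xi>. ?g x \<xi> \<inter> S1 = {} \<and> ?g x \<xi> \<inter> S2 = \<tau>} =
      emeasure (steps q) {\<xi>. ?g x \<xi> \<inter> S1 = {}} * emeasure (steps q) {\<xi>. ?g x \<xi> \<inter> S2 = \<tau>}"
      unfolding steps_def
    proof (rule emeasure_PiM_Int_disjoint[where A="{..<s}" and B="{s..}"])
      show "Measurable.pred (Pi\<^sub>M UNIV (\<lambda>_. measure_pmf (lazy_step_pmf q))) (\<lambda>\<xi>. ?g x \<xi> \<inter> S1 = {})"
        using gm[OF S(1)] unfolding steps_def by simp
      show "Measurable.pred (Pi\<^sub>M UNIV (\<lambda>_. measure_pmf (lazy_step_pmf q))) (\<lambda>\<xi>. ?g x \<xi> \<inter> S2 = \<tau>)"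
        using gm[OF S(2)] unfolding steps_def by simp
    next
      fix \<xi> \<xi>' :: "int \<Rightarrow> int" assume *: "\<And>i. i \<in> {..<s} \<Longrightarrow> \<xi> i = \<xi>' i"
      have "sum \<xi> {n..<s} = sum \<xi>' {n..<s}" for n by (rule sum.cong) (use * in auto)
      then have "?g x \<xi> \<inter> S1 = ?g x \<xi>' \<inter> S1" using t(1) by (auto simp: traj_graph_def traj_recentred(1))
      then show "(?g x \<xi> \<inter> S1 = {}) = (?g x \<xi>' \<inter> S1 = {})" by simp
    next
      fix \<xi> \<xi>' :: "int \<Rightarrow> int" assume *: "\<And>i. i \<in> {s..} \<Longrightarrow> \<xi> i = \<xi>' i"
      have "sum \<xi> {s..<n} = sum \<xi>' {s..<n}" for n by (rule sum.cong) (use * in auto)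
      then have "?g x \<xi> \<inter> S2 = ?g x \<xi>' \<inter> S2" using t(2) by (auto simp: traj_graph_def traj_recentred(2))
      then show "(?g x \<xi> \<inter> S2 = \<tau>) = (?g x \<xi>' \<inter> S2 = \<tau>)" by simp
    qed (auto intro: measure_pmf.prob_space_axioms)
    ultimately show ?thesis by simp
  qed
  have ge: "emeasure (steps q) {\<xi>. ?g x \<xi> \<inter> S1 = {}} \<ge> ennreal (1 - \<epsilon>)" for x
  proof -
    have "prob {\<xi>. ?g x \<xi> \<inter> S1 = {}} = 1 - prob {\<xi>. ?g x \<xi> \<inter> S1 \<noteq> {}}"
      using prob_compl[OF sets_Collect_UNIV[OF space_steps gm[OF S(1), of "\<lambda>C. C \<noteq> {}" x]]]
      by (simp add: set_diff_eq)
    then show ?thesis using \<epsilon>[of x] by (simp add: emeasure_eq_measure)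
  qed
  have pw: "emeasure (walks q) {(x, \<xi>). traj_graph \<xi> x \<inter> S = \<tau>} = (\<integral>\<^sup>+x. emeasure (steps q) {\<xi>. ?g x \<xi> \<inter> S = \<tau>} \<partial>count_space UNIV)"
    if "finite S" for S
  proof -
    have "Measurable.pred (walks q) (\<lambda>(x, \<xi>). ?g x \<xi> \<inter> S = \<tau>)"
      unfolding case_prod_unfold walks_def
      by (rule pred_traj_graph_on_finite[OF that]) (auto intro!: measurable_count_space_combine[where h="(-)"] measurable_traj)
    from emeasure_walks_eq[OF this] show ?thesis
      by (simp add: emeasure_walks_recentre[OF that, of q "\<lambda>C. C = \<tau>" s])
  qed
  have fin: "emeasure (walks q) {(x, \<xi>). traj_graph \<xi> x \<inter> S = \<tau>} < \<infinity>" if "finite S" for S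
  proof -
    have "emeasure (walks q) {(x, \<xi>). traj_graph \<xi> x \<inter> S = \<tau>} \<le> emeasure (walks q) {(x, \<xi>). traj_graph \<xi> x \<inter> S \<noteq> {}}"
      using \<tau> sets_walks_graph[OF that, of "\<lambda>C. C \<noteq> {}" q] by (intro emeasure_mono) auto
    then show ?thesis using emeasure_walks_hit_finite[OF that, of q] by simp
  qed
  have "ennreal (1 - \<epsilon>) * emeasure (walks q) {(x, \<xi>). traj_graph \<xi> x \<inter> S2 = \<tau>}
     = (\<integral>\<^sup>+x. ennreal (1 - \<epsilon>) * emeasure (steps q) {\<xi>. ?g x \<xi> \<inter> S2 = \<tau>} \<partial>count_space UNIV)"
    by (simp add: pw S nn_integral_cmult)
  also have "\<dots> \<le> (\<integral>\<^sup>+x. emeasure (steps q) {\<xi>. ?g x \<xi> \<inter> (S1 \<union> S2) = \<tau>} \<partial>count_space UNIV)"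
    by (intro nn_integral_mono) (simp add: e ge mult_right_mono)
  also have "\<dots> = emeasure (walks q) {(x, \<xi>). traj_graph \<xi> x \<inter> (S1 \<union> S2) = \<tau>}"
    by (simp add: pw S)
  finally have main: "ennreal (1 - \<epsilon>) * emeasure (walks q) {(x, \<xi>). traj_graph \<xi> x \<inter> S2 = \<tau>}
     \<le> emeasure (walks q) {(x, \<xi>). traj_graph \<xi> x \<inter> (S1 \<union> S2) = \<tau>}" .
  show ?thesis
  \<comment> \<open>For \<epsilon> > 1 \<open>ennreal\<close> truncates 1 - \<epsilon> to 0, but
    then the real left side is nonpositive.\<close>
  proof (cases "\<epsilon> \<le> 1")
    case True
    have "enn2real (ennreal (1 - \<epsilon>) * emeasure (walks q) {(x, \<xi>). traj_graph \<xi> x \<inter> S2 = \<tau>})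
      \<le> enn2real (emeasure (walks q) {(x, \<xi>). traj_graph \<xi> x \<inter> (S1 \<union> S2) = \<tau>})"
      by (rule enn2real_mono[OF main]) (use fin S in auto)
    then show ?thesis using True by (simp add: pattern_mass_def measure_def enn2real_mult)
  next
    case False
    then have "(1 - \<epsilon>) * pattern_mass q S2 \<tau> \<le> 0" by (intro mult_nonpos_nonneg) (auto simp: pattern_mass_def)
    then show ?thesis by (smt (verit) pattern_mass_def measure_nonneg)
  qed
qed

text \<open>Speed at most 1 forces a walk that meets S1 to be within 2l of y at time t + l. That
  leaves 4l + 1 positions, each bounded by \<open>lazy_prob_le\<close> over the at least g steps
  between t + l and s.\<close>

lemma measure_hit_window_le:
  assumes q: "0 < q" "q < 1" and S1: "finite S1"
    and w: "\<And>z. z \<in> S1 \<Longrightarrow> \<bar>fst z - y\<bar> \<le> int l \<and> t \<le> snd z \<and> snd z \<le> t + int l"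
    and g: "t + int l + int g \<le> s"
  shows "measure (steps q) {\<xi>. traj_graph \<xi> (x - traj \<xi> 0 s) \<inter> S1 \<noteq> {}} \<le> (4 * real l + 1) / sqrt ((1 - q) * (real g + 1))"
proof -
  interpret prob_space "steps q" by (rule prob_space_steps)
  let ?I = "{t + int l..<s}"
  let ?U = "{y - 2 * int l..y + 2 * int l}"
  have pr[measurable]: "Measurable.pred (steps q) (\<lambda>\<xi>. sum \<xi> J = w)" for J w
    using measurable_sum_count_space[of J "\<lambda>i \<xi>. \<xi> i" "steps q"] by simp
  have m: "{\<xi>. sum \<xi> J = w} \<in> sets (steps q)" for J w by (intro sets_Collect_UNIV space_steps pr)
  have "prob {\<xi>. traj_graph \<xi> (x - traj \<xi> 0 s) \<inter> S1 \<noteq> {}} \<le> prob (\<Union>u\<in>?U. {\<xi>. sum \<xi> ?I = x - u})"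
  proof (rule finite_measure_mono_AE)
    show "AE \<xi> in steps q. \<xi> \<in> {\<xi>. traj_graph \<xi> (x - traj \<xi> 0 s) \<inter> S1 \<noteq> {}} \<longrightarrow> \<xi> \<in> (\<Union>u\<in>?U. {\<xi>. sum \<xi> ?I = x - u})"
      using AE_step[OF less_imp_le less_imp_le, OF q]
    proof eventually_elim
      case (elim \<xi>)
      then have st: "\<bar>\<xi> i\<bar> \<le> 1" for i by (metis abs_1 abs_minus_cancel abs_zero insertE order_refl singletonD zero_le_one)
      show ?case
      proof
        assume "\<xi> \<in> {\<xi>. traj_graph \<xi> (x - traj \<xi> 0 s) \<inter> S1 \<noteq> {}}"
        then obtain u n where z: "(u, n) \<in> S1" "traj \<xi> (x - traj \<xi> 0 s) n = u"
          unfolding traj_graph_def by fastforce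
        from w[OF z(1)] have b: "\<bar>u - y\<bar> \<le> int l" "t \<le> n" "n \<le> t + int l" by auto
        then have "n \<le> s" using g by simp
        with z have "u = x - sum \<xi> {n..<s}" by (simp add: traj_recentred(1))
        moreover have "sum \<xi> {n..<s} = sum \<xi> {n..<t + int l} + sum \<xi> ?I"
        proof -
          have "{n..<s} = {n..<t + int l} \<union> ?I" using b g by auto
          then show ?thesis by (simp add: sum.union_disjoint)
        qed
        moreover have "\<bar>sum \<xi> {n..<t + int l}\<bar> \<le> int l"
        proof -
          have "\<bar>sum \<xi> {n..<t + int l}\<bar> \<le> (\<Sum>i\<in>{n..<t + int l}. 1)"
            using st by (intro order_trans[OF sum_abs] sum_mono) auto
          then show ?thesis using b by simp
        qed
        ultimately have "x - sum \<xi> ?I \<in> ?U" using b by auto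
        then show "\<xi> \<in> (\<Union>u\<in>?U. {\<xi>. sum \<xi> ?I = x - u})" by (intro UN_I[of "x - sum \<xi> ?I"]) auto
      qed
    qed
  qed (use m in auto)
  also have "\<dots> \<le> (\<Sum>u\<in>?U. prob {\<xi>. sum \<xi> ?I = x - u})"
    using m by (intro finite_measure_subadditive_finite) auto
  also have "\<dots> \<le> (\<Sum>u\<in>?U. 1 / sqrt ((1 - q) * (real g + 1)))"
  proof (rule sum_mono)
    fix u
    have "prob {\<xi>. sum \<xi> ?I = x - u} \<le> 1 / sqrt ((1 - q) * (real (card ?I) + 1))"
      using q by (subst measure_sum_steps) (auto intro!: lazy_prob_le)
    also have "\<dots> \<le> 1 / sqrt ((1 - q) * (real g + 1))"
    proof (rule frac_le)
      have "real g \<le> real (card ?I)" using g by simp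
      then show "sqrt ((1 - q) * (real g + 1)) \<le> sqrt ((1 - q) * (real (card ?I) + 1))"
        using q by (intro real_sqrt_le_mono mult_left_mono) auto
    qed (use q in auto)
    finally show "prob {\<xi>. sum \<xi> ?I = x - u} \<le> 1 / sqrt ((1 - q) * (real g + 1))" .
  qed
  also have "\<dots> = (4 * real l + 1) / sqrt ((1 - q) * (real g + 1))" by simp
  finally show ?thesis .
qed

section \<open>The trace of the Poisson cloud of walks\<close>

definition walk_env :: "real \<Rightarrow> real \<Rightarrow> ((int \<Rightarrow> nat) \<times> (int \<times> nat \<times> int \<Rightarrow> int)) measure" where
  "walk_env q \<rho> = PiM UNIV (\<lambda>x::int. measure_pmf (poisson_pmf \<rho>)) \<Otimes>\<^sub>M PiM UNIV (\<lambda>_::int \<times> nat \<times> int. measure_pmf (lazy_step_pmf q))"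

definition occupied :: "(int \<Rightarrow> nat) \<times> (int \<times> nat \<times> int \<Rightarrow> int) \<Rightarrow> (int \<times> int) set" where
  "occupied e = {z. \<exists>x k. k < fst e x \<and> z \<in> traj_graph (\<lambda>i. snd e (x, k, i)) x}"

lemma trace_eq_occupied: "trace \<omega> = occupied (fst \<omega>)"
  by (auto simp: trace_def occupied_def traj_graph_def walk_path_eq_traj; blast)

lemma prob_space_counts: "prob_space (PiM UNIV (\<lambda>x::int. measure_pmf (poisson_pmf \<rho>)))"
  by (intro prob_space_PiM measure_pmf.prob_space_axioms)

lemma prob_space_all_steps: "prob_space (PiM UNIV (\<lambda>_::int \<times> nat \<times> int. measure_pmf (lazy_step_pmf q)))"
  by (intro prob_space_PiM measure_pmf.prob_space_axioms)

lemma prob_space_walk_env: "prob_space (walk_env q \<rho>)"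
  unfolding walk_env_def
  by (intro prob_space_pair prob_space_counts prob_space_all_steps)

lemma space_walk_env[simp]: "space (walk_env q \<rho>) = UNIV"
  by (simp add: walk_env_def space_pair_measure space_PiM)

lemma measurable_walk_steps[measurable]:
  "(\<lambda>xi i. xi (x, k, i)) \<in> PiM UNIV (\<lambda>_::int \<times> nat \<times> int. measure_pmf (lazy_step_pmf q)) \<rightarrow>\<^sub>M steps q"
  unfolding steps_def
proof (rule measurable_PiM_single')
  fix i :: int
  show "(\<lambda>xi. xi (x, k, i)) \<in> PiM UNIV (\<lambda>_::int \<times> nat \<times> int. measure_pmf (lazy_step_pmf q)) \<rightarrow>\<^sub>M measure_pmf (lazy_step_pmf q)"
    by (rule measurable_component_singleton) simp
qed (simp add: space_PiM)

lemma distr_walk_steps: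
  "distr (PiM UNIV (\<lambda>_::int \<times> nat \<times> int. measure_pmf (lazy_step_pmf q))) (steps q) (\<lambda>xi i. xi (x, k, i)) = steps q"
  using distr_PiM_reindex[of UNIV "\<lambda>_::int \<times> nat \<times> int. measure_pmf (lazy_step_pmf q)" "\<lambda>i. (x, k, i)" "UNIV :: int set"]
  by (auto simp: steps_def inj_on_def measure_pmf.prob_space_axioms restrict_UNIV)

lemma measurable_count[measurable]:
  "(\<lambda>N. N x) \<in> PiM UNIV (\<lambda>x::int. measure_pmf (poisson_pmf \<rho>)) \<rightarrow>\<^sub>M count_space UNIV"
  using measurable_component_singleton[of x UNIV "\<lambda>x::int. measure_pmf (poisson_pmf \<rho>)"] by simp

lemma pred_occupied[measurable]: "Measurable.pred (walk_env q \<rho>) (\<lambda>e. z \<in> occupied e)"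
  unfolding occupied_def walk_env_def traj_graph_def mem_Collect_eq by measurable

lemma pred_occupied_on_finite:
  assumes "finite S"
  shows "Measurable.pred (walk_env q \<rho>) (\<lambda>e. F (occupied e \<inter> S))"
proof -
  have "(\<lambda>e. F (occupied e \<inter> S)) = (\<lambda>e. \<exists>C\<in>{C. C \<subseteq> S \<and> F C}. \<forall>z\<in>S. (z \<in> occupied e) = (z \<in> C))"
  proof
    fix e
    have "F (occupied e \<inter> S) = (\<exists>C\<in>{C. C \<subseteq> S \<and> F C}. occupied e \<inter> S = C)" by auto
    also have "\<dots> = (\<exists>C\<in>{C. C \<subseteq> S \<and> F C}. \<forall>z\<in>S. (z \<in> occupied e) = (z \<in> C))"
      by (rule bex_cong) auto
    finally show "F (occupied e \<inter> S) = (\<exists>C\<in>{C. C \<subseteq> S \<and> F C}. \<forall>z\<in>S. (z \<in> occupied e) = (z \<in> C))" .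
  qed
  also have "Measurable.pred (walk_env q \<rho>) \<dots>"
    using assms by (intro pred_intros_finite) (auto intro: finite_subset[of _ "Pow S"])
  finally show ?thesis .
qed

lemma sets_occupied_on_finite:
  "finite S \<Longrightarrow> {e. F (occupied e \<inter> S)} \<in> sets (walk_env q \<rho>)"
  by (intro sets_Collect_UNIV space_walk_env pred_occupied_on_finite)

text \<open>The Poisson generating function. With a the probability that one walk avoids a set, it
  averages out the random number of walks at a starting point.\<close>

lemma nn_integral_poisson_power:
  assumes "0 < \<rho>" "0 \<le> a"
  shows "(\<integral>\<^sup>+n. ennreal a ^ n \<partial>measure_pmf (poisson_pmf \<rho>)) = ennreal (exp (- \<rho> * (1 - a)))"
proof -
  have s: "(\<lambda>n. pmf (poisson_pmf \<rho>) n * a ^ n) sums (exp (\<rho> * a) * exp (- \<rho>))"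
    using sums_mult2[OF exp_converges[of "\<rho> * a"], of "exp (- \<rho>)"] assms
    by (simp add: power_mult_distrib divide_inverse scaleR_conv_of_real mult_ac)
  have "(\<integral>\<^sup>+n. ennreal a ^ n \<partial>measure_pmf (poisson_pmf \<rho>)) = (\<integral>\<^sup>+n. ennreal (pmf (poisson_pmf \<rho>) n * a ^ n) \<partial>count_space UNIV)"
    using assms by (simp add: nn_integral_measure_pmf ennreal_power ennreal_mult'[symmetric])
  also have "\<dots> = (\<Sum>n. ennreal (pmf (poisson_pmf \<rho>) n * a ^ n))" by (rule nn_integral_count_space_nat)
  also have "\<dots> = ennreal (exp (\<rho> * a) * exp (- \<rho>))"
    by (rule suminf_ennreal_eq[OF _ s]) (use assms in auto)
  also have "exp (\<rho> * a) * exp (- \<rho>) = exp (- \<rho> * (1 - a))" by (simp add: exp_add[symmetric] algebra_simps)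
  finally show ?thesis .
qed

lemma traj_speed:
  assumes "\<And>i. \<bar>\<xi> i\<bar> \<le> 1"
  shows "\<bar>traj \<xi> x n - x\<bar> \<le> \<bar>n\<bar>"
proof -
  have "\<bar>sum \<xi> {0..<n}\<bar> \<le> (\<Sum>i\<in>{0..<n}. 1)" "\<bar>sum \<xi> {n..<0}\<bar> \<le> (\<Sum>i\<in>{n..<0}. 1)"
    using assms by (auto intro!: order_trans[OF sum_abs] sum_mono simp del: sum_constant)
  then show ?thesis unfolding traj_def by (cases "n \<ge> 0") auto
qed

text \<open>Given the counts N, distinct walks use disjoint coordinates of the step field, so the
  conditional probability is the product of \<open>a x ^ N x\<close>. Integrating over the
  independent Poisson counts turns each factor into exp (- \<rho> (1 - a x)).\<close>

lemma prob_avoid: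
  assumes q: "0 \<le> q" "q \<le> 1" and \<rho>: "0 < \<rho>" and A: "finite A"
  shows "measure (walk_env q \<rho>) {e. occupied e \<inter> A = {}} = exp (- \<rho> * capacity q A)"
proof -
  let ?N = "PiM UNIV (\<lambda>x::int. measure_pmf (poisson_pmf \<rho>))"
  let ?X = "PiM UNIV (\<lambda>_::int \<times> nat \<times> int. measure_pmf (lazy_step_pmf q))"
  interpret S: prob_space "steps q" by (rule prob_space_steps)
  interpret X: prob_space ?X by (rule prob_space_all_steps)
  interpret N: prob_space ?N by (rule prob_space_counts)
  interpret E: prob_space "walk_env q \<rho>" by (rule prob_space_walk_env)
  \<comment> \<open>By the speed bound only starting points in [-R, R] can reach A, so all products
    are finite. A sum instead of a maximum also covers the empty A.\<close>
  define R where "R = (\<Sum>z\<in>A. \<bar>fst z\<bar> + \<bar>snd z\<bar>)"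
  have R: "\<bar>fst z\<bar> + \<bar>snd z\<bar> \<le> R" if "z \<in> A" for z
    unfolding R_def by (rule member_le_sum[OF that]) (use A in auto)
  define I where "I = {- R..R}"
  have far: "traj_graph \<xi> x \<inter> A = {}" if "\<And>i. \<xi> i \<in> {-1, 0, 1}" "x \<notin> I" for \<xi> x
  proof (rule ccontr)
    assume "traj_graph \<xi> x \<inter> A \<noteq> {}"
    then obtain n where n: "(traj \<xi> x n, n) \<in> A" unfolding traj_graph_def by fastforce
    have "\<bar>\<xi> i\<bar> \<le> 1" for i using that(1)[of i] by auto
    from traj_speed[of \<xi> x n, OF this] R[OF n] that(2) show False by (auto simp: I_def)
  qed
  define av where "av x = {\<xi>. traj_graph \<xi> x \<inter> A = {}}" for x
  define a where "a x = measure (steps q) (av x)" for x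
  have avm[measurable]: "av x \<in> sets (steps q)" for x
    unfolding av_def by (intro sets_Collect_UNIV space_steps pred_traj_graph_on_finite[OF A, where q=q]) auto
  have em: "emeasure (steps q) (av x) = ennreal (a x)" for x by (simp add: a_def S.emeasure_eq_measure)
  have hit: "measure (steps q) {\<xi>. traj_graph \<xi> x \<inter> A \<noteq> {}} = 1 - a x" for x
    using S.prob_compl[OF avm[of x]] by (simp add: a_def av_def set_diff_eq)
  have inner: "emeasure ?X {xi. occupied (N, xi) \<inter> A = {}} = (\<Prod>x\<in>I. ennreal (a x) ^ N x)" for N
  proof -
    define J where "J = Sigma I (\<lambda>x. {..<N x})"
    define ev where "ev j = {xi :: int \<times> nat \<times> int \<Rightarrow> int. (\<lambda>i. xi (fst j, snd j, i)) \<in> av (fst j)}" for j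
    have evm: "ev j \<in> sets ?X" for j
      using measurable_sets[OF measurable_walk_steps[of "fst j" "snd j" q] avm[of "fst j"]]
      by (simp add: ev_def vimage_def space_PiM)
    have fJ: "finite J" by (auto simp: J_def I_def)
    have oc: "(occupied (N, xi) \<inter> A = {}) = (\<forall>x k. k < N x \<longrightarrow> (\<lambda>i. xi (x, k, i)) \<in> av x)" for xi
      by (auto simp: occupied_def av_def)
    have m1: "{xi. occupied (N, xi) \<inter> A = {}} \<in> sets ?X"
      unfolding oc by (rule sets_Collect_UNIV) (auto simp: space_PiM)
    have ae: "AE xi in ?X. \<forall>j. xi j \<in> {-1, 0, 1}"
      using pmf_lazy_step(4)[OF q]
      by (subst AE_all_countable, intro allI AE_PiM_component measure_pmf.prob_space_axioms)
         (auto simp: AE_measure_pmf_iff)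
    have "emeasure ?X {xi. occupied (N, xi) \<inter> A = {}} = emeasure ?X {xi. \<forall>j\<in>J. xi \<in> ev j}"
    proof (rule emeasure_eq_AE)
      show "AE xi in ?X. (xi \<in> {xi. occupied (N, xi) \<inter> A = {}}) = (xi \<in> {xi. \<forall>j\<in>J. xi \<in> ev j})"
        using ae
      proof eventually_elim
        case (elim xi)
        have "(\<lambda>i. xi (x, k, i)) \<in> av x" if "x \<notin> I" for x k
          unfolding av_def using far[of "\<lambda>i. xi (x, k, i)" x] elim that by blast
        then show ?case unfolding oc mem_Collect_eq ev_def J_def by fastforce
      qed
      show "{xi. \<forall>j\<in>J. xi \<in> ev j} \<in> sets ?X"
        using fJ evm by (intro sets_Collect_UNIV pred_intros_finite) (auto simp: space_PiM)
    qed (rule m1)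
    also have "\<dots> = (\<integral>\<^sup>+xi. (\<Prod>j\<in>J. indicator (ev j) xi) \<partial>?X)"
    proof -
      have "indicator {xi. \<forall>j\<in>J. xi \<in> ev j} xi = (\<Prod>j\<in>J. indicator (ev j) xi :: ennreal)" for xi
        using fJ by (auto simp: indicator_def)
      moreover have "{xi. \<forall>j\<in>J. xi \<in> ev j} \<in> sets ?X"
        using fJ evm by (intro sets_Collect_UNIV pred_intros_finite) (auto simp: space_PiM)
      ultimately show ?thesis by (simp flip: nn_integral_indicator)
    qed
    also have "\<dots> = (\<Prod>j\<in>J. \<integral>\<^sup>+xi. indicator (ev j) xi \<partial>?X)"
    proof (rule nn_integral_PiM_prod_disjoint[where K="\<lambda>j. range (\<lambda>i. (fst j, snd j, i))"])
      fix j and xi xi' :: "int \<times> nat \<times> int \<Rightarrow> int"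
      assume "\<And>i. i \<in> range (\<lambda>i. (fst j, snd j, i)) \<Longrightarrow> xi i = xi' i"
      then have "(\<lambda>i. xi (fst j, snd j, i)) = (\<lambda>i. xi' (fst j, snd j, i))" by auto
      then show "indicator (ev j) xi = (indicator (ev j) xi' :: ennreal)" by (simp add: ev_def indicator_def)
    qed (use fJ evm in \<open>auto simp: disjoint_family_on_def intro: measure_pmf.prob_space_axioms\<close>)
    also have "\<dots> = (\<Prod>j\<in>J. ennreal (a (fst j)))"
    proof (rule prod.cong[OF refl])
      fix j
      have "emeasure (distr ?X (steps q) (\<lambda>xi i. xi (fst j, snd j, i))) (av (fst j)) = emeasure ?X (ev j)"
        by (subst emeasure_distr) (auto simp: ev_def vimage_def space_PiM)
      then show "(\<integral>\<^sup>+xi. indicator (ev j) xi \<partial>?X) = ennreal (a (fst j))"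
        using evm by (simp add: distr_walk_steps em)
    qed
    also have "\<dots> = (\<Prod>x\<in>I. \<Prod>k\<in>{..<N x}. ennreal (a x))"
      unfolding J_def by (subst prod.Sigma) (auto simp: I_def case_prod_unfold)
    finally show ?thesis by simp
  qed
  have "emeasure (walk_env q \<rho>) {e. occupied e \<inter> A = {}} = (\<integral>\<^sup>+N. emeasure ?X {xi. occupied (N, xi) \<inter> A = {}} \<partial>?N)"
    using sets_occupied_on_finite[OF A, of "\<lambda>C. C = {}" q \<rho>] unfolding walk_env_def
    by (subst X.emeasure_pair_measure_alt) (auto simp: vimage_def)
  also have "\<dots> = (\<integral>\<^sup>+N. (\<Prod>x\<in>I. ennreal (a x) ^ N x) \<partial>?N)" by (simp add: inner)
  also have "\<dots> = (\<Prod>x\<in>I. \<integral>\<^sup>+N. ennreal (a x) ^ N x \<partial>?N)"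
    by (rule nn_integral_PiM_prod_disjoint[where K="\<lambda>x. {x}"])
       (auto simp: I_def disjoint_family_on_def intro: measure_pmf.prob_space_axioms)
  also have "\<dots> = (\<Prod>x\<in>I. ennreal (exp (- \<rho> * (1 - a x))))"
  proof (rule prod.cong[OF refl])
    fix x
    have "(\<integral>\<^sup>+n. ennreal (a x) ^ n \<partial>measure_pmf (poisson_pmf \<rho>)) = (\<integral>\<^sup>+n. ennreal (a x) ^ n \<partial>distr ?N (measure_pmf (poisson_pmf \<rho>)) (\<lambda>N. N x))"
      by (subst distr_PiM_component) (auto intro: measure_pmf.prob_space_axioms)
    also have "\<dots> = (\<integral>\<^sup>+N. ennreal (a x) ^ N x \<partial>?N)"
      by (rule nn_integral_distr) auto
    finally show "(\<integral>\<^sup>+N. ennreal (a x) ^ N x \<partial>?N) = ennreal (exp (- \<rho> * (1 - a x)))"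
      using nn_integral_poisson_power[OF \<rho>, of "a x"] by (simp add: a_def)
  qed
  also have "\<dots> = ennreal (exp (- \<rho> * (\<Sum>x\<in>I. 1 - a x)))"
    by (simp add: prod_ennreal exp_sum I_def sum_distrib_left)
  finally have 1: "measure (walk_env q \<rho>) {e. occupied e \<inter> A = {}} = exp (- \<rho> * (\<Sum>x\<in>I. 1 - a x))"
    by (simp add: E.emeasure_eq_measure)
  have "emeasure (walks q) {(x, \<xi>). traj_graph \<xi> x \<inter> A \<noteq> {}} = (\<integral>\<^sup>+x. emeasure (steps q) {\<xi>. traj_graph \<xi> x \<inter> A \<noteq> {}} \<partial>count_space UNIV)"
    by (rule emeasure_walks_eq[OF pred_walks_graph[OF A]])
  also have "\<dots> = (\<integral>\<^sup>+x\<in>I. ennreal (1 - a x) \<partial>count_space UNIV)"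
  proof (rule nn_integral_cong)
    fix x
    show "emeasure (steps q) {\<xi>. traj_graph \<xi> x \<inter> A \<noteq> {}} = ennreal (1 - a x) * indicator I x"
    proof (cases "x \<in> I")
      case False
      have "AE \<xi> in steps q. \<xi> \<in> av x"
        using AE_step[OF q] by eventually_elim (use far False in \<open>auto simp: av_def\<close>)
      then have "a x = 1" unfolding a_def using S.prob_eq_1[OF avm[of x]] by simp
      then show ?thesis using hit[of x] by (simp add: S.emeasure_eq_measure)
    qed (use hit[of x] in \<open>simp add: S.emeasure_eq_measure\<close>)
  qed
  also have "\<dots> = (\<Sum>x\<in>I. ennreal (1 - a x))"
    by (simp add: nn_integral_count_space_indicator[symmetric] nn_integral_count_space_finite I_def)
  also have "\<dots> = ennreal (\<Sum>x\<in>I. 1 - a x)" by (rule sum_ennreal) (simp add: a_def)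
  finally have "capacity q A = (\<Sum>x\<in>I. 1 - a x)"
    unfolding capacity_def measure_def by (simp add: sum_nonneg a_def)
  then show ?thesis using 1 by simp
qed

section \<open>Decoupling of time-separated events\<close>

lemma measure_on_finite_eq_sum:
  assumes "finite_measure M" "space M = UNIV" "finite S"
    and m: "\<And>F. {x. F (R x \<inter> S)} \<in> sets M"
  shows "measure M {x. F (R x \<inter> S)} = (\<Sum>C\<in>{C\<in>Pow S. F C}. measure M {x. R x \<inter> S = C})"
proof -
  interpret finite_measure M by fact
  have "{x. F (R x \<inter> S)} = (\<Union>C\<in>{C\<in>Pow S. F C}. {x. R x \<inter> S = C})" by auto
  moreover have "measure M (\<Union>C\<in>{C\<in>Pow S. F C}. {x. R x \<inter> S = C}) = (\<Sum>C\<in>{C\<in>Pow S. F C}. measure M {x. R x \<inter> S = C})"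
  proof (rule finite_measure_finite_Union)
    show "(\<lambda>C. {x. R x \<inter> S = C}) ` {C \<in> Pow S. F C} \<subseteq> sets M" using m[of "\<lambda>D. D = _"] by auto
  qed (use assms in \<open>auto simp: disjoint_family_on_def\<close>)
  ultimately show ?thesis by simp
qed

text \<open>Avoiding S - C means that the pattern lies inside C. Moebius inversion over the subsets
  of C, carried out as an induction on C, isolates the probability that the pattern equals
  C.\<close>

lemma avoidance_determines_law:
  assumes M: "finite_measure M" "space M = UNIV" "\<And>F. {x. F (R x \<inter> S)} \<in> sets M"
    and M': "finite_measure M'" "space M' = UNIV" "\<And>F. {x. F (R' x \<inter> S)} \<in> sets M'"
    and S: "finite S"
    and avoid: "\<And>A. A \<subseteq> S \<Longrightarrow> measure M {x. R x \<inter> A = {}} = measure M' {x. R' x \<inter> A = {}}"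
  shows "measure M {x. F (R x \<inter> S)} = measure M' {x. F (R' x \<inter> S)}"
proof -
  have fin: "finite {D \<in> Pow S. Q D}" for Q using S by auto
  have eM: "measure M {x. G (R x \<inter> S)} = (\<Sum>C\<in>{C\<in>Pow S. G C}. measure M {x. R x \<inter> S = C})" for G
    by (rule measure_on_finite_eq_sum) (rule M S)+
  have eM': "measure M' {x. G (R' x \<inter> S)} = (\<Sum>C\<in>{C\<in>Pow S. G C}. measure M' {x. R' x \<inter> S = C})" for G
    by (rule measure_on_finite_eq_sum) (rule M' S)+
  have "measure M {x. R x \<inter> S = C} = measure M' {x. R' x \<inter> S = C}" if "C \<subseteq> S" for C
    using finite_subset[OF that S] that
  proof (induction C rule: finite_psubset_induct)
    case (psubset C)
    have e: "{x. G x \<inter> (S - C) = {}} = {x. G x \<inter> S \<subseteq> C}" for G :: "'z \<Rightarrow> 'b set" by auto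
    have e1: "{D \<in> Pow S. D \<subseteq> C} = insert C {D \<in> Pow S. D \<subset> C}" using psubset.prems by auto
    have "measure M {x. R x \<inter> S \<subseteq> C} = measure M' {x. R' x \<inter> S \<subseteq> C}"
      using avoid[of "S - C"] by (auto simp: e)
    then have "(\<Sum>D\<in>{D \<in> Pow S. D \<subseteq> C}. measure M {x. R x \<inter> S = D}) = (\<Sum>D\<in>{D \<in> Pow S. D \<subseteq> C}. measure M' {x. R' x \<inter> S = D})"
      using eM[of "\<lambda>D. D \<subseteq> C"] eM'[of "\<lambda>D. D \<subseteq> C"] by simp
    then have "measure M {x. R x \<inter> S = C} + (\<Sum>D\<in>{D \<in> Pow S. D \<subset> C}. measure M {x. R x \<inter> S = D})
      = measure M' {x. R' x \<inter> S = C} + (\<Sum>D\<in>{D \<in> Pow S. D \<subset> C}. measure M' {x. R' x \<inter> S = D})"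
      unfolding e1 by (subst (asm) (1 2) sum.insert) (use fin in auto)
    moreover have "(\<Sum>D\<in>{D \<in> Pow S. D \<subset> C}. measure M {x. R x \<inter> S = D}) = (\<Sum>D\<in>{D \<in> Pow S. D \<subset> C}. measure M' {x. R' x \<inter> S = D})"
      by (rule sum.cong) (use psubset.IH in auto)
    ultimately show ?case by simp
  qed
  then show ?thesis
    using eM[of F] eM'[of F] by simp
qed

text \<open>The set covered by a Poisson process of patterns with intensity \<nu>: for nonnegative
  \<nu>, the pattern \<tau> is present when its Poisson count of mean \<nu> \<tau> is positive, that
  is, with probability 1 - exp (- \<nu> \<tau>), independently over \<tau>.\<close>

definition poisson_union :: "'a set \<Rightarrow> ('a set \<Rightarrow> real) \<Rightarrow> 'a set pmf" where
  "poisson_union S \<nu> = map_pmf (\<lambda>b. \<Union>{\<tau> \<in> Pow S. b \<tau>}) (Pi_pmf (Pow S) False (\<lambda>\<tau>. bernoulli_pmf (1 - exp (- \<nu> \<tau>))))"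

lemma poisson_union_avoid:
  assumes S: "finite S" and \<nu>: "\<And>\<tau>. \<tau> \<subseteq> S \<Longrightarrow> 0 \<le> \<nu> \<tau>"
  shows "measure_pmf.prob (poisson_union S \<nu>) {C. C \<inter> A = {}} = exp (- (\<Sum>\<tau>\<in>{\<tau>\<in>Pow S. \<tau> \<inter> A \<noteq> {}}. \<nu> \<tau>))"
proof -
  let ?B = "\<lambda>\<tau>. if \<tau> \<inter> A = {} then UNIV else {False}"
  have "measure_pmf.prob (poisson_union S \<nu>) {C. C \<inter> A = {}} =
    measure_pmf.prob (Pi_pmf (Pow S) False (\<lambda>\<tau>. bernoulli_pmf (1 - exp (- \<nu> \<tau>)))) (Pi (Pow S) ?B)"
    unfolding poisson_union_def measure_map_pmf
    by (rule arg_cong[where f="measure_pmf.prob _"]) (auto simp: Pi_iff split: if_splits; blast)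
  also have "\<dots> = (\<Prod>\<tau>\<in>Pow S. measure_pmf.prob (bernoulli_pmf (1 - exp (- \<nu> \<tau>))) (?B \<tau>))"
    using S by (intro measure_Pi_pmf_Pi) auto
  also have "\<dots> = (\<Prod>\<tau>\<in>Pow S. if \<tau> \<inter> A = {} then 1 else exp (- \<nu> \<tau>))"
    by (rule prod.cong) (use \<nu> in \<open>auto simp: measure_pmf_single\<close>)
  also have "\<dots> = (\<Prod>\<tau>\<in>{\<tau>\<in>Pow S. \<tau> \<inter> A \<noteq> {}}. exp (- \<nu> \<tau>))"
    using S by (intro prod.mono_neutral_cong_right) auto
  also have "\<dots> = exp (- (\<Sum>\<tau>\<in>{\<tau>\<in>Pow S. \<tau> \<inter> A \<noteq> {}}. \<nu> \<tau>))"
    using S by (simp add: exp_sum flip: sum_negf)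
  finally show ?thesis .
qed

lemma finite_set_poisson_union: "finite S \<Longrightarrow> finite (set_pmf (poisson_union S \<nu>))"
  unfolding poisson_union_def by (rule finite_subset[of _ "Pow S"]) auto

lemma prob_pair_pmf_Times:
  assumes "finite (set_pmf p)" "finite (set_pmf p')"
  shows "measure_pmf.prob (pair_pmf p p') (A \<times> B) = measure_pmf.prob p A * measure_pmf.prob p' B"
proof -
  have "measure_pmf.prob (pair_pmf p p') (A \<times> B) = measure_pmf.prob (pair_pmf p p') ((A \<inter> set_pmf p) \<times> (B \<inter> set_pmf p'))"
    by (rule measure_prob_cong_0) (auto simp: pmf_eq_0_set_pmf)
  also have "\<dots> = measure_pmf.prob p (A \<inter> set_pmf p) * measure_pmf.prob p' (B \<inter> set_pmf p')"
    by (rule measure_pmf_prob_product) (use assms in \<open>auto intro: countable_finite\<close>)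
  finally show ?thesis by (simp add: measure_Int_set_pmf)
qed

text \<open>Superposition of independent clouds. No coupling is built: the void probabilities of
  both sides agree, and these determine the law.\<close>

lemma poisson_union_add:
  assumes S: "finite S" and \<nu>: "\<And>\<tau>. \<tau> \<subseteq> S \<Longrightarrow> 0 \<le> \<nu>1 \<tau>" "\<And>\<tau>. \<tau> \<subseteq> S \<Longrightarrow> 0 \<le> \<nu>2 \<tau>"
  shows "measure_pmf.prob (poisson_union S (\<lambda>\<tau>. \<nu>1 \<tau> + \<nu>2 \<tau>)) {C. F (C \<inter> S)} =
    measure_pmf.prob (pair_pmf (poisson_union S \<nu>1) (poisson_union S \<nu>2)) {(C, D). F ((C \<union> D) \<inter> S)}"
proof -
  have "measure_pmf.prob (poisson_union S (\<lambda>\<tau>. \<nu>1 \<tau> + \<nu>2 \<tau>)) {C. F (C \<inter> S)} =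
    measure_pmf.prob (pair_pmf (poisson_union S \<nu>1) (poisson_union S \<nu>2)) {p. F ((fst p \<union> snd p) \<inter> S)}"
  proof (rule avoidance_determines_law[where S=S and R="\<lambda>C. C" and R'="\<lambda>p. fst p \<union> snd p"])
    fix A :: "'a set"
    have "{p. (fst p \<union> snd p) \<inter> A = {}} = {C. C \<inter> A = {}} \<times> {D. D \<inter> A = {}}" by auto
    then show "measure_pmf.prob (poisson_union S (\<lambda>\<tau>. \<nu>1 \<tau> + \<nu>2 \<tau>)) {C. C \<inter> A = {}} =
       measure_pmf.prob (pair_pmf (poisson_union S \<nu>1) (poisson_union S \<nu>2)) {p. (fst p \<union> snd p) \<inter> A = {}}"
      using S \<nu> by (simp add: poisson_union_avoid prob_pair_pmf_Times finite_set_poisson_union sum.distrib flip: exp_add)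
  qed (use S in \<open>auto intro: measure_pmf.finite_measure_axioms\<close>)
  then show ?thesis by (simp add: case_prod_unfold)
qed

text \<open>The bridge from the infinite environment to a finite model: only void probabilities have
  to be matched, and \<open>prob_avoid\<close> gives them in closed form.\<close>

lemma walk_env_law:
  assumes q: "0 \<le> q" "q \<le> 1" and \<rho>: "0 < \<rho>" and S: "finite S"
    and avoid: "\<And>A. A \<subseteq> S \<Longrightarrow> measure_pmf.prob p {C. C \<inter> A = {}} = exp (- \<rho> * capacity q A)"
  shows "measure (walk_env q \<rho>) {e. F (occupied e \<inter> S)} = measure_pmf.prob p {C. F (C \<inter> S)}"
proof (rule avoidance_determines_law[where S=S])
  show "finite_measure (walk_env q \<rho>)" using prob_space_walk_env prob_space.finite_measure by blast
  fix A assume "A \<subseteq> S"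
  then show "measure (walk_env q \<rho>) {e. occupied e \<inter> A = {}} = measure_pmf.prob p {C. C \<inter> A = {}}"
    using prob_avoid[OF q \<rho> finite_subset[OF _ S]] avoid by simp
qed (use S in \<open>auto intro: measure_pmf.finite_measure_axioms sets_occupied_on_finite\<close>)

text \<open>The walks missing \<open>S1\<close> are independent of the walks hitting \<open>S1\<close>; the former have, inside \<open>S2\<close>,
  at least the intensity of an environment of density \<open>\<rho> (1 - \<epsilon>)\<close>, by the Markov property at time \<open>s\<close>.\<close>

lemma decoupling:
  assumes q: "0 \<le> q" "q \<le> 1" and \<rho>: "0 < \<rho>" and \<epsilon>1: "\<epsilon> < 1"
    and S: "finite S1" "finite S2" "S1 \<inter> S2 = {}"
    and t: "\<And>z. z \<in> S1 \<Longrightarrow> snd z \<le> s" "\<And>z. z \<in> S2 \<Longrightarrow> s \<le> snd z"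
    and \<epsilon>: "\<And>x. measure (steps q) {\<xi>. traj_graph \<xi> (x - traj \<xi> 0 s) \<inter> S1 \<noteq> {}} \<le> \<epsilon>"
    and F2: "\<And>C D. C \<subseteq> D \<Longrightarrow> F2 D \<Longrightarrow> F2 C"
  shows "measure (walk_env q \<rho>) {e. F1 (occupied e \<inter> S1) \<and> F2 (occupied e \<inter> S2)} \<le>
    measure (walk_env q \<rho>) {e. F1 (occupied e \<inter> S1)} * measure (walk_env q (\<rho> * (1 - \<epsilon>))) {e. F2 (occupied e \<inter> S2)}"
proof -
  let ?S = "S1 \<union> S2"
  let ?pm = "pattern_mass q"
  \<comment> \<open>The cloud is split by pattern: \<open>\<nu>a\<close> for the walks hitting S1,
    \<open>\<nu>b\<close> for those missing it. The latter is split again into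
    \<open>\<nu>c\<close>, which reproduces density \<rho> (1 - \<epsilon>) on S2, and a remainder
    \<open>\<nu>d\<close>, nonnegative by \<open>pattern_mass_late_ge\<close>. Empty patterns get
    intensity 0, as they add nothing to a union.\<close>
  define \<nu>a where "\<nu>a \<tau> = (if \<tau> \<inter> S1 \<noteq> {} then \<rho> * ?pm ?S \<tau> else 0)" for \<tau>
  define \<nu>b where "\<nu>b \<tau> = (if \<tau> \<inter> S1 = {} \<and> \<tau> \<noteq> {} then \<rho> * ?pm ?S \<tau> else 0)" for \<tau>
  define \<nu>c where "\<nu>c \<tau> = (if \<tau> \<subseteq> S2 \<and> \<tau> \<noteq> {} then \<rho> * (1 - \<epsilon>) * ?pm S2 \<tau> else 0)" for \<tau>
  define \<nu>d where "\<nu>d \<tau> = \<nu>b \<tau> - \<nu>c \<tau>" for \<tau>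
  have pm0: "0 \<le> ?pm A \<tau>" for A \<tau> by (simp add: pattern_mass_def)
  have fS: "finite ?S" using S by simp
  have a0: "0 \<le> \<nu>a \<tau>" and b0: "0 \<le> \<nu>b \<tau>" and c0: "0 \<le> \<nu>c \<tau>" for \<tau>
    using \<rho> pm0 \<epsilon>1 by (auto simp: \<nu>a_def \<nu>b_def \<nu>c_def)
  have d0: "0 \<le> \<nu>d \<tau>" for \<tau>
  proof (cases "\<tau> \<subseteq> S2 \<and> \<tau> \<noteq> {}")
    case True
    then have "\<tau> \<inter> S1 = {}" using S(3) by auto
    moreover have "(1 - \<epsilon>) * ?pm S2 \<tau> \<le> ?pm ?S \<tau>"
      using True by (intro pattern_mass_late_ge[OF S t \<epsilon>]) auto
    ultimately show ?thesis using True \<rho> by (simp add: \<nu>d_def \<nu>b_def \<nu>c_def mult.assoc)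
  next
    case False
    then have "\<nu>c \<tau> = 0" by (simp only: \<nu>c_def if_False)
    then show ?thesis using b0[of \<tau>] by (simp add: \<nu>d_def)
  qed
  have avoid_S: "(\<Sum>\<tau>\<in>{\<tau>\<in>Pow ?S. \<tau> \<inter> A \<noteq> {}}. \<rho> * ?pm ?S \<tau>) = \<rho> * capacity q A" if "A \<subseteq> ?S" for A
    by (simp add: capacity_eq_sum_pattern_mass[OF fS that] sum_distrib_left)
  have s1: "(\<Sum>\<tau>\<in>{\<tau>\<in>Pow ?S. \<tau> \<inter> A \<noteq> {}}. \<nu>a \<tau> + \<nu>b \<tau>) = \<rho> * capacity q A" if "A \<subseteq> ?S" for A
    unfolding avoid_S[OF that, symmetric] by (rule sum.cong) (auto simp: \<nu>a_def \<nu>b_def)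
  have s2: "(\<Sum>\<tau>\<in>{\<tau>\<in>Pow ?S. \<tau> \<inter> A \<noteq> {}}. \<nu>a \<tau>) = \<rho> * capacity q A" if "A \<subseteq> S1" for A
    unfolding avoid_S[OF le_supI1[OF that], symmetric] by (rule sum.cong) (use that in \<open>auto simp: \<nu>a_def\<close>)
  have s3: "(\<Sum>\<tau>\<in>{\<tau>\<in>Pow ?S. \<tau> \<inter> S1 \<noteq> {}}. \<nu>b \<tau>) = 0"
    by (rule sum.neutral) (auto simp: \<nu>b_def)
  have s4: "(\<Sum>\<tau>\<in>{\<tau>\<in>Pow ?S. \<tau> \<inter> A \<noteq> {}}. \<nu>c \<tau>) = \<rho> * (1 - \<epsilon>) * capacity q A" if "A \<subseteq> S2" for A
  proof -
    have "(\<Sum>\<tau>\<in>{\<tau>\<in>Pow ?S. \<tau> \<inter> A \<noteq> {}}. \<nu>c \<tau>) = (\<Sum>\<tau>\<in>{\<tau>\<in>Pow S2. \<tau> \<inter> A \<noteq> {}}. \<rho> * (1 - \<epsilon>) * ?pm S2 \<tau>)"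
      by (rule sum.mono_neutral_cong_right) (use S in \<open>auto simp: \<nu>c_def\<close>)
    then show ?thesis by (simp add: capacity_eq_sum_pattern_mass[OF S(2) that] sum_distrib_left)
  qed
  have cd: "\<nu>b = (\<lambda>\<tau>. \<nu>c \<tau> + \<nu>d \<tau>)" by (simp add: \<nu>d_def)
  have "measure (walk_env q \<rho>) {e. F1 (occupied e \<inter> S1) \<and> F2 (occupied e \<inter> S2)} =
     measure (walk_env q \<rho>) {e. F1 ((occupied e \<inter> ?S) \<inter> S1) \<and> F2 ((occupied e \<inter> ?S) \<inter> S2)}"
    by (rule arg_cong[where f="measure _"]) (auto simp: Int_assoc Int_absorb1)
  also have "\<dots> = measure_pmf.prob (poisson_union ?S (\<lambda>\<tau>. \<nu>a \<tau> + \<nu>b \<tau>)) {C. F1 ((C \<inter> ?S) \<inter> S1) \<and> F2 ((C \<inter> ?S) \<inter> S2)}"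
    by (rule walk_env_law[OF q \<rho> fS, where F="\<lambda>C. F1 (C \<inter> S1) \<and> F2 (C \<inter> S2)"])
       (use fS a0 b0 s1 in \<open>auto simp: poisson_union_avoid\<close>)
  also have "\<dots> = measure_pmf.prob (pair_pmf (poisson_union ?S \<nu>a) (poisson_union ?S \<nu>b))
      {(C, D). F1 (((C \<union> D) \<inter> ?S) \<inter> S1) \<and> F2 (((C \<union> D) \<inter> ?S) \<inter> S2)}"
    by (rule poisson_union_add[OF fS a0 b0])
  \<comment> \<open>Almost surely D misses S1, so F1 sees C alone; F2 is decreasing and persists
    when C is removed. What remains is an event about C times an event about D.\<close>
  also have "\<dots> \<le> measure_pmf.prob (pair_pmf (poisson_union ?S \<nu>a) (poisson_union ?S \<nu>b)) ({C. F1 (C \<inter> S1)} \<times> {D. F2 (D \<inter> S2)})"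
  proof (rule measure_pmf.finite_measure_mono_AE)
    have "AE D in measure_pmf (poisson_union ?S \<nu>b). D \<inter> S1 = {}"
      using poisson_union_avoid[OF fS b0, where A=S1] s3 measure_pmf.prob_eq_1[of "{D. D \<inter> S1 = {}}" "poisson_union ?S \<nu>b"]
      by simp
    then have "\<And>D. D \<in> set_pmf (poisson_union ?S \<nu>b) \<Longrightarrow> D \<inter> S1 = {}" by (simp add: AE_measure_pmf_iff)
    then show "AE x in measure_pmf (pair_pmf (poisson_union ?S \<nu>a) (poisson_union ?S \<nu>b)).
       x \<in> {(C, D). F1 ((C \<union> D) \<inter> ?S \<inter> S1) \<and> F2 ((C \<union> D) \<inter> ?S \<inter> S2)} \<longrightarrow>
       x \<in> {C. F1 (C \<inter> S1)} \<times> {D. F2 (D \<inter> S2)}"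
    proof (intro AE_pmfI impI, clarsimp)
      fix C D assume *: "\<And>D. D \<in> set_pmf (poisson_union ?S \<nu>b) \<Longrightarrow> D \<inter> S1 = {}"
        "D \<in> set_pmf (poisson_union ?S \<nu>b)" "F1 ((C \<union> D) \<inter> ?S \<inter> S1)" "F2 ((C \<union> D) \<inter> ?S \<inter> S2)"
      have "(C \<union> D) \<inter> ?S \<inter> S1 = C \<inter> S1" "D \<inter> S2 \<subseteq> (C \<union> D) \<inter> ?S \<inter> S2" using *(1)[OF *(2)] by auto
      then show "F1 (C \<inter> S1) \<and> F2 (D \<inter> S2)" using *(3,4) F2 by metis
    qed
  qed simp
  also have "\<dots> = measure_pmf.prob (poisson_union ?S \<nu>a) {C. F1 (C \<inter> S1)} * measure_pmf.prob (poisson_union ?S \<nu>b) {D. F2 (D \<inter> S2)}"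
    using fS by (intro prob_pair_pmf_Times finite_set_poisson_union)
  also have "measure_pmf.prob (poisson_union ?S \<nu>a) {C. F1 (C \<inter> S1)} = measure (walk_env q \<rho>) {e. F1 (occupied e \<inter> S1)}"
    by (rule walk_env_law[OF q \<rho> S(1), symmetric])
       (use fS a0 s2 in \<open>auto simp: poisson_union_avoid\<close>)
  also have "measure_pmf.prob (poisson_union ?S \<nu>b) {D. F2 (D \<inter> S2)} \<le> measure (walk_env q (\<rho> * (1 - \<epsilon>))) {e. F2 (occupied e \<inter> S2)}"
  proof -
    have "measure_pmf.prob (poisson_union ?S \<nu>b) {D. F2 (D \<inter> S2)} = measure_pmf.prob (poisson_union ?S (\<lambda>\<tau>. \<nu>c \<tau> + \<nu>d \<tau>)) {D. F2 ((D \<inter> ?S) \<inter> S2)}"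
      unfolding cd[symmetric] by (rule arg_cong[where f="measure _"]) (auto simp: Int_assoc Int_absorb1)
    also have "\<dots> = measure_pmf.prob (pair_pmf (poisson_union ?S \<nu>c) (poisson_union ?S \<nu>d)) {(C, D). F2 (((C \<union> D) \<inter> ?S) \<inter> S2)}"
      by (rule poisson_union_add[OF fS c0 d0])
    also have "\<dots> \<le> measure_pmf.prob (pair_pmf (poisson_union ?S \<nu>c) (poisson_union ?S \<nu>d)) ({C. F2 (C \<inter> S2)} \<times> UNIV)"
    proof (rule measure_pmf.finite_measure_mono)
      have "C \<inter> S2 \<subseteq> ((C \<union> D) \<inter> ?S) \<inter> S2" for C D by auto
      then show "{(C, D). F2 (((C \<union> D) \<inter> ?S) \<inter> S2)} \<subseteq> {C. F2 (C \<inter> S2)} \<times> UNIV"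
        using F2 by blast
    qed simp
    also have "\<dots> = measure_pmf.prob (poisson_union ?S \<nu>c) {C. F2 (C \<inter> S2)}"
      using fS by (subst prob_pair_pmf_Times) (auto intro: finite_set_poisson_union)
    also have "\<dots> = measure (walk_env q (\<rho> * (1 - \<epsilon>))) {e. F2 (occupied e \<inter> S2)}"
      by (rule walk_env_law[OF q _ S(2), symmetric])
         (use fS c0 s4 \<rho> \<epsilon>1 in \<open>auto simp: poisson_union_avoid\<close>)
    finally show ?thesis .
  qed
  finally show ?thesis by (simp add: mult_left_mono)
qed

section \<open>Renormalization of the vacant set\<close>

definition lazy_path :: "(nat \<Rightarrow> int) \<Rightarrow> bool" where
  "lazy_path \<gamma> \<longleftrightarrow> (\<forall>i. \<bar>\<gamma> (Suc i) - \<gamma> i\<bar> \<le> 1)"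

text \<open>The path is quantified inside the event, so choosing it never costs a union bound and
  the random walk may be substituted for it afterwards.\<close>

definition bad :: "(int \<times> int) set \<Rightarrow> int \<times> int \<Rightarrow> nat \<Rightarrow> real \<Rightarrow> bool" where
  "bad T z L d \<longleftrightarrow> (\<exists>\<gamma>. \<gamma> 0 = fst z \<and> lazy_path \<gamma> \<and>
     d < real (card {i. i < L \<and> (\<gamma> i, snd z + int i) \<notin> T}))"

text \<open>A box containing every site that a path from z can reach within L steps, hence a finite
  set that determines \<open>bad\<close> at z (\<open>bad_cong\<close>).\<close>

definition window :: "int \<times> int \<Rightarrow> nat \<Rightarrow> (int \<times> int) set" where
  "window z L = {fst z - int L..fst z + int L} \<times> {snd z..snd z + int L}"

lemma finite_window: "finite (window z L)"
  by (simp add: window_def)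

lemma card_window: "card (window z L) = (2 * L + 1) * (L + 1)"
proof -
  have "card {fst z - int L..fst z + int L} = 2 * L + 1" "card {snd z..snd z + int L} = L + 1" by simp_all
  then show ?thesis by (simp add: window_def card_cartesian_product del: card_atLeastAtMost_int)
qed

lemma lazy_path_bound: "lazy_path \<gamma> \<Longrightarrow> \<bar>\<gamma> (i + j) - \<gamma> i\<bar> \<le> int j"
proof (induction j)
  case (Suc j)
  then have "\<bar>\<gamma> (Suc (i + j)) - \<gamma> (i + j)\<bar> \<le> 1" by (simp add: lazy_path_def)
  then show ?case using Suc by simp
qed simp

lemma bad_cong:
  assumes "T \<inter> window z L = T' \<inter> window z L"
  shows "bad T z L d = bad T' z L d"
proof -
  have *: "{i. i < L \<and> (\<gamma> i, snd z + int i) \<notin> T} = {i. i < L \<and> (\<gamma> i, snd z + int i) \<notin> T'}"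
    if "\<gamma> 0 = fst z" "lazy_path \<gamma>" for \<gamma>
  proof -
    have "(\<gamma> i, snd z + int i) \<in> window z L" if "i < L" for i
      using lazy_path_bound[OF \<open>lazy_path \<gamma>\<close>, of 0 i] that \<open>\<gamma> 0 = fst z\<close> by (auto simp: window_def)
    then show ?thesis using assms by blast
  qed
  show ?thesis unfolding bad_def by (intro arg_cong[where f=Ex] ext conj_cong refl) (simp add: *)
qed

lemma bad_antimono:
  assumes "C \<subseteq> D" "bad D z L d"
  shows "bad C z L d"
proof -
  from assms(2) obtain \<gamma> where \<gamma>: "\<gamma> 0 = fst z" "lazy_path \<gamma>" "d < real (card {i. i < L \<and> (\<gamma> i, snd z + int i) \<notin> D})"
    unfolding bad_def by blast
  have "card {i. i < L \<and> (\<gamma> i, snd z + int i) \<notin> D} \<le> card {i. i < L \<and> (\<gamma> i, snd z + int i) \<notin> C}"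
    using assms(1) by (intro card_mono) auto
  with \<gamma>(3) have "d < real (card {i. i < L \<and> (\<gamma> i, snd z + int i) \<notin> C})" by linarith
  then show ?thesis unfolding bad_def using \<gamma>(1,2) by blast
qed

lemma bad_weaken: "bad T z L d \<Longrightarrow> d' \<le> d \<Longrightarrow> bad T z L d'"
  unfolding bad_def by (elim exE conjE, rule exI) (auto intro: le_less_trans)

lemma sets_bad: "{e. bad (occupied e) z L d} \<in> sets (walk_env q \<rho>)"
proof -
  have "{e. bad (occupied e) z L d} = {e. bad (occupied e \<inter> window z L) z L d}"
    by (intro Collect_cong bad_cong) auto
  then show ?thesis using sets_occupied_on_finite[OF finite_window, of "\<lambda>C. bad C z L d" z L q \<rho>] by simp
qed

text \<open>The estimate at the lowest scale: as d is nonnegative, badness needs at least one vacant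
  site in the window, and a single site has capacity 1.\<close>

lemma prob_bad_le_exp:
  assumes q: "0 \<le> q" "q \<le> 1" and \<rho>: "0 < \<rho>" and d: "0 \<le> d"
  shows "measure (walk_env q \<rho>) {e. bad (occupied e) z L d} \<le> real (card (window z L)) * exp (- \<rho>)"
proof -
  interpret prob_space "walk_env q \<rho>" by (rule prob_space_walk_env)
  have m: "{e. occupied e \<inter> {y} = {}} \<in> events" for y by (rule sets_occupied_on_finite) simp
  have "prob {e. bad (occupied e) z L d} \<le> prob (\<Union>y\<in>window z L. {e. occupied e \<inter> {y} = {}})"
  proof (rule finite_measure_mono)
    show "{e. bad (occupied e) z L d} \<subseteq> (\<Union>y\<in>window z L. {e. occupied e \<inter> {y} = {}})"
    proof
      fix e assume "e \<in> {e. bad (occupied e) z L d}"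
      then have b: "bad (occupied e) z L d" by simp
      show "e \<in> (\<Union>y\<in>window z L. {e. occupied e \<inter> {y} = {}})"
      proof (rule ccontr)
        assume "e \<notin> (\<Union>y\<in>window z L. {e. occupied e \<inter> {y} = {}})"
        then have "occupied e \<inter> window z L = UNIV \<inter> window z L" by auto
        from bad_cong[OF this] b have "bad UNIV z L d" by simp
        then show False using d by (simp add: bad_def)
      qed
    qed
  qed (intro sets.finite_UN finite_window m)
  also have "\<dots> \<le> (\<Sum>y\<in>window z L. prob {e. occupied e \<inter> {y} = {}})"
    using m by (intro finite_measure_subadditive_finite finite_window) auto
  also have "\<dots> = (\<Sum>y\<in>window z L. exp (- \<rho>))"
    by (rule sum.cong) (simp_all only: prob_avoid[OF q \<rho> finite.insertI[OF finite.emptyI]] capacity_point, simp)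
  finally show ?thesis by simp
qed

section \<open>Cutting paths into slots and selecting separated bad ones\<close>

lemma card_by_slots:
  fixes P :: "nat \<Rightarrow> bool"
  shows "card {i. i < N * L \<and> P i} = (\<Sum>j<N. card {i. i < L \<and> P (j * L + i)})"
proof -
  have c: "card {i. i < M \<and> Q i} = (\<Sum>i<M. if Q i then 1 else 0)" for M and Q :: "nat \<Rightarrow> bool"
    by (simp add: sum.If_cases lessThan_def Collect_conj_eq)
  have "(\<Sum>i<N * L. if P i then 1 else 0 :: nat) = (\<Sum>j<N. \<Sum>i\<in>{j * L..<j * L + L}. if P i then 1 else 0)"
    by (rule sum.nat_group[symmetric])
  also have "\<dots> = (\<Sum>j<N. \<Sum>i<L. if P (j * L + i) then 1 else 0)"
  proof (rule sum.cong[OF refl])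
    fix j
    show "(\<Sum>i\<in>{j * L..<j * L + L}. if P i then 1 else 0 :: nat) = (\<Sum>i<L. if P (j * L + i) then 1 else 0)"
      using sum.shift_bounds_nat_ivl[of "\<lambda>i. if P i then 1 else 0 :: nat" 0 "j * L" L]
      by (simp only: lessThan_atLeast0 add_0 add_0_right add.commute[of L] add.commute[of _ "j * L"])
  qed
  finally show ?thesis unfolding c .
qed

text \<open>Every slot is charged \<bar>d\<bar>, and a bad one additionally its full length
  L.\<close>

lemma vacant_count_le_bad_slots:
  assumes \<gamma>: "lazy_path \<gamma>"
  shows "real (card {i. i < N * L \<and> (\<gamma> i, t + int i) \<notin> T}) \<le>
    real (card {j. j < N \<and> bad T (\<gamma> (j * L), t + int (j * L)) L d}) * real L + real N * \<bar>d\<bar>"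
proof -
  let ?B = "{j. j < N \<and> bad T (\<gamma> (j * L), t + int (j * L)) L d}"
  let ?c = "\<lambda>j. card {i. i < L \<and> (\<gamma> (j * L + i), t + int (j * L + i)) \<notin> T}"
  have "real (?c j) \<le> (if j \<in> ?B then real L else 0) + \<bar>d\<bar>" if "j < N" for j
  proof (cases "j \<in> ?B")
    case True
    have "?c j \<le> card {..<L}" by (rule card_mono) auto
    then show ?thesis using True by simp
  next
    case False
    have "lazy_path (\<lambda>i. \<gamma> (j * L + i))" using \<gamma> by (simp add: lazy_path_def)
    then have "bad T (\<gamma> (j * L), t + int (j * L)) L d" if "d < real (?c j)"
      unfolding bad_def using that by (intro exI[of _ "\<lambda>i. \<gamma> (j * L + i)"]) (simp add: add.assoc)
    moreover have "\<not> bad T (\<gamma> (j * L), t + int (j * L)) L d" using False that by simp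
    ultimately have "real (?c j) \<le> d" by (meson not_le)
    then show ?thesis using abs_ge_self[of d] False by (simp only: if_False)
  qed
  then have "(\<Sum>j<N. real (?c j)) \<le> (\<Sum>j<N. (if j \<in> ?B then real L else 0) + \<bar>d\<bar>)"
    by (intro sum_mono) auto
  also have "\<dots> = (\<Sum>j\<in>?B. real L) + real N * \<bar>d\<bar>"
    unfolding sum.distrib by (simp add: sum.If_cases Collect_conj_eq lessThan_def)
  finally show ?thesis unfolding card_by_slots by simp
qed

text \<open>Greedy choice from the top: at most G indices, the maximum included, lie closer than G
  to the maximum. The list is decreasing so that its head is the latest slot, the one split off in
  \<open>prob_spaced_bad_le\<close>.\<close>

lemma spaced_sublist:
  fixes J :: "nat set"
  assumes "finite J" "m * G \<le> card J" "0 < G"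
  shows "\<exists>js. length js = m \<and> set js \<subseteq> J \<and> sorted_wrt (\<lambda>i j. j + G \<le> i) js"
  using assms
proof (induction m arbitrary: J)
  case 0
  show ?case by (intro exI[of _ "[]"]) simp
next
  case (Suc m)
  have "J \<noteq> {}" using Suc.prems by auto
  define j where "j = Max J"
  define J' where "J' = {i \<in> J. i + G \<le> j}"
  have j: "j \<in> J" "\<And>i. i \<in> J \<Longrightarrow> i \<le> j" using Suc.prems \<open>J \<noteq> {}\<close> by (auto simp: j_def)
  have "J - J' \<subseteq> {Suc j - G..<Suc j}"
  proof
    fix i assume "i \<in> J - J'"
    then show "i \<in> {Suc j - G..<Suc j}" using j(2)[of i] by (auto simp: J'_def)
  qed
  then have "card (J - J') \<le> card {Suc j - G..<Suc j}" by (intro card_mono) auto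
  then have "card (J - J') \<le> G" by simp
  moreover have "card J = card (J - J') + card J'"
    using Suc.prems by (subst card_Un_disjoint[symmetric]) (auto simp: J'_def intro: arg_cong[where f=card])
  ultimately have "m * G \<le> card J'" using Suc.prems by simp
  moreover have "finite J'" using Suc.prems by (auto simp: J'_def)
  ultimately obtain js where js: "length js = m" "set js \<subseteq> J'" "sorted_wrt (\<lambda>i j. j + G \<le> i) js"
    using Suc.IH Suc.prems by blast
  then have "length (j # js) = Suc m \<and> set (j # js) \<subseteq> J \<and> sorted_wrt (\<lambda>i j. j + G \<le> i) (j # js)"
    using j by (auto simp: J'_def)
  then show ?case by blast
qed

text \<open>With at most m G bad slots the path would meet at most N d + m G L \<le> D vacant sites.
  So there are more, enough for m of them with starting times at least G L apart.\<close>

lemma bad_imp_spaced_bad: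
  assumes b: "bad T z (N * L) D" and D: "real N * d + real (m * G) * real L \<le> D" and d: "0 \<le> d" and G: "0 < G"
  shows "\<exists>zs. length zs = m \<and> set zs \<subseteq> window z (N * L) \<and>
    sorted_wrt (\<lambda>y y'. snd y' + int (G * L) \<le> snd y) zs \<and> (\<forall>y\<in>set zs. bad T y L d)"
proof -
  from b obtain \<gamma> where \<gamma>: "\<gamma> 0 = fst z" "lazy_path \<gamma>"
    and c: "D < real (card {i. i < N * L \<and> (\<gamma> i, snd z + int i) \<notin> T})" unfolding bad_def by blast
  define y where "y j = (\<gamma> (j * L), snd z + int (j * L))" for j
  define J where "J = {j. j < N \<and> bad T (y j) L d}"
  have "D < real (card J) * real L + real N * d"
    using vacant_count_le_bad_slots[OF \<gamma>(2), of N L "snd z" T d] c d by (simp add: J_def y_def)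
  then have "real (m * G) * real L < real (card J) * real L" using D by linarith
  then have "real (m * G) < real (card J)" by (simp add: mult_less_cancel_right del: of_nat_mult)
  then have "m * G \<le> card J" by linarith
  then obtain js where js: "length js = m" "set js \<subseteq> J" "sorted_wrt (\<lambda>i j. j + G \<le> i) js"
    using spaced_sublist[of J m G] G by (auto simp: J_def)
  have "snd (y j) + int (G * L) \<le> snd (y i)" if "j + G \<le> i" for i j
  proof -
    have "j * L + G * L \<le> i * L" using that mult_le_mono1[of "j + G" i L] by (simp add: add_mult_distrib)
    then have "int (j * L + G * L) \<le> int (i * L)" by (rule of_nat_mono)
    then show ?thesis by (simp add: y_def)
  qed
  then have "sorted_wrt (\<lambda>y y'. snd y' + int (G * L) \<le> snd y) (map y js)"
    unfolding sorted_wrt_map by (intro sorted_wrt_mono_rel[OF _ js(3)]) auto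
  moreover have "set (map y js) \<subseteq> window z (N * L)"
  proof
    fix u assume "u \<in> set (map y js)"
    then obtain j where j: "u = y j" "j < N" using js(2) by (auto simp: J_def)
    have "j * L \<le> N * L" using j by simp
    then have "int (j * L) \<le> int (N * L)" by (rule of_nat_mono)
    then show "u \<in> window z (N * L)"
      using lazy_path_bound[OF \<gamma>(2), of 0 "j * L"] \<gamma>(1) j(1) by (auto simp: window_def y_def)
  qed
  moreover have "\<forall>u\<in>set (map y js). bad T u L d" using js(2) by (auto simp: J_def)
  moreover have "length (map y js) = m" using js(1) by simp
  ultimately show ?thesis by blast
qed

text \<open>The latest window is decoupled from the union of the earlier ones. The earlier ones keep
  density \<rho> and only the latest drops to \<rho> (1 - \<epsilon>), so one loss \<epsilon> serves
  all factors. There are at most m earlier windows, whence the factor m in the hypothesis on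
  \<epsilon>.\<close>

lemma prob_spaced_bad_le:
  assumes q: "0 < q" "q < 1" and \<rho>: "0 < \<rho>" and g: "0 < g"
    and \<epsilon>: "real m * ((4 * real L + 1) / sqrt ((1 - q) * (real g + 1))) \<le> \<epsilon>" "\<epsilon> < 1"
    and p: "\<And>z. measure (walk_env q (\<rho> * (1 - \<epsilon>))) {e. bad (occupied e) z L d} \<le> p"
    and zs: "length zs \<le> Suc m" "sorted_wrt (\<lambda>y y'. snd y' + int (L + g) \<le> snd y) zs"
  shows "measure (walk_env q \<rho>) {e. \<forall>y\<in>set zs. bad (occupied e) y L d} \<le> p ^ length zs"
  using zs
proof (induction zs)
  case Nil
  interpret prob_space "walk_env q \<rho>" by (rule prob_space_walk_env)
  show ?case by simp
next
  case (Cons z zs)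
  interpret prob_space "walk_env q \<rho>" by (rule prob_space_walk_env)
  interpret St: prob_space "steps q" by (rule prob_space_steps)
  have p0: "0 \<le> p" using p[of z] measure_nonneg order_trans by blast
  define S1 where "S1 = (\<Union>y\<in>set zs. window y L)"
  let ?S2 = "window z L"
  have early: "snd y + int L + int g \<le> snd z" if "y \<in> set zs" for y using Cons.prems that by auto
  have fS1: "finite S1" by (simp add: S1_def finite_window)
  have t: "snd u + int g \<le> snd z" if "u \<in> S1" for u
    using that early by (fastforce simp: S1_def window_def)
  have hit: "measure (steps q) {\<xi>. traj_graph \<xi> (x - traj \<xi> 0 (snd z)) \<inter> S1 \<noteq> {}} \<le> \<epsilon>" for x
  proof -
    let ?g = "\<lambda>\<xi>. traj_graph \<xi> (x - traj \<xi> 0 (snd z))"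
    have m: "{\<xi>. ?g \<xi> \<inter> window y L \<noteq> {}} \<in> sets (steps q)" for y
      by (intro sets_Collect_UNIV space_steps pred_traj_graph_on_finite[OF finite_window _ measurable_recentre, where f="\<lambda>\<xi>. \<xi>" and q=q]) simp
    have "{\<xi>. ?g \<xi> \<inter> S1 \<noteq> {}} = (\<Union>y\<in>set zs. {\<xi>. ?g \<xi> \<inter> window y L \<noteq> {}})" by (auto simp: S1_def)
    also have "measure (steps q) \<dots> \<le> (\<Sum>y\<in>set zs. measure (steps q) {\<xi>. ?g \<xi> \<inter> window y L \<noteq> {}})"
      using m by (intro St.finite_measure_subadditive_finite) auto
    also have "\<dots> \<le> (\<Sum>y\<in>set zs. (4 * real L + 1) / sqrt ((1 - q) * (real g + 1)))"
    proof (rule sum_mono)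
      fix y assume "y \<in> set zs"
      then show "measure (steps q) {\<xi>. ?g \<xi> \<inter> window y L \<noteq> {}} \<le> (4 * real L + 1) / sqrt ((1 - q) * (real g + 1))"
        using early by (intro measure_hit_window_le[OF q finite_window, where y="fst y" and t="snd y"]) (auto simp: window_def)
    qed
    also have "\<dots> = real (card (set zs)) * ((4 * real L + 1) / sqrt ((1 - q) * (real g + 1)))" by simp
    also have "\<dots> \<le> real m * ((4 * real L + 1) / sqrt ((1 - q) * (real g + 1)))"
      using Cons.prems(1) card_length[of zs] q by (intro mult_right_mono) auto
    finally show ?thesis using \<epsilon>(1) by simp
  qed
  have "bad (occupied e) y L d = bad (occupied e \<inter> S1) y L d" if "y \<in> set zs" for y e
    using that by (intro bad_cong) (auto simp: S1_def)
  then have r1: "(\<forall>y\<in>set zs. bad (occupied e) y L d) = (\<forall>y\<in>set zs. bad (occupied e \<inter> S1) y L d)" for e by blast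
  have r2: "bad (occupied e) z L d = bad (occupied e \<inter> ?S2) z L d" for e by (intro bad_cong) auto
  have "prob {e. \<forall>y\<in>set (z # zs). bad (occupied e) y L d} =
    prob {e. (\<forall>y\<in>set zs. bad (occupied e \<inter> S1) y L d) \<and> bad (occupied e \<inter> ?S2) z L d}"
    by (rule arg_cong[where f=prob]) (use r1 r2 in auto)
  also have "\<dots> \<le> prob {e. \<forall>y\<in>set zs. bad (occupied e \<inter> S1) y L d} * measure (walk_env q (\<rho> * (1 - \<epsilon>))) {e. bad (occupied e \<inter> ?S2) z L d}"
  proof (rule decoupling[where s="snd z"])
    show "S1 \<inter> ?S2 = {}" using t g by (fastforce simp: window_def)
    show "snd u \<le> snd z" if "u \<in> S1" for u using t[OF that] by simp
    show "bad C z L d" if "C \<subseteq> D" "bad D z L d" for C D using that by (rule bad_antimono)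
  qed (use q \<rho> \<epsilon> fS1 hit in \<open>auto simp: finite_window window_def\<close>)
  also have "\<dots> \<le> p ^ length zs * p"
  proof (rule mult_mono)
    show "prob {e. \<forall>y\<in>set zs. bad (occupied e \<inter> S1) y L d} \<le> p ^ length zs"
      using Cons by (simp add: r1)
    show "measure (walk_env q (\<rho> * (1 - \<epsilon>))) {e. bad (occupied e \<inter> ?S2) z L d} \<le> p"
      using p[of z] by (simp add: r2)
  qed (use p0 in auto)
  finally show ?case by (simp add: mult.commute)
qed

text \<open>A bad path at length N L yields m separated bad starting points in its window. The union
  bound over lists of m sites costs the m-th power of the window size, against the m-th power of
  p.\<close>

lemma prob_bad_renormalization:
  assumes q: "0 < q" "q < 1" and \<rho>: "0 < \<rho>" and g: "0 < g"
    and \<epsilon>: "real m * ((4 * real L + 1) / sqrt ((1 - q) * (real g + 1))) \<le> \<epsilon>" "\<epsilon> < 1"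
    and p: "\<And>z. measure (walk_env q (\<rho> * (1 - \<epsilon>))) {e. bad (occupied e) z L d} \<le> p"
    and G: "L + g \<le> G * L" "0 < G" and d: "0 \<le> d"
    and D: "real N * d + real (m * G) * real L \<le> D"
  shows "measure (walk_env q \<rho>) {e. bad (occupied e) z (N * L) D} \<le> (real (card (window z (N * L))) * p) ^ m"
proof -
  interpret prob_space "walk_env q \<rho>" by (rule prob_space_walk_env)
  define Z where "Z = {zs. (set zs \<subseteq> window z (N * L) \<and> length zs = m)}"
  define Z' where "Z' = {zs \<in> Z. sorted_wrt (\<lambda>y y'. snd y' + int (L + g) \<le> snd y) zs}"
  have fZ: "finite Z" unfolding Z_def by (rule finite_lists_length_eq[OF finite_window])
  have cZ: "card Z = card (window z (N * L)) ^ m" unfolding Z_def by (rule card_lists_length_eq[OF finite_window])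
  have fZ': "finite Z'" using fZ by (auto simp: Z'_def)
  have m: "{e. \<forall>y\<in>set zs. bad (occupied e) y L d} \<in> events" for zs
  proof -
    have "Measurable.pred (walk_env q \<rho>) (\<lambda>e. \<forall>y\<in>set zs. bad (occupied e) y L d)"
      using sets_bad by (intro pred_intros_finite) (auto simp: pred_def)
    then show ?thesis by (rule sets_Collect_UNIV[OF space_walk_env])
  qed
  have p0: "0 \<le> p" using p[of z] measure_nonneg order_trans by blast
  have "prob {e. bad (occupied e) z (N * L) D} \<le> prob (\<Union>zs\<in>Z'. {e. \<forall>y\<in>set zs. bad (occupied e) y L d})"
  proof (rule finite_measure_mono)
    show "{e. bad (occupied e) z (N * L) D} \<subseteq> (\<Union>zs\<in>Z'. {e. \<forall>y\<in>set zs. bad (occupied e) y L d})"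
    proof
      fix e assume "e \<in> {e. bad (occupied e) z (N * L) D}"
      then obtain zs where zs: "length zs = m" "set zs \<subseteq> window z (N * L)"
        "sorted_wrt (\<lambda>y y'. snd y' + int (G * L) \<le> snd y) zs" "\<forall>y\<in>set zs. bad (occupied e) y L d"
        using bad_imp_spaced_bad[OF _ D d G(2)] by blast
      have "int (L + g) \<le> int (G * L)" using G(1) by (rule of_nat_mono)
      then have "sorted_wrt (\<lambda>y y'. snd y' + int (L + g) \<le> snd y) zs"
        by (intro sorted_wrt_mono_rel[OF _ zs(3)]) linarith
      with zs show "e \<in> (\<Union>zs\<in>Z'. {e. \<forall>y\<in>set zs. bad (occupied e) y L d})" by (auto simp: Z'_def Z_def)
    qed
  qed (intro sets.finite_UN fZ' m)
  also have "\<dots> \<le> (\<Sum>zs\<in>Z'. prob {e. \<forall>y\<in>set zs. bad (occupied e) y L d})"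
    using m by (intro finite_measure_subadditive_finite fZ') auto
  also have "\<dots> \<le> (\<Sum>zs\<in>Z'. p ^ m)"
  proof (rule sum_mono)
    fix zs assume "zs \<in> Z'"
    then show "prob {e. \<forall>y\<in>set zs. bad (occupied e) y L d} \<le> p ^ m"
      using prob_spaced_bad_le[OF q \<rho> g \<epsilon> p, of zs] by (auto simp: Z'_def Z_def)
  qed
  also have "\<dots> \<le> real (card Z) * p ^ m"
    using card_mono[OF fZ, of Z'] p0 by (auto simp: Z'_def intro!: mult_right_mono)
  finally show ?thesis by (simp add: cZ power_mult_distrib)
qed

section \<open>Iteration over the scales\<close>

lemma card_window_le:
  assumes "6 \<le> B" "1 \<le> M"
  shows "real (card (window z M)) \<le> real B * real M ^ 2"
proof -
  have "(2 * M + 1) * (M + 1) \<le> (3 * M) * (2 * M)" using assms(2) by (intro mult_mono) auto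
  also have "\<dots> = 6 * M ^ 2" by (simp add: power2_eq_square)
  also have "\<dots> \<le> B * M ^ 2" using assms(1) by simp
  finally have "card (window z M) \<le> B * M ^ 2" by (simp add: card_window)
  then have "real (card (window z M)) \<le> real (B * M ^ 2)" by (rule of_nat_mono)
  then show ?thesis by simp
qed

lemma scale_ge:
  assumes "4 \<le> (B::nat)"
  shows "real B * 4 ^ k \<le> real (B ^ 4 ^ k)"
proof -
  have "Suc k \<le> 4 ^ k" by (induction k) auto
  have "B * 4 ^ k \<le> B * B ^ k" using assms by (intro mult_left_mono power_mono) auto
  also have "\<dots> = B ^ Suc k" by simp
  also have "\<dots> \<le> B ^ 4 ^ k" using assms \<open>Suc k \<le> 4 ^ k\<close> by (intro power_increasing) auto
  finally have "real (B * 4 ^ k) \<le> real (B ^ 4 ^ k)" by (rule of_nat_mono)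
  then show ?thesis by simp
qed

text \<open>One induction step uses m = 16, N = g = L^3 and G = L^2 + 1. Vacancy threshold and
  density both carry the factor 2 - 1 / 2^k: it grows by 1 / 2^(k + 1) per step, which pays for the
  losses, and stays below 2. In exponents of B, in units of 8^k, the entropy takes at most 9 from
  34; the remaining 25 times 16 gives 400, above the required 34 * 8 = 272.\<close>

lemma multiscale_prob_bad:
  fixes B :: nat
  assumes q: "0 < q" "q < 1" and B: "6 \<le> B" "102400 \<le> (1 - q) * real B" "64 \<le> \<delta> * real B"
    and \<rho>0: "0 < \<rho>0" "real B ^ 3 * exp (- \<rho>0) \<le> 1 / real B ^ 34"
    and \<rho>: "\<rho>0 * (2 - 1 / 2 ^ k) \<le> \<rho>"
  shows "measure (walk_env q \<rho>) {e. bad (occupied e) z (B ^ 4 ^ k) (\<delta> * (2 - 1 / 2 ^ k) * real (B ^ 4 ^ k))} \<le> 1 / real B ^ (34 * 8 ^ k)"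
  using \<rho>
proof (induction k arbitrary: \<rho> z)
  case 0
  then have \<rho>: "\<rho>0 \<le> \<rho>" by simp
  have "0 < \<delta> * real B" using B(3) by linarith
  then have \<delta>: "0 < \<delta>" by (simp add: zero_less_mult_iff)
  have "measure (walk_env q \<rho>) {e. bad (occupied e) z B (\<delta> * real B)} \<le> real (card (window z B)) * exp (- \<rho>)"
    using q \<rho> \<rho>0(1) \<delta> by (intro prob_bad_le_exp) auto
  also have "\<dots> \<le> (real B * real B ^ 2) * exp (- \<rho>0)"
    using \<rho> B by (intro mult_mono card_window_le) auto
  also have "\<dots> \<le> 1 / real B ^ 34" using \<rho>0(2) by (simp add: power3_eq_cube power2_eq_square mult.assoc)
  finally show ?case by simp
next
  case (Suc k)
  define L where "L = B ^ 4 ^ k"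
  define M where "M = B ^ 4 ^ Suc k"
  \<comment> \<open>t is the density loss \<epsilon> of this step. The factors at scales k and k + 1
    read 2 - 4t and 2 - 2t, and (2 - 2t)(1 - t) \<ge> 2 - 4t keeps the density high enough for the
    induction hypothesis.\<close>
  define t where "t = 1 / (2::real) ^ (k + 2)"
  have t: "0 < t" "t < 1" "1 / 2 ^ k = 4 * t" "1 / 2 ^ Suc k = 2 * t"
    using one_less_power[of "2::real" "k + 2"] by (simp_all add: t_def field_simps)
  have "0 < \<delta> * real B" using B(3) by linarith
  then have \<delta>: "0 < \<delta>" by (simp add: zero_less_mult_iff)
  have LM: "L ^ 3 * L = M" by (simp add: L_def M_def power_mult[symmetric] power_add[symmetric])
  have L1: "1 \<le> L" "1 \<le> M" using B(1) by (auto simp: L_def M_def)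
  have Lge: "real B * 4 ^ k \<le> real L" using scale_ge[of B k] B(1) by (simp add: L_def)
  have pw: "(4::real) ^ k = (2 ^ k)\<^sup>2" "(1::real) \<le> 2 ^ k"
    by (simp_all add: power_mult[symmetric] mult.commute[of k] power_mult)
  \<comment> \<open>Here 102400 = 320^2. Since L \<ge> B 4^k, the square root is at least 320 L 2^k,
    and 16 * 5 / 320 = 1 / 4 gives t.\<close>
  have \<epsilon>: "real 16 * ((4 * real L + 1) / sqrt ((1 - q) * (real (L ^ 3) + 1))) \<le> t"
  proof -
    have "102400 * (2 ^ k)\<^sup>2 \<le> (1 - q) * (real B * 4 ^ k)"
      using mult_right_mono[OF B(2), of "4 ^ k"] by (simp add: pw mult.assoc)
    also have "\<dots> \<le> (1 - q) * real L" using q Lge by (intro mult_left_mono) auto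
    finally have "(320 * 2 ^ k)\<^sup>2 \<le> (1 - q) * real L" by (simp add: power_mult_distrib)
    then have "real L ^ 2 * (320 * 2 ^ k)\<^sup>2 \<le> real L ^ 2 * ((1 - q) * real L)" by (intro mult_left_mono) auto
    then have "(real L * (320 * 2 ^ k))\<^sup>2 \<le> (1 - q) * (real (L ^ 3) + 1)"
      using q by (simp add: power_mult_distrib power2_eq_square power3_eq_cube algebra_simps)
    then have "real L * (320 * 2 ^ k) \<le> sqrt ((1 - q) * (real (L ^ 3) + 1))" by (rule real_le_rsqrt)
    then have "(4 * real L + 1) / sqrt ((1 - q) * (real (L ^ 3) + 1)) \<le> (5 * real L) / (real L * (320 * 2 ^ k))"
      using L1 by (intro frac_le) auto
    also have "\<dots> = 1 / (64 * 2 ^ k)" using L1 by (simp add: field_simps)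
    finally have "real 16 * ((4 * real L + 1) / sqrt ((1 - q) * (real (L ^ 3) + 1))) \<le> real 16 * (1 / (64 * 2 ^ k))"
      by (intro mult_left_mono) auto
    also have "\<dots> = t" by (simp add: t_def power_add)
    finally show ?thesis .
  qed
  \<comment> \<open>The sacrificed slots contain 16 (L^3 + L) \<le> 32 L^3 sites, and the growing
    threshold leaves room 2 t \<delta> L^4. So 16 \<le> t \<delta> L is needed, which is the origin
    of the 64 in the bound on \<delta> B.\<close>
  have D: "real (L ^ 3) * (\<delta> * (2 - 1 / 2 ^ k) * real L) + real (16 * (L ^ 2 + 1)) * real L \<le> \<delta> * (2 - 1 / 2 ^ Suc k) * real M"
  proof -
    have "64 * 2 ^ k \<le> 64 * (4::real) ^ k" by (intro mult_left_mono power_mono) auto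
    also have "\<dots> \<le> (\<delta> * real B) * 4 ^ k" using B(3) by (intro mult_right_mono) auto
    also have "\<dots> \<le> \<delta> * real L" using Lge \<delta> by (simp add: mult.assoc)
    finally have "16 \<le> t * (\<delta> * real L)" by (simp add: t_def field_simps power_add)
    then have "16 * (2 * real L ^ 3) \<le> (t * (\<delta> * real L)) * (2 * real L ^ 3)" by (intro mult_right_mono) auto
    moreover have "real L \<le> real L ^ 3" using L1 by (simp add: self_le_power)
    ultimately have "16 * (real L ^ 3 + real L) \<le> 2 * t * \<delta> * real L ^ 4" by (simp add: power_numeral_reduce algebra_simps)
    moreover have "real M = real L ^ 4" using LM by (simp add: power_numeral_reduce flip: of_nat_power of_nat_mult)
    ultimately show ?thesis unfolding t by (simp add: algebra_simps power_numeral_reduce)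
  qed
  have p: "measure (walk_env q (\<rho> * (1 - t))) {e. bad (occupied e) z L (\<delta> * (2 - 1 / 2 ^ k) * real L)} \<le> 1 / real B ^ (34 * 8 ^ k)" for z
    unfolding L_def
  proof (rule Suc.IH)
    have "2 - 4 * t \<le> (2 - 2 * t) * (1 - t)" by (simp add: algebra_simps)
    then have "\<rho>0 * (2 - 4 * t) \<le> \<rho>0 * (2 - 2 * t) * (1 - t)"
      using \<rho>0(1) by (simp add: mult.assoc)
    also have "\<dots> \<le> \<rho> * (1 - t)"
    proof (rule mult_right_mono)
      show "\<rho>0 * (2 - 2 * t) \<le> \<rho>" using Suc.prems unfolding t .
    qed (use t in simp)
    finally show "\<rho>0 * (2 - 1 / 2 ^ k) \<le> \<rho> * (1 - t)" by (simp only: t)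
  qed
  have \<rho>: "0 < \<rho>"
  proof -
    have "0 < \<rho>0 * (2 - 2 * t)" using \<rho>0 t by (intro mult_pos_pos) auto
    then show ?thesis using Suc.prems unfolding t by linarith
  qed
  have "measure (walk_env q \<rho>) {e. bad (occupied e) z (L ^ 3 * L) (\<delta> * (2 - 1 / 2 ^ Suc k) * real M)}
    \<le> (real (card (window z (L ^ 3 * L))) * (1 / real B ^ (34 * 8 ^ k))) ^ 16"
  proof (rule prob_bad_renormalization[OF q \<rho> _ \<epsilon> t(2) p _ _ _ D])
    show "0 < L ^ 3" using L1 by simp
    show "L + L ^ 3 \<le> (L\<^sup>2 + 1) * L" by (simp add: power_numeral_reduce)
    have "(1::real) / 2 ^ k \<le> 1" using pw(2) by simp
    then have "0 \<le> 2 - (1::real) / 2 ^ k" by linarith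
    then show "0 \<le> \<delta> * (2 - 1 / 2 ^ k) * real L" using \<delta> by (intro mult_nonneg_nonneg) simp_all
  qed simp
  also have "\<dots> \<le> (1 / real B ^ (25 * 8 ^ k)) ^ 16"
  proof (rule power_mono)
    have e: "1 + 2 * 4 ^ Suc k \<le> 9 * (8::nat) ^ k"
    proof -
      have "(4::nat) ^ k \<le> 8 ^ k" "(1::nat) \<le> 8 ^ k" by (auto intro: power_mono)
      moreover have "1 + 2 * 4 ^ Suc k = 1 + 8 * (4::nat) ^ k" by simp
      ultimately show ?thesis by linarith
    qed
    have "real (card (window z (L ^ 3 * L))) \<le> real B * real M ^ 2"
      unfolding LM using B L1 by (intro card_window_le) auto
    also have "\<dots> = real B ^ (1 + 2 * 4 ^ Suc k)" by (simp add: M_def power_mult[symmetric] mult.commute)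
    also have "\<dots> \<le> real B ^ (9 * 8 ^ k)" using B(1) e by (intro power_increasing) auto
    finally have "real (card (window z (L ^ 3 * L))) * (1 / real B ^ (34 * 8 ^ k)) \<le> real B ^ (9 * 8 ^ k) * (1 / real B ^ (34 * 8 ^ k))"
      by (intro mult_right_mono) auto
    also have "\<dots> = 1 / real B ^ (25 * 8 ^ k)"
    proof -
      have "34 * (8::nat) ^ k = 9 * 8 ^ k + 25 * 8 ^ k" by simp
      then have "real B ^ (34 * 8 ^ k) = real B ^ (9 * 8 ^ k) * real B ^ (25 * 8 ^ k)" by (simp only: power_add)
      then show ?thesis using B(1) by simp
    qed
    finally show "real (card (window z (L ^ 3 * L))) * (1 / real B ^ (34 * 8 ^ k)) \<le> 1 / real B ^ (25 * 8 ^ k)" .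
  qed simp
  also have "\<dots> = 1 / real B ^ (25 * 8 ^ k * 16)"
    by (simp only: power_one_over flip: power_mult)
  also have "\<dots> \<le> 1 / real B ^ (34 * 8 ^ Suc k)"
    using B(1) by (intro divide_left_mono power_increasing) auto
  finally show ?case unfolding LM M_def .
qed

text \<open>The previous bound is applied with \<delta> / 2, since its threshold may double. The
  union over the window at scale k + 2 costs an exponent 1 + 32 * 4^k \<le> 33 * 8^k; hence the
  choice 34 = 33 + 1, which leaves 8^k.\<close>

lemma env_good_at_all_scales:
  assumes q: "0 < q" "q < 1" and \<delta>: "0 < \<delta>"
  shows "\<exists>B \<rho>0. 6 \<le> (B::nat) \<and> 0 < \<rho>0 \<and> (\<forall>\<rho>\<ge>\<rho>0. \<forall>k.
    measure (walk_env q \<rho>) {e. \<exists>z\<in>window (0, 0) (B ^ 4 ^ (k + 2)). bad (occupied e) z (B ^ 4 ^ k) (\<delta> * real (B ^ 4 ^ k))}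
      \<le> 1 / real B ^ (8 ^ k))"
proof -
  obtain B :: nat where B': "max 6 (max (102400 / (1 - q)) (64 / (\<delta> / 2))) \<le> real B"
    using real_arch_simple by blast
  then have B: "6 \<le> B" "102400 \<le> (1 - q) * real B" "64 \<le> \<delta> / 2 * real B"
    using q \<delta> by (auto simp: field_simps)
  \<comment> \<open>37 = 3 + 34: the window at the lowest scale costs B^3 and the induction must
    start with B^(-34).\<close>
  define \<rho>0 where "\<rho>0 = 37 * ln (real B)"
  have "exp (- \<rho>0) = 1 / real B ^ 37"
    using B(1) by (simp add: \<rho>0_def exp_minus exp_of_nat_mult[of 37, simplified] divide_inverse)
  then have \<rho>0: "0 < \<rho>0" "real B ^ 3 * exp (- \<rho>0) \<le> 1 / real B ^ 34"
    using B(1) by (simp_all add: \<rho>0_def field_simps flip: power_add)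
  have "measure (walk_env q \<rho>) {e. \<exists>z\<in>window (0, 0) (B ^ 4 ^ (k + 2)). bad (occupied e) z (B ^ 4 ^ k) (\<delta> * real (B ^ 4 ^ k))}
      \<le> 1 / real B ^ (8 ^ k)" if \<rho>: "2 * \<rho>0 \<le> \<rho>" for \<rho> k
  proof -
    interpret prob_space "walk_env q \<rho>" by (rule prob_space_walk_env)
    let ?L = "B ^ 4 ^ k" and ?W = "window (0, 0) (B ^ 4 ^ (k + 2))"
    let ?d = "\<delta> / 2 * (2 - 1 / 2 ^ k) * real ?L"
    have "\<delta> / 2 * (2 - 1 / 2 ^ k) \<le> \<delta>" using \<delta> by (simp add: field_simps)
    then have d: "?d \<le> \<delta> * real ?L" by (intro mult_right_mono) auto
    have "\<rho>0 * (2 - 1 / 2 ^ k) \<le> \<rho>0 * 2" using \<rho>0 by (intro mult_left_mono) auto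
    then have \<rho>': "\<rho>0 * (2 - 1 / 2 ^ k) \<le> \<rho>" using \<rho> by simp
    have "prob {e. \<exists>z\<in>?W. bad (occupied e) z ?L (\<delta> * real ?L)} \<le> prob (\<Union>z\<in>?W. {e. bad (occupied e) z ?L ?d})"
    proof (rule finite_measure_mono)
      show "{e. \<exists>z\<in>?W. bad (occupied e) z ?L (\<delta> * real ?L)} \<subseteq> (\<Union>z\<in>?W. {e. bad (occupied e) z ?L ?d})"
        using bad_weaken[OF _ d] by blast
    qed (intro sets.finite_UN finite_window sets_bad)
    also have "\<dots> \<le> (\<Sum>z\<in>?W. prob {e. bad (occupied e) z ?L ?d})"
      using sets_bad by (intro finite_measure_subadditive_finite finite_window) auto
    also have "\<dots> \<le> (\<Sum>z\<in>?W. 1 / real B ^ (34 * 8 ^ k))"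
      using multiscale_prob_bad[OF q B \<rho>0 \<rho>'] by (intro sum_mono)
    also have "\<dots> = real (card ?W) * (1 / real B ^ (34 * 8 ^ k))" by simp
    also have "\<dots> \<le> real B ^ (33 * 8 ^ k) * (1 / real B ^ (34 * 8 ^ k))"
    proof (rule mult_right_mono)
      have e: "1 + 2 * 4 ^ (k + 2) \<le> 33 * (8::nat) ^ k"
      proof -
        have "(4::nat) ^ k \<le> 8 ^ k" "(1::nat) \<le> 8 ^ k" by (auto intro: power_mono)
        moreover have "1 + 2 * 4 ^ (k + 2) = 1 + 32 * (4::nat) ^ k" by (simp add: power_add)
        ultimately show ?thesis by linarith
      qed
      have "real (card ?W) \<le> real B * real (B ^ 4 ^ (k + 2)) ^ 2"
        using B by (intro card_window_le) auto
      also have "\<dots> = real B ^ (1 + 2 * 4 ^ (k + 2))" by (simp add: power_mult[symmetric] mult.commute)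
      also have "\<dots> \<le> real B ^ (33 * 8 ^ k)" using B(1) e by (intro power_increasing) auto
      finally show "real (card ?W) \<le> real B ^ (33 * 8 ^ k)" .
    qed simp
    also have "\<dots> = 1 / real B ^ (8 ^ k)"
    proof -
      have "34 * (8::nat) ^ k = 33 * 8 ^ k + 8 ^ k" by simp
      then have "real B ^ (34 * 8 ^ k) = real B ^ (33 * 8 ^ k) * real B ^ (8 ^ k)" by (simp only: power_add)
      then show ?thesis using B(1) by simp
    qed
    finally show ?thesis .
  qed
  then show ?thesis using B(1) \<rho>0(1) by (intro exI[of _ B] exI[of _ "2 * \<rho>0"]) auto
qed

section \<open>The driven walk in a fixed environment\<close>

definition uniforms :: "(int \<times> int \<Rightarrow> real) measure" where
  "uniforms = PiM UNIV (\<lambda>_. uniform_measure lborel {0..1::real})"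

text \<open>\<open>Ywalk\<close> from the origin with the trace replaced by an arbitrary
  deterministic set T, so that the environment can be integrated last.\<close>

fun drive :: "real \<Rightarrow> real \<Rightarrow> (int \<times> int) set \<Rightarrow> (int \<times> int \<Rightarrow> real) \<Rightarrow> nat \<Rightarrow> int \<times> int" where
  "drive p_o p_b T u 0 = (0, 0)"
| "drive p_o p_b T u (Suc i) =
     (let z = drive p_o p_b T u i in
      if u z \<le> (if z \<in> T then p_b else p_o) then (fst z + 1, snd z + 1) else (fst z - 1, snd z + 1))"

lemma Ywalk_eq_drive: "Ywalk p_o p_b \<omega> (0, 0) i = drive p_o p_b (trace \<omega>) (snd \<omega>) i"
  by (induction i) (auto simp: Let_def)

lemma snd_drive: "snd (drive p_o p_b T u i) = int i"
  by (induction i) (auto simp: Let_def)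

lemma fst_drive_bound: "\<bar>fst (drive p_o p_b T u i)\<bar> \<le> int i"
  by (induction i) (auto simp: Let_def)

text \<open>The number of right-steps if every visited site were treated as occupied. Each time
  level contributes a fresh uniform variable, so under \<open>uniforms\<close> this behaves like a
  binomial count whatever T is.\<close>

definition coins :: "real \<Rightarrow> real \<Rightarrow> (int \<times> int) set \<Rightarrow> (int \<times> int \<Rightarrow> real) \<Rightarrow> nat \<Rightarrow> real" where
  "coins p_o p_b T u n = (\<Sum>i<n. of_bool (u (drive p_o p_b T u i) \<le> p_b))"

text \<open>At an occupied site the true step is 2 * coin - 1. At a vacant one it is at least -1,
  hence falls short of this value by at most 2.\<close>

lemma fst_drive_ge:
  assumes "p_o \<le> p_b"
  shows "real_of_int (fst (drive p_o p_b T u n)) \<ge> 2 * coins p_o p_b T u n - real n - 2 * real (card {i. i < n \<and> drive p_o p_b T u i \<notin> T})"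
proof (induction n)
  case (Suc n)
  let ?y = "drive p_o p_b T u"
  have "{i. i < Suc n \<and> ?y i \<notin> T} = (if ?y n \<in> T then {i. i < n \<and> ?y i \<notin> T} else insert n {i. i < n \<and> ?y i \<notin> T})"
    by (auto simp: less_Suc_eq)
  then have "card {i. i < Suc n \<and> ?y i \<notin> T} = card {i. i < n \<and> ?y i \<notin> T} + of_bool (?y n \<notin> T)"
    by simp
  then show ?case using Suc assms by (auto simp: coins_def Let_def)
qed (simp add: coins_def)

lemma drive_cong:
  assumes "\<And>z. snd z < int n \<Longrightarrow> u z = u' z"
  shows "drive p_o p_b T u n = drive p_o p_b T u' n"
  using assms
proof (induction n)
  case (Suc n)
  then have "drive p_o p_b T u n = drive p_o p_b T u' n" by simp
  moreover have "u (drive p_o p_b T u n) = u' (drive p_o p_b T u n)" using Suc.prems by (simp add: snd_drive)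
  ultimately show ?case by (simp add: Let_def)
qed simp

lemma coins_cong:
  assumes "\<And>z. snd z < int n \<Longrightarrow> u z = u' z"
  shows "coins p_o p_b T u n = coins p_o p_b T u' n"
  unfolding coins_def
proof (rule sum.cong[OF refl])
  fix i assume i: "i \<in> {..<n}"
  then have "drive p_o p_b T u i = drive p_o p_b T u' i" using assms by (intro drive_cong) auto
  moreover have "u (drive p_o p_b T u i) = u' (drive p_o p_b T u i)" using i assms by (simp add: snd_drive)
  ultimately show "(of_bool (u (drive p_o p_b T u i) \<le> p_b) :: real) = of_bool (u' (drive p_o p_b T u' i) \<le> p_b)" by simp
qed

section \<open>Concentration of the coins\<close>

lemma space_uniforms[simp]: "space uniforms = UNIV"
  by (simp add: uniforms_def space_PiM)

lemma prob_space_uniform: "prob_space (uniform_measure lborel {0..1::real})"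
  by (rule prob_space_uniform_measure) auto

lemma prob_space_uniforms: "prob_space uniforms"
  unfolding uniforms_def by (intro prob_space_PiM prob_space_uniform)

lemma measurable_uniforms[measurable]: "(\<lambda>u. u z) \<in> borel_measurable uniforms"
  using measurable_component_singleton[of z UNIV "\<lambda>_. uniform_measure lborel {0..1::real}"]
  by (simp add: uniforms_def)

lemma measurable_drive:
  assumes T: "\<And>z. Measurable.pred M (\<lambda>\<omega>. z \<in> T \<omega>)" and u: "\<And>z. (\<lambda>\<omega>. u \<omega> z) \<in> borel_measurable M"
  shows "(\<lambda>\<omega>. drive p_o p_b (T \<omega>) (u \<omega>) n) \<in> M \<rightarrow>\<^sub>M count_space UNIV"
proof (induction n)
  case (Suc n)
  have [measurable]: "Measurable.pred M (\<lambda>\<omega>. z \<in> T \<omega>)" "(\<lambda>\<omega>. u \<omega> z) \<in> borel_measurable M" for z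
    by (rule T u)+
  have "(\<lambda>\<omega>. (\<lambda>z \<omega>. if u \<omega> z \<le> (if z \<in> T \<omega> then p_b else p_o) then (fst z + 1, snd z + 1) else (fst z - 1, snd z + 1)) (drive p_o p_b (T \<omega>) (u \<omega>) n) \<omega>) \<in> M \<rightarrow>\<^sub>M count_space UNIV"
    by (rule measurable_compose_countable[OF _ Suc]) measurable
  then show ?case by (simp add: Let_def)
qed simp

lemma measurable_coins:
  assumes T: "\<And>z. Measurable.pred M (\<lambda>\<omega>. z \<in> T \<omega>)" and u: "\<And>z. (\<lambda>\<omega>. u \<omega> z) \<in> borel_measurable M"
  shows "(\<lambda>\<omega>. coins p_o p_b (T \<omega>) (u \<omega>) n) \<in> borel_measurable M"
proof -
  have [measurable]: "(\<lambda>\<omega>. u \<omega> z) \<in> borel_measurable M" for z by (rule u)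
  have "(\<lambda>\<omega>. (\<lambda>z \<omega>. of_bool (u \<omega> z \<le> p_b) :: real) (drive p_o p_b (T \<omega>) (u \<omega>) i) \<omega>) \<in> borel_measurable M" for i
    by (rule measurable_compose_countable[OF _ measurable_drive[OF T u]]) measurable
  then show ?thesis unfolding coins_def by (intro borel_measurable_sum) simp
qed

lemma emeasure_uniform_le:
  assumes "0 \<le> p" "p \<le> 1"
  shows "emeasure uniforms {u. u z \<le> p} = ennreal p"
proof -
  have "uniform_measure lborel {0..1::real} = distr uniforms (uniform_measure lborel {0..1}) (\<lambda>u. u z)"
    unfolding uniforms_def by (subst distr_PiM_component) (auto intro: prob_space_uniform)
  then have "emeasure (uniform_measure lborel {0..1::real}) {..p} = emeasure (distr uniforms (uniform_measure lborel {0..1}) (\<lambda>u. u z)) {..p}"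
    by simp
  also have "\<dots> = emeasure uniforms {u. u z \<le> p}"
    by (subst emeasure_distr) (auto simp: vimage_def)
  moreover have "emeasure (uniform_measure lborel {0..1::real}) {..p} = ennreal p"
  proof -
    have "{0..1} \<inter> {..p} = {0..p}" using assms by auto
    then show ?thesis using assms by (simp add: emeasure_uniform_measure divide_ennreal_def)
  qed
  ultimately show ?thesis by simp
qed

text \<open>Hoeffding's lemma for p minus a Bernoulli variable of mean p, whose two values are at
  distance 1.\<close>

lemma bernoulli_exp_le:
  fixes p l :: real
  assumes "0 \<le> p" "p \<le> 1" "0 \<le> l"
  shows "p * exp (- l * (1 - p)) + (1 - p) * exp (l * p) \<le> exp (l\<^sup>2 / 8)"
proof -
  have "0 \<le> (1 - p) * (exp l - 1)" using assms by simp
  then have pos: "0 < 1 + (1 - p) * (exp l - 1)" by linarith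
  have "- l * (1 - p) + ln (1 + (1 - p) * (exp l - 1)) \<le> l\<^sup>2 / 8"
    using Hoeffdings_lemma_aux[of l "1 - p"] assms by simp
  then have "exp (- l * (1 - p)) * (1 + (1 - p) * (exp l - 1)) \<le> exp (l\<^sup>2 / 8)"
    using pos by (metis exp_add exp_le_cancel_iff exp_ln)
  also have "exp (- l * (1 - p)) * (1 + (1 - p) * (exp l - 1)) = p * exp (- l * (1 - p)) + (1 - p) * (exp (- l * (1 - p)) * exp l)"
    by (simp add: algebra_simps)
  also have "exp (- l * (1 - p)) * exp l = exp (l * p)" by (simp add: exp_add[symmetric] algebra_simps)
  finally show ?thesis .
qed

text \<open>The next coin sits at a random site. Splitting by the position z at time n, the past
  uses only levels below n while the coin is \<open>u z\<close> on level n, so the expectation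
  factors; the bound on the coin factor is the same for all z, and the pieces recombine.\<close>

lemma coins_exponential_moment:
  assumes p: "0 \<le> p_b" "p_b \<le> 1" and l: "0 \<le> l"
  shows "(\<integral>\<^sup>+u. ennreal (exp (l * (real n * p_b - coins p_o p_b T u n))) \<partial>uniforms) \<le> ennreal (exp (real n * (l\<^sup>2 / 8)))"
proof (induction n)
  case 0
  interpret prob_space uniforms by (rule prob_space_uniforms)
  show ?case by (simp add: coins_def emeasure_space_1[simplified])
next
  case (Suc n)
  interpret prob_space uniforms by (rule prob_space_uniforms)
  let ?y = "\<lambda>u. drive p_o p_b T u n"
  let ?w = "\<lambda>u. exp (l * (real n * p_b - coins p_o p_b T u n))"
  let ?c = "\<lambda>z u. exp (l * (p_b - of_bool (u z \<le> p_b)))"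
  define Z where "Z = {- int n..int n} \<times> {int n}"
  have ym[measurable]: "?y \<in> uniforms \<rightarrow>\<^sub>M count_space UNIV" by (rule measurable_drive) auto
  have wm[measurable]: "(\<lambda>u. coins p_o p_b T u n) \<in> borel_measurable uniforms" by (rule measurable_coins) auto
  have yZ: "?y u \<in> Z" for u
    using fst_drive_bound[of p_o p_b T u n] snd_drive[of p_o p_b T u n] by (cases "?y u") (auto simp: Z_def)
  have split: "ennreal (exp (l * (real (Suc n) * p_b - coins p_o p_b T u (Suc n)))) =
     (\<Sum>z\<in>Z. (ennreal (?w u) * indicator {u. ?y u = z} u) * ennreal (?c z u))" for u
  proof -
    have "(\<Sum>z\<in>Z. (ennreal (?w u) * indicator {u. ?y u = z} u) * ennreal (?c z u)) =
      (\<Sum>z\<in>{?y u}. (ennreal (?w u) * indicator {u. ?y u = z} u) * ennreal (?c z u))"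
      by (rule sum.mono_neutral_right) (use yZ in \<open>auto simp: Z_def indicator_def split: if_splits\<close>)
    also have "\<dots> = ennreal (?w u * ?c (?y u) u)" by (simp add: ennreal_mult)
    also have "?w u * ?c (?y u) u = exp (l * (real (Suc n) * p_b - coins p_o p_b T u (Suc n)))"
      by (simp add: exp_add[symmetric] coins_def algebra_simps)
    finally show ?thesis by simp
  qed
  have coin: "(\<integral>\<^sup>+u. ennreal (?c z u) \<partial>uniforms) \<le> ennreal (exp (l\<^sup>2 / 8))" for z
  proof -
    have le: "{u. u z \<le> p_b} \<in> events" by (rule sets_Collect_UNIV) auto
    have e1: "prob {u. u z \<le> p_b} = p_b" using emeasure_uniform_le[OF p, of z] p by (simp add: emeasure_eq_measure)
    have e2: "prob (- {u. u z \<le> p_b}) = 1 - p_b" using prob_compl[OF le] e1 by (simp add: Compl_eq_Diff_UNIV)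
    have "(\<integral>\<^sup>+u. ennreal (?c z u) \<partial>uniforms) = (\<integral>\<^sup>+u. ennreal (exp (- l * (1 - p_b))) * indicator {u. u z \<le> p_b} u + ennreal (exp (l * p_b)) * indicator (- {u. u z \<le> p_b}) u \<partial>uniforms)"
      by (intro nn_integral_cong) (auto simp: indicator_def algebra_simps)
    also have "\<dots> = ennreal (exp (- l * (1 - p_b))) * emeasure uniforms {u. u z \<le> p_b} + ennreal (exp (l * p_b)) * emeasure uniforms (- {u. u z \<le> p_b})"
    proof -
      have "- {u. u z \<le> p_b} \<in> events" using sets.compl_sets[OF le] by (simp add: Compl_eq_Diff_UNIV)
      then show ?thesis using le by (subst nn_integral_add) (simp_all add: nn_integral_cmult)
    qed
    also have "\<dots> = ennreal (exp (- l * (1 - p_b)) * p_b + exp (l * p_b) * (1 - p_b))"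
      using p by (simp add: emeasure_eq_measure e1 e2 ennreal_mult)
    also have "\<dots> \<le> ennreal (exp (l\<^sup>2 / 8))"
      using bernoulli_exp_le[OF p l] by (intro ennreal_leI) (simp add: mult.commute)
    finally show ?thesis .
  qed
  have indep: "(\<integral>\<^sup>+u. (ennreal (?w u) * indicator {u. ?y u = z} u) * ennreal (?c z u) \<partial>uniforms) =
    (\<integral>\<^sup>+u. ennreal (?w u) * indicator {u. ?y u = z} u \<partial>uniforms) * (\<integral>\<^sup>+u. ennreal (?c z u) \<partial>uniforms)" if "z \<in> Z" for z
  proof -
    define F where "F j u = (if j then ennreal (?w u) * indicator {u. ?y u = z} u else ennreal (?c z u))" for j u
    define K where "K j = (if j then {z. snd z < int n} else {z})" for j
    have "(\<integral>\<^sup>+u. (\<Prod>j\<in>(UNIV::bool set). F j u) \<partial>uniforms) = (\<Prod>j\<in>(UNIV::bool set). \<integral>\<^sup>+u. F j u \<partial>uniforms)"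
      unfolding uniforms_def
    proof (rule nn_integral_PiM_prod_disjoint[where K=K])
      show "disjoint_family_on K UNIV" using that by (auto simp: disjoint_family_on_def K_def Z_def)
      fix j :: bool and u u' :: "int \<times> int \<Rightarrow> real" assume eq: "\<And>i. i \<in> K j \<Longrightarrow> u i = u' i"
      show "F j u = F j u'"
      proof (cases j)
        case True
        then have "\<And>v. snd v < int n \<Longrightarrow> u v = u' v" using eq by (simp add: K_def)
        then have "coins p_o p_b T u n = coins p_o p_b T u' n" "?y u = ?y u'"
          using coins_cong drive_cong by blast+
        then show ?thesis using True by (simp add: F_def indicator_def)
      next
        case False
        then have "u z = u' z" using eq by (simp add: K_def)
        then show ?thesis using False by (simp add: F_def)
      qed
    next
      fix j
      have "F j \<in> borel_measurable uniforms" unfolding F_def by (cases j) simp_all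
      then show "F j \<in> borel_measurable (Pi\<^sub>M UNIV (\<lambda>_. uniform_measure lborel {0..1}))" by (simp add: uniforms_def)
    qed (auto intro: prob_space_uniform)
    then show ?thesis by (simp add: UNIV_bool F_def mult.commute)
  qed
  have "(\<integral>\<^sup>+u. ennreal (exp (l * (real (Suc n) * p_b - coins p_o p_b T u (Suc n)))) \<partial>uniforms) =
     (\<Sum>z\<in>Z. \<integral>\<^sup>+u. (ennreal (?w u) * indicator {u. ?y u = z} u) * ennreal (?c z u) \<partial>uniforms)"
    unfolding split by (rule nn_integral_sum) simp
  also have "\<dots> \<le> (\<Sum>z\<in>Z. (\<integral>\<^sup>+u. ennreal (?w u) * indicator {u. ?y u = z} u \<partial>uniforms) * ennreal (exp (l\<^sup>2 / 8)))"
    by (intro sum_mono) (simp add: indep mult_left_mono[OF coin])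
  also have "\<dots> = (\<integral>\<^sup>+u. (\<Sum>z\<in>Z. ennreal (?w u) * indicator {u. ?y u = z} u) \<partial>uniforms) * ennreal (exp (l\<^sup>2 / 8))"
    by (subst nn_integral_sum) (simp_all add: sum_distrib_right)
  also have "(\<integral>\<^sup>+u. (\<Sum>z\<in>Z. ennreal (?w u) * indicator {u. ?y u = z} u) \<partial>uniforms) = (\<integral>\<^sup>+u. ennreal (?w u) \<partial>uniforms)"
  proof (rule nn_integral_cong)
    fix u
    have "(\<Sum>z\<in>Z. ennreal (?w u) * indicator {u. ?y u = z} u) = (\<Sum>z\<in>{?y u}. ennreal (?w u) * indicator {u. ?y u = z} u)"
      by (rule sum.mono_neutral_right) (use yZ in \<open>auto simp: Z_def indicator_def split: if_splits\<close>)
    then show "(\<Sum>z\<in>Z. ennreal (?w u) * indicator {u. ?y u = z} u) = ennreal (?w u)" by simp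
  qed
  also have "(\<integral>\<^sup>+u. ennreal (?w u) \<partial>uniforms) * ennreal (exp (l\<^sup>2 / 8)) \<le> ennreal (exp (real n * (l\<^sup>2 / 8))) * ennreal (exp (l\<^sup>2 / 8))"
    by (rule mult_right_mono[OF Suc.IH]) simp
  also have "\<dots> = ennreal (exp (real (Suc n) * (l\<^sup>2 / 8)))"
    by (simp add: ennreal_mult[symmetric] exp_add[symmetric] algebra_simps)
  finally show ?case .
qed

lemma coins_lower_deviation:
  assumes p: "0 \<le> p_b" "p_b \<le> 1" and \<eta>: "0 < \<eta>"
  shows "emeasure uniforms {u. coins p_o p_b T u n \<le> real n * (p_b - \<eta>)} \<le> ennreal (exp (- 2 * \<eta>\<^sup>2 * real n))"
proof -
  \<comment> \<open>The minimizer of - l \<eta> + l^2 / 8, where the value is - 2 \<eta>^2.\<close>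
  define l where "l = 4 * \<eta>"
  have [measurable]: "(\<lambda>u. coins p_o p_b T u n) \<in> borel_measurable uniforms" by (rule measurable_coins) auto
  have m: "{u. coins p_o p_b T u n \<le> real n * (p_b - \<eta>)} \<in> sets uniforms" by (rule sets_Collect_UNIV) auto
  have "emeasure uniforms {u. coins p_o p_b T u n \<le> real n * (p_b - \<eta>)} = (\<integral>\<^sup>+u. indicator {u. coins p_o p_b T u n \<le> real n * (p_b - \<eta>)} u \<partial>uniforms)"
    using m by simp
  also have "\<dots> \<le> (\<integral>\<^sup>+u. ennreal (exp (- l * \<eta> * real n)) * ennreal (exp (l * (real n * p_b - coins p_o p_b T u n))) \<partial>uniforms)"
  proof (rule nn_integral_mono)
    fix u
    show "indicator {u. coins p_o p_b T u n \<le> real n * (p_b - \<eta>)} u \<le> ennreal (exp (- l * \<eta> * real n)) * ennreal (exp (l * (real n * p_b - coins p_o p_b T u n)))"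
    proof (cases "coins p_o p_b T u n \<le> real n * (p_b - \<eta>)")
      case True
      then have "0 \<le> l * (real n * p_b - coins p_o p_b T u n - \<eta> * real n)"
        using \<eta> by (intro mult_nonneg_nonneg) (auto simp: l_def algebra_simps)
      then have "1 \<le> exp (- l * \<eta> * real n) * exp (l * (real n * p_b - coins p_o p_b T u n))"
        by (simp add: exp_add[symmetric] algebra_simps)
      then show ?thesis using True by (simp add: ennreal_mult[symmetric] flip: ennreal_1)
    qed simp
  qed
  also have "\<dots> = ennreal (exp (- l * \<eta> * real n)) * (\<integral>\<^sup>+u. ennreal (exp (l * (real n * p_b - coins p_o p_b T u n))) \<partial>uniforms)"
    by (rule nn_integral_cmult) simp
  also have "\<dots> \<le> ennreal (exp (- l * \<eta> * real n)) * ennreal (exp (real n * (l\<^sup>2 / 8)))"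
    using \<eta> by (intro mult_left_mono coins_exponential_moment p) (auto simp: l_def)
  also have "\<dots> = ennreal (exp (- 2 * \<eta>\<^sup>2 * real n))"
    by (simp add: ennreal_mult[symmetric] exp_add[symmetric] l_def power2_eq_square algebra_simps)
  finally show ?thesis .
qed

section \<open>Ballisticity\<close>

lemma env_measure_eq: "env_measure q \<rho> = walk_env q \<rho> \<Otimes>\<^sub>M uniforms"
  by (simp add: env_measure_def walk_env_def uniforms_def)

lemma space_env_measure[simp]: "space (env_measure q \<rho>) = UNIV"
  by (simp add: env_measure_eq space_pair_measure)

lemma prob_space_env_measure: "prob_space (env_measure q \<rho>)"
  unfolding env_measure_eq by (intro prob_space_pair prob_space_walk_env prob_space_uniforms)

lemma Xwalk_eq_drive: "Xwalk p_o p_b \<omega> n = fst (drive p_o p_b (occupied (fst \<omega>)) (snd \<omega>) n)"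
  by (simp add: Xwalk_def Ywalk_eq_drive trace_eq_occupied)

lemma pred_occupied_env: "Measurable.pred (env_measure q \<rho>) (\<lambda>\<omega>. z \<in> occupied (fst \<omega>))"
  unfolding env_measure_eq by measurable

lemma measurable_uniform_env: "(\<lambda>\<omega>. snd \<omega> z) \<in> borel_measurable (env_measure q \<rho>)"
  unfolding env_measure_eq by measurable

lemma sets_escape:
  "{\<omega>. \<exists>n. real_of_int (Xwalk p_o p_b \<omega> n) < real n * v - real L} \<in> sets (env_measure q \<rho>)"
proof (rule sets_Collect_UNIV)
  have "Measurable.pred (env_measure q \<rho>) (\<lambda>\<omega>. real_of_int (fst (drive p_o p_b (occupied (fst \<omega>)) (snd \<omega>) n)) < real n * v - real L)" for n
    using measurable_compose[OF measurable_drive[OF pred_occupied_env measurable_uniform_env], of "\<lambda>y. real_of_int (fst y) < real n * v - real L" "count_space UNIV"]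
    by simp
  then show "Measurable.pred (env_measure q \<rho>) (\<lambda>\<omega>. \<exists>n. real_of_int (Xwalk p_o p_b \<omega> n) < real n * v - real L)"
    unfolding Xwalk_eq_drive by (intro pred_intros_countable)
qed simp

lemma emeasure_env_fst:
  assumes "A \<in> sets (walk_env q \<rho>)"
  shows "emeasure (env_measure q \<rho>) {\<omega>. fst \<omega> \<in> A} = emeasure (walk_env q \<rho>) A"
proof -
  interpret prob_space uniforms by (rule prob_space_uniforms)
  have "{\<omega>. fst \<omega> \<in> A} = A \<times> space uniforms" by auto
  then show ?thesis
    unfolding env_measure_eq using assms by (simp only: emeasure_pair_measure_Times sets.top emeasure_space_1 mult_1_right)
qed

definition slow_coins :: "real \<Rightarrow> real \<Rightarrow> real \<Rightarrow> nat \<Rightarrow> sample set" where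
  "slow_coins p_o p_b \<eta> n = {\<omega>. coins p_o p_b (occupied (fst \<omega>)) (snd \<omega>) n \<le> real n * (p_b - \<eta>)}"

lemma sets_slow_coins: "slow_coins p_o p_b \<eta> n \<in> sets (env_measure q \<rho>)"
proof -
  have [measurable]: "(\<lambda>\<omega>. coins p_o p_b (occupied (fst \<omega>)) (snd \<omega>) n) \<in> borel_measurable (env_measure q \<rho>)"
    by (rule measurable_coins[OF pred_occupied_env measurable_uniform_env])
  show ?thesis unfolding slow_coins_def by (rule sets_Collect_UNIV) simp_all
qed

lemma emeasure_slow_coins:
  assumes p: "0 \<le> p_b" "p_b \<le> 1" and \<eta>: "0 < \<eta>"
  shows "emeasure (env_measure q \<rho>) (slow_coins p_o p_b \<eta> n) \<le> ennreal (exp (- 2 * \<eta>\<^sup>2 * real n))"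
proof -
  interpret U: prob_space uniforms by (rule prob_space_uniforms)
  interpret W: prob_space "walk_env q \<rho>" by (rule prob_space_walk_env)
  have "emeasure (env_measure q \<rho>) (slow_coins p_o p_b \<eta> n) =
     (\<integral>\<^sup>+e. emeasure uniforms {u. coins p_o p_b (occupied e) u n \<le> real n * (p_b - \<eta>)} \<partial>walk_env q \<rho>)"
    using sets_slow_coins[of p_o p_b \<eta> n q \<rho>] unfolding env_measure_eq
    by (subst U.emeasure_pair_measure_alt) (auto simp: slow_coins_def vimage_def)
  also have "\<dots> \<le> (\<integral>\<^sup>+e. ennreal (exp (- 2 * \<eta>\<^sup>2 * real n)) \<partial>walk_env q \<rho>)"
    by (intro nn_integral_mono coins_lower_deviation p \<eta>)
  also have "\<dots> = ennreal (exp (- 2 * \<eta>\<^sup>2 * real n))"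
    using W.emeasure_space_1 by simp
  finally show ?thesis .
qed

text \<open>Serves the times n from scale k + 1 up to scale k + 2: such a path is cut into slots of
  length \<open>B ^ 4 ^ k\<close>, all of which start in the window of scale k + 2.\<close>

definition bad_scale :: "nat \<Rightarrow> real \<Rightarrow> nat \<Rightarrow> ((int \<Rightarrow> nat) \<times> (int \<times> nat \<times> int \<Rightarrow> int)) set" where
  "bad_scale B \<delta> k = {e. \<exists>z\<in>window (0, 0) (B ^ 4 ^ (k + 2)). bad (occupied e) z (B ^ 4 ^ k) (\<delta> * real (B ^ 4 ^ k))}"

lemma sets_bad_scale: "bad_scale B \<delta> k \<in> sets (walk_env q \<rho>)"
proof -
  have "bad_scale B \<delta> k = (\<Union>z\<in>window (0, 0) (B ^ 4 ^ (k + 2)). {e. bad (occupied e) z (B ^ 4 ^ k) (\<delta> * real (B ^ 4 ^ k))})"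
    by (auto simp: bad_scale_def)
  then show ?thesis by (simp add: sets.finite_UN finite_window sets_bad)
qed

lemma scale_of_time:
  fixes B :: nat
  assumes "2 \<le> B" "B ^ 4 ^ (k0 + 1) \<le> n"
  obtains k where "k0 \<le> k" "B ^ 4 ^ (k + 1) \<le> n" "n < B ^ 4 ^ (k + 2)"
proof -
  have mono: "B ^ 4 ^ i \<le> B ^ 4 ^ j" if "i \<le> j" for i j :: nat
    using assms(1) that by (intro power_increasing) auto
  have "n < 2 ^ n" by (rule less_exp)
  also have "\<dots> \<le> B ^ n" using assms(1) by (intro power_mono) auto
  also have "\<dots> \<le> B ^ 4 ^ n" using assms(1) less_exp[of n] power_mono[of 2 "4::nat" n] by (intro power_increasing) auto
  finally have ex: "\<exists>j. n < B ^ 4 ^ j" by blast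
  define j where "j = (LEAST j. n < B ^ 4 ^ j)"
  have j: "n < B ^ 4 ^ j" unfolding j_def by (rule LeastI_ex[OF ex])
  have "k0 + 1 < j"
  proof (rule ccontr)
    assume "\<not> k0 + 1 < j"
    then have "B ^ 4 ^ j \<le> B ^ 4 ^ (k0 + 1)" by (intro mono) simp
    then show False using assms(2) j by simp
  qed
  then obtain k where k: "j = k + 2" "k0 \<le> k" by (metis add.commute add_2_eq_Suc' less_iff_Suc_add add_Suc_right plus_1_eq_Suc le_add1)
  have "\<not> n < B ^ 4 ^ (k + 1)" using not_less_Least[of "k + 1" "\<lambda>j. n < B ^ 4 ^ j"] k(1) by (simp add: j_def)
  then show ?thesis using that[of k] k j by simp
qed

lemma vacant_count_le:
  assumes B: "2 \<le> B" and \<delta>: "0 \<le> \<delta>" and n: "B ^ 4 ^ (k + 1) \<le> n" "n < B ^ 4 ^ (k + 2)"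
    and good: "e \<notin> bad_scale B \<delta> k" and \<gamma>: "lazy_path \<gamma>" "\<gamma> 0 = 0"
  shows "real (card {i. i < n \<and> (\<gamma> i, int i) \<notin> occupied e}) \<le> 2 * \<delta> * real n"
proof -
  define L where "L = B ^ 4 ^ k"
  \<comment> \<open>The extra slot makes the slots cover all times below n. The overshoot is at most
    L \<le> n, whence the factor 2 in the conclusion.\<close>
  define N where "N = n div L + 1"
  have L: "0 < L" "L \<le> n"
  proof -
    have "B ^ 4 ^ k \<le> B ^ 4 ^ (k + 1)" using B by (intro power_increasing) auto
    then show "L \<le> n" using n(1) by (simp add: L_def)
  qed (use B in \<open>simp add: L_def\<close>)
  have "\<not> bad (occupied e) (\<gamma> (j * L), int (j * L)) L (\<delta> * real L)" if "j < N" for j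
  proof -
    have "j * L \<le> n" using that by (simp add: N_def) (metis div_times_less_eq_dividend le_trans less_Suc_eq_le mult_le_mono1)
    then have "int (j * L) \<le> int (B ^ 4 ^ (k + 2))" using n(2) by (intro of_nat_mono) simp
    then have "(\<gamma> (j * L), int (j * L)) \<in> window (0, 0) (B ^ 4 ^ (k + 2))"
      using lazy_path_bound[OF \<gamma>(1), of 0 "j * L"] \<gamma>(2) by (auto simp: window_def)
    then show ?thesis using good by (auto simp: bad_scale_def L_def)
  qed
  then have none: "{j. j < N \<and> bad (occupied e) (\<gamma> (j * L), 0 + int (j * L)) L (\<delta> * real L)} = {}" by auto
  have "n \<le> N * L" using L(1) by (simp add: N_def) (metis add.commute dividend_less_div_times less_imp_le)
  then have "card {i. i < n \<and> (\<gamma> i, int i) \<notin> occupied e} \<le> card {i. i < N * L \<and> (\<gamma> i, 0 + int i) \<notin> occupied e}"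
    by (intro card_mono) auto
  then have "real (card {i. i < n \<and> (\<gamma> i, int i) \<notin> occupied e}) \<le> real (card {i. i < N * L \<and> (\<gamma> i, 0 + int i) \<notin> occupied e})"
    by (rule of_nat_mono)
  also have "\<dots> \<le> real N * (\<delta> * real L)"
    using vacant_count_le_bad_slots[OF \<gamma>(1), of N L 0 "occupied e" "\<delta> * real L"] \<delta> unfolding none by simp
  also have "\<dots> = \<delta> * real (N * L)" by simp
  also have "\<dots> \<le> \<delta> * real (2 * n)"
  proof -
    have "N * L \<le> 2 * n" using L(2) by (simp add: N_def) (metis add_mono div_times_less_eq_dividend mult_2 add.commute)
    then show ?thesis using \<delta> by (intro mult_left_mono of_nat_mono) auto
  qed
  finally show ?thesis by simp
qed

text \<open>As X moves at speed at most 1 and v \<le> 1, an escape at time n forces L \<le> 2n, so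
  only times from n0, half of L rounded up, matter. The speed margin w is spent evenly: 2 * (w / 4)
  on slow coins, and 2 * (2 * (w / 8)) on vacant sites.\<close>

lemma escape_subset:
  assumes p: "p_o \<le> p_b" "p_b \<le> 1" and B: "2 \<le> B"
    and w: "0 < w" "v = 2 * p_b - 1 - w" and k0: "B ^ 4 ^ (k0 + 1) \<le> n0" and n0: "L \<le> 2 * n0" "2 * n0 \<le> L + 1"
  shows "{\<omega>. \<exists>n. real_of_int (Xwalk p_o p_b \<omega> n) < real n * v - real L} \<subseteq>
    (\<Union>j. {\<omega>. fst \<omega> \<in> bad_scale B (w / 8) (k0 + j)}) \<union> (\<Union>j. slow_coins p_o p_b (w / 4) (n0 + j))"
proof
  fix \<omega> assume "\<omega> \<in> {\<omega>. \<exists>n. real_of_int (Xwalk p_o p_b \<omega> n) < real n * v - real L}"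
  then obtain n where n: "real_of_int (Xwalk p_o p_b \<omega> n) < real n * v - real L" by blast
  let ?y = "drive p_o p_b (occupied (fst \<omega>)) (snd \<omega>)"
  have X: "real_of_int (Xwalk p_o p_b \<omega> n) = real_of_int (fst (?y n))" by (simp add: Xwalk_eq_drive)
  have "L \<le> 2 * n"
  proof (rule ccontr)
    assume "\<not> L \<le> 2 * n"
    then have "real (2 * n) \<le> real L" by (intro of_nat_mono) simp
    moreover have "\<bar>real_of_int (fst (?y n))\<bar> \<le> real n" using fst_drive_bound[of p_o p_b _ _ n] by (metis of_int_abs of_int_le_iff of_int_of_nat_eq)
    moreover have "real n * v \<le> real n * 1" using p w by (intro mult_left_mono) auto
    ultimately show False using n X by simp
  qed
  then have nn0: "n0 \<le> n" using n0 by simp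
  show "\<omega> \<in> (\<Union>j. {\<omega>. fst \<omega> \<in> bad_scale B (w / 8) (k0 + j)}) \<union> (\<Union>j. slow_coins p_o p_b (w / 4) (n0 + j))"
  proof (rule ccontr)
    assume notin: "\<omega> \<notin> (\<Union>j. {\<omega>. fst \<omega> \<in> bad_scale B (w / 8) (k0 + j)}) \<union> (\<Union>j. slow_coins p_o p_b (w / 4) (n0 + j))"
    obtain k where k: "k0 \<le> k" "B ^ 4 ^ (k + 1) \<le> n" "n < B ^ 4 ^ (k + 2)"
      using scale_of_time[OF B order_trans[OF k0 nn0]] by blast
    have good: "fst \<omega> \<notin> bad_scale B (w / 8) k" using notin k(1) le_Suc_ex[OF k(1)] by auto
    have fast: "\<omega> \<notin> slow_coins p_o p_b (w / 4) n" using notin le_Suc_ex[OF nn0] by auto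
    have "lazy_path (\<lambda>i. fst (?y i))" by (auto simp: lazy_path_def Let_def)
    then have "real (card {i. i < n \<and> (fst (?y i), int i) \<notin> occupied (fst \<omega>)}) \<le> 2 * (w / 8) * real n"
      using w by (intro vacant_count_le[OF B _ k(2,3) good]) auto
    moreover have "(fst (?y i), int i) = ?y i" for i by (simp add: prod_eq_iff snd_drive)
    ultimately have vac: "real (card {i. i < n \<and> ?y i \<notin> occupied (fst \<omega>)}) \<le> 2 * (w / 8) * real n" by simp
    have "real n * (p_b - w / 4) < coins p_o p_b (occupied (fst \<omega>)) (snd \<omega>) n"
      using fast by (simp add: slow_coins_def)
    moreover have "real n * v = 2 * (real n * (p_b - w / 4)) - real n - 2 * (2 * (w / 8) * real n)"
      unfolding w(2) by (simp add: algebra_simps)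
    ultimately show False
      using fst_drive_ge[OF p(1), of "occupied (fst \<omega>)" "snd \<omega>" n] vac n X by linarith
  qed
qed

lemma emeasure_UN_geometric:
  assumes A: "\<And>j. A j \<in> sets M" "\<And>j. emeasure M (A j) \<le> ennreal (a * r ^ j)"
    and r: "0 \<le> r" "r < 1" and a: "0 \<le> a"
  shows "emeasure M (\<Union>j. A j) \<le> ennreal (a / (1 - r))"
proof -
  have "emeasure M (\<Union>j. A j) \<le> (\<Sum>j. emeasure M (A j))"
    using A by (intro emeasure_subadditive_countably) auto
  also have "\<dots> \<le> (\<Sum>j. ennreal (a * r ^ j))" by (intro suminf_le A) auto
  also have "\<dots> = ennreal (a / (1 - r))"
  proof (rule suminf_ennreal_eq)
    show "(\<lambda>j. a * r ^ j) sums (a / (1 - r))" using sums_mult[OF geometric_sums[of r], of a] r by simp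
  qed (use r a in simp)
  finally show ?thesis .
qed

lemma measure_escape_le:
  assumes p: "p_o \<le> p_b" "0 \<le> p_b" "p_b \<le> 1" and B: "2 \<le> B"
    and w: "0 < w" "v = 2 * p_b - 1 - w" and k0: "B ^ 4 ^ (k0 + 1) \<le> n0" and n0: "L \<le> 2 * n0" "2 * n0 \<le> L + 1"
    and env: "\<And>k. measure (walk_env q \<rho>) (bad_scale B (w / 8) k) \<le> 1 / real B ^ (8 ^ k)"
  shows "measure (env_measure q \<rho>) {\<omega>. \<exists>n. real_of_int (Xwalk p_o p_b \<omega> n) < real n * v - real L} \<le>
    2 / real B ^ (8 ^ k0) + exp (- (w\<^sup>2 / 8) * real n0) / (1 - exp (- (w\<^sup>2 / 8)))"
proof -
  interpret prob_space "env_measure q \<rho>" by (rule prob_space_env_measure)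
  interpret W: prob_space "walk_env q \<rho>" by (rule prob_space_walk_env)
  define U1 where "U1 = (\<Union>j. {\<omega> :: sample. fst \<omega> \<in> bad_scale B (w / 8) (k0 + j)})"
  define U2 where "U2 = (\<Union>j. slow_coins p_o p_b (w / 4) (n0 + j))"
  let ?r = "exp (- (w\<^sup>2 / 8))"
  have s1: "{\<omega> :: sample. fst \<omega> \<in> bad_scale B (w / 8) k} \<in> events" for k
  proof -
    have "fst \<in> env_measure q \<rho> \<rightarrow>\<^sub>M walk_env q \<rho>" unfolding env_measure_eq by measurable
    from measurable_sets[OF this sets_bad_scale] show ?thesis by (simp add: vimage_def)
  qed
  have "emeasure (env_measure q \<rho>) U1 \<le> ennreal ((1 / real B ^ (8 ^ k0)) / (1 - 1 / 2))"
    unfolding U1_def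
  proof (rule emeasure_UN_geometric)
    fix j
    \<comment> \<open>A crude linear bound on the exponent is enough to dominate the sum over the
      scales by a geometric series of ratio 1 / 2.\<close>
    have "8 ^ k0 + j \<le> 8 ^ (k0 + j)"
    proof -
      have "1 + j \<le> 8 ^ j" by (induction j) auto
      then have "8 ^ k0 * (1 + j) \<le> 8 ^ k0 * (8::nat) ^ j" by (intro mult_left_mono) auto
      then have "8 ^ k0 + j * 8 ^ k0 \<le> (8::nat) ^ (k0 + j)" by (simp add: power_add algebra_simps)
      moreover have "j * 1 \<le> j * 8 ^ k0" by (intro mult_left_mono) auto
      ultimately show ?thesis by linarith
    qed
    then have "real B ^ (8 ^ k0) * real B ^ j \<le> real B ^ (8 ^ (k0 + j))"
      using B unfolding power_add[symmetric] by (intro power_increasing) auto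
    moreover have "real B ^ (8 ^ k0) * 2 ^ j \<le> real B ^ (8 ^ k0) * real B ^ j"
      using B by (intro mult_left_mono power_mono) auto
    ultimately have "real B ^ (8 ^ k0) * 2 ^ j \<le> real B ^ (8 ^ (k0 + j))" by (rule order_trans[rotated])
    then have "1 / real B ^ (8 ^ (k0 + j)) \<le> 1 / (real B ^ (8 ^ k0) * 2 ^ j)"
      using B by (intro divide_left_mono mult_pos_pos zero_less_power) auto
    then have "measure (walk_env q \<rho>) (bad_scale B (w / 8) (k0 + j)) \<le> 1 / real B ^ (8 ^ k0) * (1 / 2) ^ j"
      using env[of "k0 + j"] by (simp add: power_divide)
    then show "emeasure (env_measure q \<rho>) {\<omega>. fst \<omega> \<in> bad_scale B (w / 8) (k0 + j)} \<le> ennreal (1 / real B ^ (8 ^ k0) * (1 / 2) ^ j)"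
      unfolding emeasure_env_fst[OF sets_bad_scale] W.emeasure_eq_measure by (rule ennreal_leI)
  qed (use s1 in auto)
  then have m1: "prob U1 \<le> 2 / real B ^ (8 ^ k0)"
    by (simp add: emeasure_eq_measure mult.commute)
  have r: "0 \<le> ?r" "?r < 1" using w by auto
  have "emeasure (env_measure q \<rho>) U2 \<le> ennreal (exp (- (w\<^sup>2 / 8) * real n0) / (1 - ?r))"
    unfolding U2_def
  proof (rule emeasure_UN_geometric)
    fix j
    have "exp (- 2 * (w / 4)\<^sup>2 * real (n0 + j)) = exp (- (w\<^sup>2 / 8) * real n0) * ?r ^ j"
      by (simp add: power_divide exp_of_nat_mult[symmetric] exp_add[symmetric] algebra_simps)
    then show "emeasure (env_measure q \<rho>) (slow_coins p_o p_b (w / 4) (n0 + j)) \<le> ennreal (exp (- (w\<^sup>2 / 8) * real n0) * ?r ^ j)"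
      using emeasure_slow_coins[OF p(2,3), of "w / 4" q \<rho> p_o "n0 + j"] w by simp
  qed (use r sets_slow_coins in auto)
  then have m2: "prob U2 \<le> exp (- (w\<^sup>2 / 8) * real n0) / (1 - ?r)"
    using r by (simp add: emeasure_eq_measure)
  have "U1 \<in> events" "U2 \<in> events" unfolding U1_def U2_def using s1 sets_slow_coins by auto
  then have "prob {\<omega>. \<exists>n. real_of_int (Xwalk p_o p_b \<omega> n) < real n * v - real L} \<le> prob (U1 \<union> U2)"
    using escape_subset[OF p(1,3) B w k0 n0] unfolding U1_def[symmetric] U2_def[symmetric]
    by (intro finite_measure_mono) auto
  also have "\<dots> \<le> prob U1 + prob U2" using \<open>U1 \<in> events\<close> \<open>U2 \<in> events\<close> by (rule measure_Un_le)
  finally show ?thesis using m1 m2 by linarith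
qed

section \<open>From scales to the bound in L\<close>

lemma powr_three_halves: "0 \<le> (x::real) \<Longrightarrow> x powr (3 / 2) = sqrt x ^ 3"
  by (cases "x = 0") (simp_all add: powr_half_sqrt[symmetric] powr_power)

text \<open>Lets the coin term, exponentially small in L, be absorbed into the slower decay. When ln
  x > 1 the power is at most (ln x)^2, and ln x = 2 ln (sqrt x) \<le> 2 sqrt x.\<close>

lemma ln_powr_three_halves_le:
  fixes x :: real
  assumes "1 \<le> x"
  shows "ln x powr (3 / 2) \<le> 5 * x"
proof -
  have "ln x = 2 * ln (sqrt x)" using assms by (simp add: ln_sqrt)
  also have "\<dots> \<le> 2 * sqrt x" using ln_le_minus_one[of "sqrt x"] assms by simp
  finally have "(ln x)\<^sup>2 \<le> (2 * sqrt x)\<^sup>2" using assms by (intro power_mono) auto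
  then have sq: "(ln x)\<^sup>2 \<le> 4 * x" using assms by (simp add: power_mult_distrib)
  show ?thesis
  proof (cases "ln x \<le> 1")
    case True
    then have "ln x powr (3 / 2) \<le> 1 powr (3 / 2)" using assms by (intro powr_mono2) auto
    then show ?thesis using assms by simp
  next
    case False
    then have "ln x powr (3 / 2) \<le> ln x powr 2" by (intro powr_mono) auto
    also have "\<dots> = (ln x)\<^sup>2" using False by simp
    finally show ?thesis using sq assms by linarith
  qed
qed

text \<open>With 2 \<le> B absorbing the factor 2, ln L \<le> (1 + 16 * 4^k0) ln B \<le> 17 * 4^k0
  ln B. Raising this to the power 3/2 turns 4^k0 into 8^k0, the exponent of B on the left.\<close>

lemma scale_decay:
  fixes B :: nat
  assumes B: "2 \<le> B" and L: "1 \<le> L" "L \<le> 2 * B ^ 4 ^ (k0 + 2)"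
  shows "1 / real B ^ (8 ^ k0) \<le> exp (- (ln (real B) / sqrt (17 * ln (real B)) ^ 3) * ln (real L) powr (3 / 2))"
proof -
  define b where "b = ln (real B)"
  have b: "0 < b" using B by (simp add: b_def)
  have "real L \<le> real B * real B ^ 4 ^ (k0 + 2)"
  proof -
    have "2 * B ^ 4 ^ (k0 + 2) \<le> B * B ^ 4 ^ (k0 + 2)" using B by (intro mult_right_mono) auto
    then have "real L \<le> real (B * B ^ 4 ^ (k0 + 2))" using L by (intro of_nat_mono) linarith
    then show ?thesis by simp
  qed
  then have "ln (real L) \<le> ln (real B * real B ^ 4 ^ (k0 + 2))"
    using L B by (intro ln_mono) auto
  also have "\<dots> = b + real (4 ^ (k0 + 2)) * b" using B by (simp only: b_def ln_mult_pos ln_realpow zero_less_power of_nat_0_less_iff)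
  also have "\<dots> \<le> 4 ^ k0 * (17 * b)" using b mult_right_mono[of 1 "4 ^ k0" b] by (simp add: power_add)
  finally have "sqrt (ln (real L)) \<le> sqrt (4 ^ k0 * (17 * b))" by (rule real_sqrt_le_mono)
  also have "\<dots> = 2 ^ k0 * sqrt (17 * b)"
    by (simp add: real_sqrt_mult real_sqrt_power)
  finally have "sqrt (ln (real L)) ^ 3 \<le> (2 ^ k0 * sqrt (17 * b)) ^ 3" using L by (intro power_mono) auto
  also have "\<dots> = 8 ^ k0 * sqrt (17 * b) ^ 3"
    by (simp add: power_mult_distrib power_mult[symmetric] mult.commute[of k0]) (simp add: power_mult)
  finally have "ln (real L) powr (3 / 2) \<le> 8 ^ k0 * sqrt (17 * b) ^ 3" using L by (subst powr_three_halves) auto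
  then have "(b / sqrt (17 * b) ^ 3) * ln (real L) powr (3 / 2) \<le> (b / sqrt (17 * b) ^ 3) * (8 ^ k0 * sqrt (17 * b) ^ 3)"
    using b by (intro mult_left_mono) auto
  also have "\<dots> = real (8 ^ k0) * b" using b by simp
  finally have "exp (- (real (8 ^ k0) * b)) \<le> exp (- (b / sqrt (17 * b) ^ 3) * ln (real L) powr (3 / 2))" by simp
  moreover have "exp (- (real (8 ^ k0) * b)) = 1 / real B ^ (8 ^ k0)"
    using B by (simp only: exp_minus exp_of_nat_mult b_def) (simp add: divide_inverse)
  ultimately show ?thesis unfolding b_def[symmetric] by (simp only:)
qed

lemma escape_probability:
  assumes q: "0 < q" "q < 1" and p: "p_o \<le> p_b" "0 \<le> p_b" "p_b \<le> 1" and v: "v < 2 * p_b - 1"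
  shows "\<exists>\<rho>_s > 0. \<exists>c > 0. \<forall>\<rho> \<ge> \<rho>_s. \<forall>L::nat. L \<ge> 1 \<longrightarrow>
    measure (env_measure q \<rho>) {\<omega>. \<exists>n. real_of_int (Xwalk p_o p_b \<omega> n) < real n * v - real L}
      \<le> (1 / c) * exp (- c * (ln (real L)) powr (3 / 2))"
proof -
  define w where "w = 2 * p_b - 1 - v"
  have w: "0 < w" "v = 2 * p_b - 1 - w" using v by (auto simp: w_def)
  obtain B \<rho>0 where B: "6 \<le> (B::nat)" and \<rho>0: "0 < \<rho>0"
    and env: "\<And>\<rho> k. \<rho>0 \<le> \<rho> \<Longrightarrow> measure (walk_env q \<rho>) (bad_scale B (w / 8) k) \<le> 1 / real B ^ (8 ^ k)"
    using env_good_at_all_scales[OF q, of "w / 8"] w unfolding bad_scale_def by auto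
  define a where "a = w\<^sup>2 / 8"
  define C where "C = 1 / (1 - exp (- a))"
  define c1 where "c1 = ln (real B) / sqrt (17 * ln (real B)) ^ 3"
  \<comment> \<open>Chosen so that c2 * 5 L = a L / 2 \<le> a n0, where 5 L is the bound from
    \<open>ln_powr_three_halves_le\<close>.\<close>
  define c2 where "c2 = a / 10"
  define Y where "Y = 10 * real (B ^ 4)"
  \<comment> \<open>\<open>c1\<close> handles the environment term, \<open>c2\<close> the coin term
    and 1 / (2 + C) the prefactor. exp (- Y) makes the claimed bound at least 1 when L \<le> 2 *
    B^4, since Y bounds the power of the logarithm there.\<close>
  define c where "c = min (min c1 c2) (min (1 / (2 + C)) (exp (- Y)))"
  have a: "0 < a" using w by (simp add: a_def)
  have C: "0 < C" using a by (simp add: C_def)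
  have pos: "0 < c1" "0 < c2" using B a by (auto simp: c1_def c2_def)
  have c: "0 < c" "c \<le> c1" "c \<le> c2" "c \<le> 1 / (2 + C)" "c \<le> exp (- Y)"
    using pos C by (auto simp: c_def)
  have c1': "c \<le> 1" using c(5) by (rule order_trans) (simp add: Y_def)
  have "measure (env_measure q \<rho>) {\<omega>. \<exists>n. real_of_int (Xwalk p_o p_b \<omega> n) < real n * v - real L}
      \<le> (1 / c) * exp (- c * (ln (real L)) powr (3 / 2))" if \<rho>: "\<rho>0 \<le> \<rho>" and L: "1 \<le> L" for \<rho> and L :: nat
  proof -
    interpret prob_space "env_measure q \<rho>" by (rule prob_space_env_measure)
    define y where "y = ln (real L) powr (3 / 2)"
    have y: "0 \<le> y" "y \<le> 5 * real L" using ln_powr_three_halves_le[of "real L"] L by (auto simp: y_def)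
    define n0 where "n0 = (L + 1) div 2"
    have n0: "L \<le> 2 * n0" "2 * n0 \<le> L + 1" by (auto simp: n0_def)
    show ?thesis
    proof (cases "B ^ 4 ^ (0 + 1) \<le> n0")
      case False
      then have "L \<le> 2 * B ^ 4" using n0 by simp
      then have "real L \<le> real (2 * B ^ 4)" by (rule of_nat_mono)
      then have "y \<le> Y" using y by (simp add: Y_def)
      then have "c * y \<le> 1 * Y" using c1' c(1) y(1) by (intro mult_mono) auto
      then have "c \<le> exp (- c * y)" using c(5) by (smt (verit, best) exp_le_cancel_iff mult_minus_left)
      then have "1 \<le> (1 / c) * exp (- c * y)" using c(1) by (simp add: field_simps)
      then show ?thesis using prob_le_1 order_trans unfolding y_def by blast
    next
      case True
      obtain k0 where k0: "B ^ 4 ^ (k0 + 1) \<le> n0" "n0 < B ^ 4 ^ (k0 + 2)"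
        using scale_of_time[OF _ True] B by auto
      have "prob {\<omega>. \<exists>n. real_of_int (Xwalk p_o p_b \<omega> n) < real n * v - real L} \<le>
         2 / real B ^ (8 ^ k0) + exp (- (w\<^sup>2 / 8) * real n0) / (1 - exp (- (w\<^sup>2 / 8)))"
        using B by (intro measure_escape_le[OF p _ w k0(1) n0 env[OF \<rho>]]) auto
      also have "\<dots> = 2 * (1 / real B ^ (8 ^ k0)) + C * exp (- a * real n0)"
        by (simp add: a_def C_def)
      also have "\<dots> \<le> 2 * exp (- c * y) + C * exp (- c * y)"
      proof (intro add_mono mult_left_mono)
        have "1 / real B ^ (8 ^ k0) \<le> exp (- c1 * y)"
          unfolding c1_def y_def using B L n0 k0 by (intro scale_decay) auto
        also have "\<dots> \<le> exp (- c * y)" using c(2) y(1) by (simp add: mult_right_mono)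
        finally show "1 / real B ^ (8 ^ k0) \<le> exp (- c * y)" .
        have "c * y \<le> c2 * (5 * real L)" using c(1,3) y pos by (intro mult_mono) auto
        also have "\<dots> = a * (real L / 2)" by (simp add: c2_def)
        also have "\<dots> \<le> a * real n0"
        proof (rule mult_left_mono)
          have "real L \<le> real (2 * n0)" using n0(1) by (rule of_nat_mono)
          then show "real L / 2 \<le> real n0" by simp
        qed (use a in simp)
        finally show "exp (- a * real n0) \<le> exp (- c * y)" by simp
      qed (use C in auto)
      also have "\<dots> = (2 + C) * exp (- c * y)" by (simp add: algebra_simps)
      also have "\<dots> \<le> (1 / c) * exp (- c * y)"
      proof (rule mult_right_mono)
        show "2 + C \<le> 1 / c" using c(1,4) C by (simp add: field_simps)
      qed simp
      finally show ?thesis by (simp only: y_def)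
    qed
  qed
  then show ?thesis using \<rho>0 c(1) by blast
qed

theorem theorem1p5:
  fixes q p_o p_b :: real
  assumes "0 < q" "q < 1"
    and "0 \<le> p_o" "p_o \<le> 1" "0 \<le> p_b" "p_b \<le> 1"
    and "2 * p_o - 1 < 2 * p_b - 1"
  shows "\<forall>v_s. 2 * p_o - 1 \<le> v_s \<and> v_s < 2 * p_b - 1 \<longrightarrow>
    (\<exists>\<rho>_s > 0. \<exists>c > 0. \<forall>\<rho> \<ge> \<rho>_s. \<forall>L::nat. L \<ge> 1 \<longrightarrow>
       (let E = {\<omega> \<in> space (env_measure q \<rho>).
                   \<exists>n::nat. real_of_int (Xwalk p_o p_b \<omega> n) < real n * v_s - real L}
        in E \<in> sets (env_measure q \<rho>) \<and>
           measure (env_measure q \<rho>) E \<le> (1 / c) * exp (- c * (ln (real L)) powr (3/2))))"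
proof (intro allI impI)
  fix v_s assume v: "2 * p_o - 1 \<le> v_s \<and> v_s < 2 * p_b - 1"
  have p: "p_o \<le> p_b" using assms(7) by simp
  show "\<exists>\<rho>_s > 0. \<exists>c > 0. \<forall>\<rho> \<ge> \<rho>_s. \<forall>L::nat. L \<ge> 1 \<longrightarrow>
       (let E = {\<omega> \<in> space (env_measure q \<rho>).
                   \<exists>n::nat. real_of_int (Xwalk p_o p_b \<omega> n) < real n * v_s - real L}
        in E \<in> sets (env_measure q \<rho>) \<and>
           measure (env_measure q \<rho>) E \<le> (1 / c) * exp (- c * (ln (real L)) powr (3/2)))"
    using escape_probability[OF assms(1,2) p assms(5,6), of v_s] v
    by (simp add: Let_def sets_escape)
qed

end
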